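(* Let $\Omega\subset\mathbb{R}^d$, $d\ge2$, be a bounded Lipschitz domain. Then $\sigma^{(\Lambda)}_1\le\sqrt{-\Lambda}$ for all $\Lambda<0$.
   Context: For $\Lambda<0$, the Dirichlet-to-Neumann map $\mathcal{D}_\Lambda$ sends $u\in H^{1/2}(\partial\Omega)$ to $\partial_nU$, where $U\in H^1(\Omega)$ uniquely solves $-\Delta U=\Lambda U$ in $\Omega$, $U|_{\partial\Omega}=u$, and $\partial_n$ is the exterior normal derivative; it is self-adjoint in $L^2(\partial\Omega)$ with discrete spectrum, and $\sigma^{(\Lambda)}_1$ is its smallest eigenvalue. *)

theory Defs
  imports "HOL-Analysis.Analysis"
begin

definition lipschitz_domain :: "'a::euclidean_space set \<Rightarrow> bool" where
  "lipschitz_domain \<Omega> \<longleftrightarrow>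
     open \<Omega> \<and> connected \<Omega> \<and> \<Omega> \<noteq> {} \<and>
     (\<forall>p \<in> frontier \<Omega>. \<exists>e r L (\<gamma> :: 'a \<Rightarrow> real).
        norm e = 1 \<and> r > 0 \<and> L-lipschitz_on {y. y \<bullet> e = 0} \<gamma> \<and>
        (\<forall>x \<in> ball p r. x \<in> \<Omega> \<longleftrightarrow> x \<bullet> e < \<gamma> (x - (x \<bullet> e) *\<^sub>R e)))"

definition hausdorff_const :: "real \<Rightarrow> real" where
  "hausdorff_const s = pi powr (s / 2) / (Gamma (s / 2 + 1) * 2 powr s)"

definition hausdorff_pre :: "real \<Rightarrow> real \<Rightarrow> 'a::euclidean_space set \<Rightarrow> ennreal" where
  "hausdorff_pre s \<delta> A =
     (INF C \<in> {C :: nat \<Rightarrow> 'a set. A \<subseteq> (\<Union>i. C i) \<and> (\<forall>i. bounded (C i) \<and> diameter (C i) \<le> \<delta>)}.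
        (\<Sum>i. ennreal (hausdorff_const s * diameter (C i) powr s)))"

text \<open>The s-dimensional Hausdorff outer measure (normalised so that for integer s it
agrees with s-dimensional surface area).\<close>
definition hausdorff_outer :: "real \<Rightarrow> 'a::euclidean_space set \<Rightarrow> ennreal" where
  "hausdorff_outer s A = (SUP \<delta> \<in> {0<..}. hausdorff_pre s \<delta> A)"

definition hausdorff_measure :: "real \<Rightarrow> 'a::euclidean_space measure" where
  "hausdorff_measure s = measure_of UNIV (sets borel) (hausdorff_outer s)"

definition surface_measure :: "'a::euclidean_space set \<Rightarrow> 'a measure" where
  "surface_measure \<Omega> = restrict_space (hausdorff_measure (real DIM('a) - 1)) (frontier \<Omega>)"

definition C1_grad :: "('a::euclidean_space \<Rightarrow> real) \<Rightarrow> ('a \<Rightarrow> 'a) \<Rightarrow> bool" where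
  "C1_grad \<phi> D\<phi> \<longleftrightarrow> (\<forall>x. (\<phi> has_derivative (\<lambda>h. D\<phi> x \<bullet> h)) (at x)) \<and> continuous_on UNIV D\<phi>"

definition weak_gradient :: "'a::euclidean_space set \<Rightarrow> ('a \<Rightarrow> real) \<Rightarrow> ('a \<Rightarrow> 'a) \<Rightarrow> bool" where
  "weak_gradient \<Omega> U G \<longleftrightarrow>
     (\<forall>\<phi> D\<phi>. C1_grad \<phi> D\<phi> \<and> compact (closure {x. \<phi> x \<noteq> 0}) \<and> closure {x. \<phi> x \<noteq> 0} \<subseteq> \<Omega> \<longrightarrow>
        (\<forall>b \<in> Basis.
           integrable (lebesgue_on \<Omega>) (\<lambda>x. U x * (D\<phi> x \<bullet> b)) \<and>
           integrable (lebesgue_on \<Omega>) (\<lambda>x. (G x \<bullet> b) * \<phi> x) \<and>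
           integral\<^sup>L (lebesgue_on \<Omega>) (\<lambda>x. U x * (D\<phi> x \<bullet> b))
             = - integral\<^sup>L (lebesgue_on \<Omega>) (\<lambda>x. (G x \<bullet> b) * \<phi> x)))"

definition H1 :: "'a::euclidean_space set \<Rightarrow> ('a \<Rightarrow> real) \<Rightarrow> ('a \<Rightarrow> 'a) \<Rightarrow> bool" where
  "H1 \<Omega> U G \<longleftrightarrow>
     U \<in> borel_measurable (lebesgue_on \<Omega>) \<and> G \<in> borel_measurable (lebesgue_on \<Omega>) \<and>
     integrable (lebesgue_on \<Omega>) (\<lambda>x. (U x)\<^sup>2) \<and>
     integrable (lebesgue_on \<Omega>) (\<lambda>x. (norm (G x))\<^sup>2) \<and>
     weak_gradient \<Omega> U G"

definition is_trace :: "'a::euclidean_space set \<Rightarrow> ('a \<Rightarrow> real) \<Rightarrow> ('a \<Rightarrow> 'a) \<Rightarrow> ('a \<Rightarrow> real) \<Rightarrow> bool" where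
  "is_trace \<Omega> U G u \<longleftrightarrow>
     u \<in> borel_measurable (surface_measure \<Omega>) \<and>
     integrable (surface_measure \<Omega>) (\<lambda>x. (u x)\<^sup>2) \<and>
     (\<exists>\<phi> D\<phi>. (\<forall>n. C1_grad (\<phi> n) (D\<phi> n) \<and> compact (closure {x. \<phi> n x \<noteq> 0})) \<and>
        (\<lambda>n. \<integral>\<^sup>+ x. ennreal ((\<phi> n x - U x)\<^sup>2 + (norm (D\<phi> n x - G x))\<^sup>2) \<partial>lebesgue_on \<Omega>)
          \<longlonglongrightarrow> 0 \<and>
        (\<lambda>n. \<integral>\<^sup>+ x. ennreal ((\<phi> n x - u x)\<^sup>2) \<partial>surface_measure \<Omega>) \<longlonglongrightarrow> 0)"

text \<open>sigma is an eigenvalue of the Dirichlet-to-Neumann map D_Lambda: there is a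
nonzero u in H^{1/2}(boundary) (= trace of some U in H^1) whose solution U of
-Delta U = Lambda U with U = u on the boundary has (weak) exterior normal derivative
sigma u, i.e. for all V in H^1(Omega) with trace v,
  int_Omega grad U . grad V - Lambda U V = int_boundary (sigma u) v  (Green's formula).\<close>
definition DtN_eigenvalue :: "'a::euclidean_space set \<Rightarrow> real \<Rightarrow> real \<Rightarrow> bool" where
  "DtN_eigenvalue \<Omega> \<Lambda> \<sigma> \<longleftrightarrow>
     (\<exists>U G u. H1 \<Omega> U G \<and> is_trace \<Omega> U G u \<and>
        \<not> (AE x in surface_measure \<Omega>. u x = 0) \<and>
        (\<forall>V W v. H1 \<Omega> V W \<and> is_trace \<Omega> V W v \<longrightarrow>
           integral\<^sup>L (lebesgue_on \<Omega>) (\<lambda>x. G x \<bullet> W x - \<Lambda> * U x * V x)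
             = integral\<^sup>L (surface_measure \<Omega>) (\<lambda>x. \<sigma> * u x * v x)))"

definition DtN_sigma1 :: "'a::euclidean_space set \<Rightarrow> real \<Rightarrow> real" where
  "DtN_sigma1 \<Omega> \<Lambda> = (LEAST \<sigma>. DtN_eigenvalue \<Omega> \<Lambda> \<sigma>)"

end

(* Since the Rayleigh quotient of D_Lambda is (int_Omega |grad U|^2 - Lambda U^2) / (int_boundary U^2),
   the bound follows by testing with U(x) = exp(k x.b), k = sqrt(-Lambda), b a coordinate vector: there
   the numerator is 2 k^2 int_Omega U^2, and slicing in the direction b gives
   2 k int_Omega U^2 <= int_boundary U^2. The sharp constant here needs that orthogonal projection does
   not increase measure, i.e. Lebesgue measure on a hyperplane is at most the Hausdorff measure; this is
   the isodiametric inequality, proved by Steiner symmetrization.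

   That sigma_1, a LEAST, is attained requires a minimiser. Minimising sequences of C^1 functions
   have boundary values which are precompact in L^2: comparing a boundary value with the averages over
   finitely many balls at depth comparable to delta costs only O(delta) times the Dirichlet energy,
   integrating along the cone of directions that point into the Lipschitz domain. *)
theory Submission
  imports Defs "HOL-Complex_Analysis.Great_Picard"
begin

section \<open>Hausdorff measure\<close>

text \<open>With k = sqrt(-\<Lambda>) the form |grad U|^2 - \<Lambda> U^2 is the squared L2 norm of
  the pair (k U, grad U), so it controls U itself. Compactness is therefore asked of boundary values
  alone: interior convergence of a minimising sequence follows from the parallelogram law and the
  completeness of L2. Since \<open>is_trace\<close> describes joint L2 limits of compactly supported
  C1 functions, in the interior and on the boundary, minimality and the Euler-Lagrange equation are
  proved for such test functions and carried over by limits.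

  Compactness on the boundary rests on bounds of order \<rho>^(n-1) for the surface measure of balls
  of radius \<rho>, n being the dimension: they make the kernel 1/t^n, produced by the volume
  element along the cone of inward directions, integrable with a total mass independent of the
  depth. The same bounds make the surface measure finite, which the exchange of integrals and the
  square integrability of test functions require.

  The exponential lacks compact support and is therefore truncated outside a ball containing the
  closure of \<Omega>.\<close>

lemma hausdorff_pre_le:
  assumes "A \<subseteq> (\<Union>i. C i)" "\<And>i. bounded (C i) \<and> diameter (C i) \<le> \<delta>"
  shows "hausdorff_pre s \<delta> A \<le> (\<Sum>i. ennreal (hausdorff_const s * diameter (C i) powr s))"
  unfolding hausdorff_pre_def by (rule INF_lower) (use assms in auto)

lemma hausdorff_pre_mono: "A \<subseteq> B \<Longrightarrow> hausdorff_pre s \<delta> A \<le> hausdorff_pre s \<delta> B"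
  unfolding hausdorff_pre_def by (rule INF_superset_mono) auto

lemma hausdorff_pre_antimono: "\<delta> \<le> \<delta>' \<Longrightarrow> hausdorff_pre s \<delta>' A \<le> hausdorff_pre s \<delta> A"
  unfolding hausdorff_pre_def by (rule INF_superset_mono) (auto intro: order_trans)

lemma hausdorff_pre_empty: "\<delta> > 0 \<Longrightarrow> hausdorff_pre s \<delta> ({}::'a::euclidean_space set) = 0"
  using hausdorff_pre_le[of "{}::'a set" "\<lambda>_. {}" \<delta> s] by (simp add: diameter_def)

text \<open>Covers of the \<open>A i\<close> that are optimal up to e/2^(i+1) merge into one
  sequence through \<open>prod_decode\<close>. If the right side is infinite the claim is trivial;
  otherwise every term is finite, so such covers exist.\<close>

lemma hausdorff_pre_countable_subadditive:
  fixes A :: "nat \<Rightarrow> 'a::euclidean_space set"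
  shows "hausdorff_pre s \<delta> (\<Union>i. A i) \<le> (\<Sum>i. hausdorff_pre s \<delta> (A i))"
proof (cases "(\<Sum>i. hausdorff_pre s \<delta> (A i)) = top")
  case False
  let ?w = "\<lambda>C::'a set. ennreal (hausdorff_const s * diameter C powr s)"
  have fin: "hausdorff_pre s \<delta> (A i) < top" for i
    by (rule ennreal_suminf_lessD[OF less_top[THEN iffD1, OF False]])
  show ?thesis
  proof (rule ennreal_le_epsilon)
    fix e :: real assume e: "e > 0"
    have "\<exists>C. A i \<subseteq> (\<Union>j. C j) \<and> (\<forall>j. bounded (C j) \<and> diameter (C j) \<le> \<delta>) \<and>
            (\<Sum>j. ?w (C j)) \<le> hausdorff_pre s \<delta> (A i) + ennreal (e * (1/2)^Suc i)" for i
    proof -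
      have "hausdorff_pre s \<delta> (A i) < hausdorff_pre s \<delta> (A i) + ennreal (e * (1/2)^Suc i)"
      proof -
        obtain r where r: "hausdorff_pre s \<delta> (A i) = ennreal r" "r \<ge> 0"
          using fin[of i] by (cases "hausdorff_pre s \<delta> (A i)") auto
        have "ennreal r < ennreal (r + e * (1/2)^Suc i)" using r e by (intro ennreal_lessI) (auto simp: add_nonneg_pos)
        also have "\<dots> = ennreal r + ennreal (e * (1/2)^Suc i)" using r e by (intro ennreal_plus) auto
        finally show ?thesis unfolding r .
      qed
      then show ?thesis
        unfolding hausdorff_pre_def INF_less_iff by (auto intro: less_imp_le)
    qed
    then obtain C where C: "\<And>i. A i \<subseteq> (\<Union>j. C i j)"
      "\<And>i j. bounded (C i j) \<and> diameter (C i j) \<le> \<delta>"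
      "\<And>i. (\<Sum>j. ?w (C i j)) \<le> hausdorff_pre s \<delta> (A i) + ennreal (e * (1/2)^Suc i)"
      by metis
    have half: "(\<Sum>i. ennreal (e * (1/2)^Suc i)) = ennreal e"
    proof -
      have "(\<lambda>i. e * (1/2)^Suc i) sums (e * 1)" by (intro sums_mult power_half_series)
      then have "(\<Sum>i. ennreal (e * (1/2)^Suc i)) = ennreal (e * 1)"
        by (rule suminf_ennreal_eq[rotated]) (use e in simp)
      then show ?thesis by simp
    qed
    have "hausdorff_pre s \<delta> (\<Union>i. A i) \<le> (\<Sum>n. ?w (case_prod C (prod_decode n)))"
    proof (rule hausdorff_pre_le)
      show "(\<Union>i. A i) \<subseteq> (\<Union>n. case_prod C (prod_decode n))"
      proof
        fix x assume "x \<in> (\<Union>i. A i)"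
        then obtain i where "x \<in> A i" by auto
        with C(1) obtain j where "x \<in> C i j" by blast
        then have "x \<in> case_prod C (prod_decode (prod_encode (i, j)))" by simp
        then show "x \<in> (\<Union>n. case_prod C (prod_decode n))" by (rule UN_I[OF UNIV_I])
      qed
    qed (use C(2) in \<open>auto split: prod.split\<close>)
    also have "\<dots> = (\<Sum>i. \<Sum>j. ?w (C i j))"
      using suminf_ennreal_2dimen[of "\<lambda>i. \<Sum>j. ?w (C i j)" "\<lambda>p. ?w (case_prod C p)"] by (simp add: o_def)
    also have "\<dots> \<le> (\<Sum>i. hausdorff_pre s \<delta> (A i) + ennreal (e * (1/2)^Suc i))"
      by (rule suminf_le) (use C(3) in auto)
    also have "\<dots> = (\<Sum>i. hausdorff_pre s \<delta> (A i)) + ennreal e"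
      by (subst suminf_add[symmetric]) (use half in auto)
    finally show "hausdorff_pre s \<delta> (\<Union>i. A i) \<le> (\<Sum>i. hausdorff_pre s \<delta> (A i)) + ennreal e" .
  qed
qed simp

lemma hausdorff_outer_mono: "A \<subseteq> B \<Longrightarrow> hausdorff_outer s A \<le> hausdorff_outer s B"
  unfolding hausdorff_outer_def by (rule SUP_mono) (use hausdorff_pre_mono in blast)

lemma hausdorff_pre_le_outer: "\<delta> > 0 \<Longrightarrow> hausdorff_pre s \<delta> A \<le> hausdorff_outer s A"
  unfolding hausdorff_outer_def by (rule SUP_upper) auto

lemma hausdorff_outer_countable_subadditive:
  "hausdorff_outer s (\<Union>i. A i) \<le> (\<Sum>i. hausdorff_outer s (A i))"
  unfolding hausdorff_outer_def[of s "\<Union>i. A i"]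
proof (rule SUP_least)
  fix \<delta> :: real assume "\<delta> \<in> {0<..}"
  then have "(\<Sum>i. hausdorff_pre s \<delta> (A i)) \<le> (\<Sum>i. hausdorff_outer s (A i))"
    by (intro suminf_le hausdorff_pre_le_outer) auto
  then show "hausdorff_pre s \<delta> (\<Union>i. A i) \<le> (\<Sum>i. hausdorff_outer s (A i))"
    using hausdorff_pre_countable_subadditive order_trans by blast
qed

lemma hausdorff_outer_empty: "hausdorff_outer s {} = 0"
  unfolding hausdorff_outer_def using hausdorff_pre_empty by (auto intro!: SUP_eqI)

lemma outer_measure_space_hausdorff: "outer_measure_space UNIV (hausdorff_outer s)"
  unfolding outer_measure_space_def positive_def increasing_def countably_subadditive_def
  using hausdorff_outer_mono hausdorff_outer_empty hausdorff_outer_countable_subadditive by auto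

section \<open>Additivity on separated sets and the Caratheodory criterion\<close>

lemma hausdorff_outer_subadditive: "hausdorff_outer s (A \<union> B) \<le> hausdorff_outer s A + hausdorff_outer s B"
proof -
  have "hausdorff_outer s (\<Union>i. (if i = 0 then A else if i = Suc 0 then B else {}))
      \<le> (\<Sum>i. hausdorff_outer s (if i = 0 then A else if i = Suc 0 then B else {}))"
    by (rule hausdorff_outer_countable_subadditive)
  also have "\<dots> = (\<Sum>i\<in>{0, Suc 0}. hausdorff_outer s (if i = 0 then A else if i = Suc 0 then B else {}))"
    by (rule suminf_finite) (auto simp: hausdorff_outer_empty)
  also have "\<dots> = hausdorff_outer s A + hausdorff_outer s B" by simp
  also have "(\<Union>i. (if i = (0::nat) then A else if i = Suc 0 then B else {})) = A \<union> B"
    by (auto split: if_splits)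
  finally show ?thesis .
qed

text \<open>A set of diameter at most \<delta> cannot meet both \<open>A\<close> and
  \<open>B\<close> when they are further than \<delta> apart, so every cover of the union splits
  into a cover of \<open>A\<close> and a cover of \<open>B\<close> that share no nonempty
  member.\<close>

lemma hausdorff_pre_separated:
  fixes A B :: "'a::euclidean_space set"
  assumes sep: "\<And>x y. x \<in> A \<Longrightarrow> y \<in> B \<Longrightarrow> dist x y > \<delta>" and "\<delta> > 0"
  shows "hausdorff_pre s \<delta> A + hausdorff_pre s \<delta> B \<le> hausdorff_pre s \<delta> (A \<union> B)"
  unfolding hausdorff_pre_def[of s \<delta> "A \<union> B"]
proof (rule INF_greatest)
  let ?w = "\<lambda>C::'a set. ennreal (hausdorff_const s * diameter C powr s)"
  fix C :: "nat \<Rightarrow> 'a set"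
  assume "C \<in> {C. A \<union> B \<subseteq> (\<Union>i. C i) \<and> (\<forall>i. bounded (C i) \<and> diameter (C i) \<le> \<delta>)}"
  then have C: "A \<union> B \<subseteq> (\<Union>i. C i)" "\<And>i. bounded (C i)" "\<And>i. diameter (C i) \<le> \<delta>" by auto
  let ?P = "\<lambda>X i. if C i \<inter> X \<noteq> {} then C i else {}"
  have cov: "hausdorff_pre s \<delta> X \<le> (\<Sum>i. ?w (?P X i))" if X: "X \<subseteq> (\<Union>i. C i)" for X
  proof (rule hausdorff_pre_le)
    show "X \<subseteq> (\<Union>i. ?P X i)"
    proof
      fix x assume "x \<in> X"
      then obtain i where "x \<in> C i" using X by blast
      then have "x \<in> ?P X i" using \<open>x \<in> X\<close> by auto
      then show "x \<in> (\<Union>i. ?P X i)" by blast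
    qed
    show "bounded (?P X i) \<and> diameter (?P X i) \<le> \<delta>" for i
      using C(2,3)[of i] \<open>\<delta> > 0\<close> by simp
  qed
  have "hausdorff_pre s \<delta> A + hausdorff_pre s \<delta> B \<le> (\<Sum>i. ?w (?P A i)) + (\<Sum>i. ?w (?P B i))"
    by (intro add_mono cov) (use C in auto)
  also have "\<dots> = (\<Sum>i. ?w (?P A i) + ?w (?P B i))" by (rule suminf_add) auto
  also have "\<dots> \<le> (\<Sum>i. ?w (C i))"
  proof (rule suminf_le)
    fix i
    have "C i \<inter> A = {} \<or> C i \<inter> B = {}"
    proof (rule ccontr)
      assume "\<not> ?thesis"
      then obtain x y where xy: "x \<in> C i" "x \<in> A" "y \<in> C i" "y \<in> B" by auto
      then have "dist x y \<le> \<delta>" using C(3)[of i] diameter_bounded_bound[OF C(2) xy(1,3)] by linarith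
      with sep xy show False by fastforce
    qed
    then show "?w (?P A i) + ?w (?P B i) \<le> ?w (C i)" by (auto simp: diameter_def)
  qed auto
  finally show "hausdorff_pre s \<delta> A + hausdorff_pre s \<delta> B \<le> (\<Sum>i. ?w (C i))" .
qed

text \<open>This is the metric outer measure property. The supremum over scales is approached by
  small scales, at which \<open>hausdorff_pre\<close> is already superadditive on the two
  sets.\<close>

lemma hausdorff_outer_separated:
  fixes A B :: "'a::euclidean_space set"
  assumes sep: "\<And>x y. x \<in> A \<Longrightarrow> y \<in> B \<Longrightarrow> dist x y \<ge> \<eta>" and "\<eta> > 0"
  shows "hausdorff_outer s (A \<union> B) = hausdorff_outer s A + hausdorff_outer s B"
proof (rule antisym)
  show "hausdorff_outer s (A \<union> B) \<le> hausdorff_outer s A + hausdorff_outer s B"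
    by (rule hausdorff_outer_subadditive)
  have small: "hausdorff_pre s \<delta> A + hausdorff_pre s \<delta>' B \<le> hausdorff_outer s (A \<union> B)"
    if "\<delta> > 0" "\<delta>' > 0" for \<delta> \<delta>'
  proof -
    \<comment> \<open>The scale must lie below both given ones and strictly below \<eta>, because
      \<open>hausdorff_pre_separated\<close> asks for strict separation. Allowing two different
      scales lets the two suprema be taken one after the other.\<close>
    define d where "d = min (min \<delta> \<delta>') (\<eta>/2)"
    have d: "d > 0" "d \<le> \<delta>" "d \<le> \<delta>'" "d < \<eta>" using that \<open>\<eta> > 0\<close> by (auto simp: d_def min_def)
    have "hausdorff_pre s \<delta> A + hausdorff_pre s \<delta>' B \<le> hausdorff_pre s d A + hausdorff_pre s d B"
      by (intro add_mono hausdorff_pre_antimono d)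
    also have "\<dots> \<le> hausdorff_pre s d (A \<union> B)"
      by (rule hausdorff_pre_separated) (use sep d in force)+
    also have "\<dots> \<le> hausdorff_outer s (A \<union> B)" by (rule hausdorff_pre_le_outer) fact
    finally show ?thesis .
  qed
  have "hausdorff_outer s A + hausdorff_outer s B = (SUP \<delta>\<in>{0<..}. hausdorff_pre s \<delta> A + hausdorff_outer s B)"
    unfolding hausdorff_outer_def[of s A] by (rule ennreal_SUP_add_left[symmetric]) auto
  also have "\<dots> \<le> hausdorff_outer s (A \<union> B)"
  proof (rule SUP_least)
    fix \<delta> :: real assume \<delta>: "\<delta> \<in> {0<..}"
    have "hausdorff_pre s \<delta> A + hausdorff_outer s B = (SUP \<delta>'\<in>{0<..}. hausdorff_pre s \<delta> A + hausdorff_pre s \<delta>' B)"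
      unfolding hausdorff_outer_def[of s B] by (subst (1 2) add.commute, rule ennreal_SUP_add_left[symmetric]) auto
    also have "\<dots> \<le> hausdorff_outer s (A \<union> B)" by (rule SUP_least) (use small \<delta> in auto)
    finally show "hausdorff_pre s \<delta> A + hausdorff_outer s B \<le> hausdorff_outer s (A \<union> B)" .
  qed
  finally show "hausdorff_outer s A + hausdorff_outer s B \<le> hausdorff_outer s (A \<union> B)" .
qed

lemma hausdorff_outer_sum_separated:
  fixes D :: "nat \<Rightarrow> 'a::euclidean_space set"
  assumes "\<And>i j. i < j \<Longrightarrow> \<exists>\<eta>>0. \<forall>x\<in>D i. \<forall>y\<in>D j. dist x y \<ge> \<eta>"
  shows "(\<Sum>i<n. hausdorff_outer s (D i)) = hausdorff_outer s (\<Union>i<n. D i)"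
  using assms
proof (induction n)
  case (Suc n)
  obtain e where e: "\<And>i. i < n \<Longrightarrow> e i > 0 \<and> (\<forall>x\<in>D i. \<forall>y\<in>D n. dist x y \<ge> e i)"
  proof -
    have "\<forall>i. \<exists>\<eta>. i < n \<longrightarrow> \<eta> > 0 \<and> (\<forall>x\<in>D i. \<forall>y\<in>D n. dist x y \<ge> \<eta>)"
      using Suc.prems by meson
    then show ?thesis using that by metis
  qed
  \<comment> \<open>The inserted 1 gives the minimum a value when n = 0.\<close>
  define \<eta> where "\<eta> = Min (insert 1 (e ` {..<n}))"
  have \<eta>: "\<eta> > 0" "\<And>i. i < n \<Longrightarrow> \<eta> \<le> e i" using e by (auto simp: \<eta>_def)
  have "hausdorff_outer s ((\<Union>i<n. D i) \<union> D n) = hausdorff_outer s (\<Union>i<n. D i) + hausdorff_outer s (D n)"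
    by (rule hausdorff_outer_separated[OF _ \<eta>(1)]) (use e \<eta> in \<open>force intro: order_trans\<close>)
  moreover have "(\<Union>i<Suc n. D i) = (\<Union>i<n. D i) \<union> D n" by (auto simp: less_Suc_eq)
  ultimately show ?case using Suc by simp
qed (simp add: hausdorff_outer_empty)

text \<open>The shells of points at distance between \<open>1/(n+2)\<close> and \<open>1/(n+1)\<close> from the closed set
  are pairwise separated as soon as their indices differ by two, so that their outer measures
  are summable and the part of \<open>E\<close> near \<open>F\<close> is negligible.\<close>
lemma closed_caratheodory_hausdorff:
  fixes F E :: "'a::euclidean_space set"
  assumes "closed F"
  shows "hausdorff_outer s (E \<inter> F) + hausdorff_outer s (E - F) \<le> hausdorff_outer s E"
proof (cases "hausdorff_outer s E = top \<or> F = {}")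
  case True then show ?thesis by (auto simp: hausdorff_outer_empty)
next
  case False
  then have fin: "hausdorff_outer s E < top" and ne: "F \<noteq> {}" using less_top by blast+
  let ?H = "hausdorff_outer s"
  let ?d = "\<lambda>x. infdist x F"
  define En where "En n = {x\<in>E. ?d x \<ge> 1 / real (Suc n)}" for n
  define D where "D n = {x\<in>E. 1 / real (Suc (Suc n)) \<le> ?d x \<and> ?d x < 1 / real (Suc n)}" for n
  have dpos: "x \<notin> F \<Longrightarrow> ?d x > 0" for x
    using assms ne in_closed_iff_infdist_zero[of F x] infdist_nonneg[of x F] by fastforce
  have sepD: "\<exists>\<eta>>0. \<forall>x\<in>D i. \<forall>y\<in>D j. dist x y \<ge> \<eta>" if "Suc i < j" for i j
  proof (intro exI conjI ballI)
    have "1 / real (Suc j) < 1 / real (Suc (Suc i))" using that by (intro frac_less2) auto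
    then show "1 / real (Suc (Suc i)) - 1 / real (Suc j) > 0" by simp
    fix x y assume "x \<in> D i" "y \<in> D j"
    then have "?d x \<ge> 1 / real (Suc (Suc i))" "?d y < 1 / real (Suc j)" by (auto simp: D_def)
    moreover have "?d x \<le> ?d y + dist x y" by (rule infdist_triangle)
    ultimately show "dist x y \<ge> 1 / real (Suc (Suc i)) - 1 / real (Suc j)" by linarith
  qed
  \<comment> \<open>With \<open>a\<close> = 0 or \<open>a\<close> = 1 only every other shell is
    used, so these shells are mutually separated; their outer measures add up to that of a subset of
    \<open>E\<close>.\<close>
  have sub: "(\<Sum>i<n. ?H (D (2*i+a))) \<le> ?H E" for n a
  proof -
    have "(\<Sum>i<n. ?H (D (2*i+a))) = ?H (\<Union>i<n. D (2*i+a))"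
      by (rule hausdorff_outer_sum_separated) (rule sepD, simp)
    also have "\<dots> \<le> ?H E" by (rule hausdorff_outer_mono) (auto simp: D_def)
    finally show ?thesis .
  qed
  have split: "(\<Sum>i<2*n. ?H (D i)) = (\<Sum>i<n. ?H (D (2*i+0))) + (\<Sum>i<n. ?H (D (2*i+1)))" for n
    by (induction n) (auto simp: algebra_simps)
  have "(\<Sum>i. ?H (D i)) \<le> ?H E + ?H E"
  proof (rule suminf_le_const)
    fix n
    have "(\<Sum>i<n. ?H (D i)) \<le> (\<Sum>i<2*n. ?H (D i))" by (rule sum_mono2) auto
    also have "\<dots> \<le> ?H E + ?H E" unfolding split by (intro add_mono sub)
    finally show "(\<Sum>i<n. ?H (D i)) \<le> ?H E + ?H E" .
  qed auto
  also have "?H E + ?H E < top" using fin by (simp add: ennreal_add_less_top)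
  finally have finsum: "(\<Sum>i. ?H (D i)) < top" .
  have tail: "(\<lambda>n. \<Sum>i. ?H (D (i + n))) \<longlonglongrightarrow> 0"
  proof -
    have f1: "?H (D i) < top" for i by (rule order.strict_trans1[OF hausdorff_outer_mono fin]) (auto simp: D_def)
    define h where "h i = enn2real (?H (D i))" for i
    have h: "?H (D i) = ennreal (h i)" "h i \<ge> 0" for i using f1[of i] by (simp_all add: h_def)
    have sm: "summable h"
      by (rule summable_suminf_not_top[OF h(2)]) (use finsum h(1) in simp)
    have "(\<lambda>n. \<Sum>i. h (i + n)) \<longlonglongrightarrow> 0" using suminf_exist_split2[OF sm] .
    then have "(\<lambda>n. ennreal (\<Sum>i. h (i + n))) \<longlonglongrightarrow> ennreal 0" by (rule tendsto_ennrealI)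
    moreover have "(\<Sum>i. ?H (D (i + n))) = ennreal (\<Sum>i. h (i + n))" for n
      unfolding h(1) by (rule suminf_ennreal2) (use h(2) summable_ignore_initial_segment[OF sm, of n] in auto)
    ultimately show ?thesis by simp
  qed
  have step: "?H (E \<inter> F) + ?H (E - F) \<le> ?H E + (\<Sum>i. ?H (D (i + n)))" for n
  proof -
    have "E - F \<subseteq> En n \<union> (\<Union>i. D (i + n))"
    proof
      fix x assume x: "x \<in> E - F"
      show "x \<in> En n \<union> (\<Union>i. D (i + n))"
      proof (cases "x \<in> En n")
        case False
        then have lt: "?d x < 1 / real (Suc n)" using x by (auto simp: En_def)
        \<comment> \<open>The least m with 1/(m+1) \<le> \<open>?d x\<close> identifies the shell:
          it exceeds n because \<open>x\<close> is outside \<open>En n\<close>, and for its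
          predecessor m' the point lies in \<open>D m'\<close>.\<close>
        obtain m0 where "1 / real (Suc m0) < ?d x" using dpos[of x] x nat_approx_posE by blast
        then have ex: "\<exists>m. 1 / real (Suc m) \<le> ?d x" by (auto intro: less_imp_le)
        define m where "m = (LEAST m. 1 / real (Suc m) \<le> ?d x)"
        have m: "1 / real (Suc m) \<le> ?d x" unfolding m_def using ex by (rule LeastI_ex)
        have mn: "m > n"
        proof (rule ccontr)
          assume "\<not> m > n"
          then have "1 / real (Suc n) \<le> 1 / real (Suc m)" by (simp add: frac_le)
          with m lt show False by linarith
        qed
        then obtain m' where m': "m = Suc m'" by (cases m) auto
        then have "\<not> 1 / real (Suc m') \<le> ?d x" using not_less_Least[of m' "\<lambda>m. 1 / real (Suc m) \<le> ?d x"] m_def by simp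
        then have "x \<in> D m'" using m x m' by (auto simp: D_def)
        moreover have "m' = (m' - n) + n" using mn m' by simp
        ultimately show ?thesis by (metis UN_iff UNIV_I UnI2)
      qed simp
    qed
    then have "?H (E - F) \<le> ?H (En n \<union> (\<Union>i. D (i + n)))" by (rule hausdorff_outer_mono)
    also have "\<dots> \<le> ?H (En n) + ?H (\<Union>i. D (i + n))" by (rule hausdorff_outer_subadditive)
    also have "\<dots> \<le> ?H (En n) + (\<Sum>i. ?H (D (i + n)))"
      by (intro add_left_mono hausdorff_outer_countable_subadditive)
    finally have "?H (E \<inter> F) + ?H (E - F) \<le> (?H (E \<inter> F) + ?H (En n)) + (\<Sum>i. ?H (D (i + n)))"
      unfolding add.assoc by (rule add_left_mono)
    moreover have "?H (E \<inter> F) + ?H (En n) \<le> ?H E"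
    proof -
      have "?H (E \<inter> F) + ?H (En n) = ?H (E \<inter> F \<union> En n)"
      proof (rule hausdorff_outer_separated[symmetric])
        fix x y assume "x \<in> E \<inter> F" "y \<in> En n"
        then show "1 / real (Suc n) \<le> dist x y" using infdist_le[of x F y] by (auto simp: En_def dist_commute)
      qed auto
      also have "\<dots> \<le> ?H E" by (rule hausdorff_outer_mono) (auto simp: En_def)
      finally show ?thesis .
    qed
    ultimately show ?thesis using add_right_mono order_trans by blast
  qed
  have "(\<lambda>n. ?H E + (\<Sum>i. ?H (D (i + n)))) \<longlonglongrightarrow> ?H E + 0"
    by (intro tendsto_add tendsto_const tail)
  then have "?H (E \<inter> F) + ?H (E - F) \<le> ?H E + 0" by (rule LIMSEQ_le_const) (use step in blast)
  then show ?thesis by simp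
qed

text \<open>The Caratheodory-measurable sets form a sigma-algebra on which the outer measure is a
  measure. Closed sets belong to it, hence all Borel sets do.\<close>

lemma measure_space_hausdorff:
  "measure_space UNIV (sets (borel :: 'a::euclidean_space measure)) (hausdorff_outer s)"
proof -
  interpret P: sigma_algebra "UNIV::'a set" "UNIV" by (metis Pow_UNIV sigma_algebra_Pow)
  let ?L = "lambda_system (UNIV::'a set) UNIV (hausdorff_outer s)"
  have ms: "measure_space UNIV ?L (hausdorff_outer s)"
    by (rule P.caratheodory_lemma[OF outer_measure_space_hausdorff])
  have "F \<in> ?L" if "closed F" for F :: "'a set"
    unfolding P.lambda_system_eq
  proof (auto intro!: antisym)
    fix E
    show "hausdorff_outer s (E \<inter> F) + hausdorff_outer s (E - F) \<le> hausdorff_outer s E"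
      by (rule closed_caratheodory_hausdorff[OF that])
    show "hausdorff_outer s E \<le> hausdorff_outer s (E \<inter> F) + hausdorff_outer s (E - F)"
      using hausdorff_outer_subadditive[of s "E \<inter> F" "E - F"] by (simp add: Int_Diff_Un)
  qed
  then have "sigma_sets UNIV (Collect closed) \<subseteq> ?L"
    using sigma_algebra.sigma_sets_subset[of UNIV ?L "Collect closed"] ms by (auto simp: measure_space_def)
  moreover have "sets (borel :: 'a measure) = sigma_sets UNIV (Collect closed)"
    by (simp add: borel_eq_closed)
  ultimately show ?thesis
    using measure_down[OF ms] sets.sigma_algebra_axioms[of "borel::'a measure"] by simp
qed

lemma sets_hausdorff_measure[simp, measurable_cong]: "sets (hausdorff_measure s) = sets borel"
  unfolding hausdorff_measure_def using sets.sigma_sets_eq[of borel] by (simp add: sets_measure_of)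

lemma space_hausdorff_measure[simp]: "space (hausdorff_measure s) = UNIV"
  unfolding hausdorff_measure_def by simp

text \<open>\<open>measure_of\<close> yields zero on every set unless its set function is a measure
  on the generated sigma-algebra, so this equation is what carries the Caratheodory argument into
  \<open>hausdorff_measure\<close>.\<close>

lemma emeasure_hausdorff_measure:
  fixes A :: "'a::euclidean_space set"
  assumes "A \<in> sets borel"
  shows "emeasure (hausdorff_measure s) A = hausdorff_outer s A"
proof -
  have ms: "measure_space UNIV (sets (borel::'a measure)) (hausdorff_outer s)"
    by (rule measure_space_hausdorff)
  show ?thesis
    by (rule emeasure_measure_of[OF hausdorff_measure_def])
      (use ms assms sets_hausdorff_measure in \<open>auto simp: measure_space_def\<close>)
qed

section \<open>The isodiametric inequality\<close>

text \<open>Steiner symmetral in direction \<open>i\<close>: every line in that direction meets it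
  in the open interval centred at 0 whose length is that of the slice of \<open>A\<close>. It is set
  in a product over an arbitrary index set so that it can be used in the coordinate hyperplane
  indexed by \<open>Basis - {b}\<close>, which is not a type of its own.\<close>

definition steiner :: "'i set \<Rightarrow> 'i \<Rightarrow> ('i \<Rightarrow> real) set \<Rightarrow> ('i \<Rightarrow> real) set" where
  "steiner I i A = {x \<in> space (Pi\<^sub>M I (\<lambda>_. lborel)).
     ennreal (2 * \<bar>x i\<bar>) < emeasure lborel {t. x(i := t) \<in> A}}"

lemma emeasure_centered_interval:
  "emeasure lborel {y::real. ennreal (2 * \<bar>y\<bar>) < L} = L"
proof (cases L)
  case (real r)
  then have "{y::real. ennreal (2 * \<bar>y\<bar>) < L} = {- r/2 <..< r/2}"
    by (auto simp: ennreal_less_iff)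
  then show ?thesis using real by simp
next
  case top
  then have "{y::real. ennreal (2 * \<bar>y\<bar>) < L} = UNIV" by (simp add: ennreal_less_top)
  then show ?thesis using top by (simp add: emeasure_lborel_UNIV)
qed

lemma fun_upd_slice_sets:
  assumes "i \<in> I" "A \<in> sets (Pi\<^sub>M I (\<lambda>_. lborel :: real measure))" "x \<in> space (Pi\<^sub>M I (\<lambda>_. lborel :: real measure))"
  shows "{t. x(i := t) \<in> A} \<in> sets borel"
proof -
  have "(\<lambda>t. x(i := t)) \<in> lborel \<rightarrow>\<^sub>M Pi\<^sub>M I (\<lambda>_. lborel :: real measure)"
    by (rule measurable_fun_upd[where J=I]) (use assms in auto)
  from measurable_sets[OF this assms(2)] show ?thesis by (simp add: vimage_def)
qed

text \<open>Slice lengths depend measurably on the point, being the measures of the sections of the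
  measurable set of pairs (x, t) with \<open>x(i := t) \<in> A\<close>.\<close>

lemma steiner_sets:
  assumes "i \<in> I" and A: "A \<in> sets (Pi\<^sub>M I (\<lambda>_. lborel))"
  shows "steiner I i A \<in> sets (Pi\<^sub>M I (\<lambda>_. lborel))"
proof -
  let ?P = "Pi\<^sub>M I (\<lambda>_. lborel :: real measure)"
  have "(\<lambda>(x, t). x(i := t)) \<in> ?P \<Otimes>\<^sub>M lborel \<rightarrow>\<^sub>M ?P"
    unfolding case_prod_beta by (rule measurable_fun_upd[where J=I]) (use assms in auto)
  from measurable_sets[OF this A]
  have Q: "{(x, t). x \<in> space ?P \<and> x(i := t) \<in> A} \<in> sets (?P \<Otimes>\<^sub>M lborel)"
    by (simp add: vimage_def space_pair_measure case_prod_beta' Collect_conj_eq[symmetric] Int_def conj_commute mem_Times_iff)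
  have "(\<lambda>x. emeasure lborel (Pair x -` {(x, t). x \<in> space ?P \<and> x(i := t) \<in> A})) \<in> borel_measurable ?P"
    by (rule lborel.measurable_emeasure_Pair[OF Q])
  then have m[measurable]: "(\<lambda>x. emeasure lborel {t. x(i := t) \<in> A}) \<in> borel_measurable ?P"
    by (rule measurable_cong[THEN iffD1, rotated]) (auto intro!: arg_cong[where f="emeasure lborel"])
  have [measurable]: "(\<lambda>x. x i) \<in> ?P \<rightarrow>\<^sub>M lborel" using assms(1) by (rule measurable_component_singleton)
  have [measurable]: "(\<lambda>x. x i) \<in> borel_measurable ?P" using \<open>(\<lambda>x. x i) \<in> ?P \<rightarrow>\<^sub>M lborel\<close> by simp
  show ?thesis unfolding steiner_def by measurable
qed

text \<open>By Fubini the measure is the integral of the slice lengths in direction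
  \<open>i\<close>, and symmetrization preserves each of these, infinite ones included.\<close>

lemma emeasure_steiner:
  assumes "finite I" "i \<in> I" and A: "A \<in> sets (Pi\<^sub>M I (\<lambda>_. lborel))"
  shows "emeasure (Pi\<^sub>M I (\<lambda>_. lborel)) (steiner I i A) = emeasure (Pi\<^sub>M I (\<lambda>_. lborel)) A"
proof -
  interpret product_sigma_finite "\<lambda>_::'i. lborel :: real measure" by standard
  let ?P = "\<lambda>I. Pi\<^sub>M I (\<lambda>_. lborel :: real measure)"
  define J where "J = I - {i}"
  have J: "finite J" "i \<notin> J" "insert i J = I" using assms by (auto simp: J_def)
  have slice: "emeasure (?P I) B = (\<integral>\<^sup>+x. emeasure lborel {t. x(i := t) \<in> B} \<partial>?P J)"
    if B: "B \<in> sets (?P I)" for B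
  proof -
    have "emeasure (?P I) B = (\<integral>\<^sup>+x. indicator B x \<partial>?P I)" using B by simp
    also have "\<dots> = (\<integral>\<^sup>+ x. (\<integral>\<^sup>+ y. indicator B (x(i := y)) \<partial>lborel) \<partial>?P J)"
      using product_nn_integral_insert[OF J(1,2), of "indicator B"] B J by simp
    also have "\<dots> = (\<integral>\<^sup>+x. emeasure lborel {t. x(i := t) \<in> B} \<partial>?P J)"
    proof (rule nn_integral_cong)
      fix x assume x: "x \<in> space (?P J)"
      then have "x(i := 0) \<in> space (?P I)" using J by (auto simp: space_PiM PiE_def extensional_def)
      from fun_upd_slice_sets[OF \<open>i \<in> I\<close> B this] have "{t. x(i := t) \<in> B} \<in> sets lborel" by simp
      then have "emeasure lborel {t. x(i := t) \<in> B} = (\<integral>\<^sup>+ y. indicator {t. x(i := t) \<in> B} y \<partial>lborel)" by simp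
      then show "(\<integral>\<^sup>+ y. indicator B (x(i := y)) \<partial>lborel) = emeasure lborel {t. x(i := t) \<in> B}"
        by (simp add: indicator_def)
    qed
    finally show ?thesis .
  qed
  show ?thesis
    unfolding slice[OF A] slice[OF steiner_sets[OF \<open>i \<in> I\<close> A]]
  proof (rule nn_integral_cong)
    fix x assume x: "x \<in> space (?P J)"
    then have "x(i := t) \<in> space (?P I)" for t using J by (auto simp: space_PiM PiE_def extensional_def)
    then have "{t. x(i := t) \<in> steiner I i A} = {t. ennreal (2 * \<bar>t\<bar>) < emeasure lborel {t. x(i := t) \<in> A}}"
      by (simp add: steiner_def)
    then show "emeasure lborel {t. x(i := t) \<in> steiner I i A} = emeasure lborel {t. x(i := t) \<in> A}"
      by (simp add: emeasure_centered_interval)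
  qed
qed

text \<open>Both Sup X - Inf Y and Sup Y - Inf X are at most D; adding the two bounds the total
  length of the intervals spanned by \<open>X\<close> and \<open>Y\<close>.\<close>

lemma lengths_le_of_close:
  fixes X Y :: "real set"
  assumes close: "\<And>t u. t \<in> X \<Longrightarrow> u \<in> Y \<Longrightarrow> \<bar>t - u\<bar> \<le> D" and "X \<noteq> {}" "Y \<noteq> {}"
  shows "\<exists>p q. 0 \<le> p \<and> 0 \<le> q \<and> emeasure lborel X \<le> ennreal p \<and> emeasure lborel Y \<le> ennreal q \<and> p + q \<le> 2 * D"
proof -
  obtain t0 u0 where t0: "t0 \<in> X" and u0: "u0 \<in> Y" using assms by auto
  have bX: "bdd_above X" "bdd_below X"
    using close[OF _ u0] by (auto intro!: bdd_aboveI[of _ "u0 + D"] bdd_belowI[of _ "u0 - D"]) (smt (verit))+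
  have bY: "bdd_above Y" "bdd_below Y"
    using close[OF t0] by (auto intro!: bdd_aboveI[of _ "t0 + D"] bdd_belowI[of _ "t0 - D"]) (smt (verit))+
  have le: "Inf X \<le> Sup X" "Inf Y \<le> Sup Y" using bX bY assms by (auto intro: cInf_le_cSup)
  have "Sup X - D \<le> Inf Y"
  proof (rule cInf_greatest[OF \<open>Y \<noteq> {}\<close>])
    fix u assume "u \<in> Y"
    then have "Sup X \<le> u + D" by (intro cSup_least[OF \<open>X \<noteq> {}\<close>]) (use close in fastforce)
    then show "Sup X - D \<le> u" by simp
  qed
  moreover have "Sup Y - D \<le> Inf X"
  proof (rule cInf_greatest[OF \<open>X \<noteq> {}\<close>])
    fix u assume "u \<in> X"
    then have "Sup Y \<le> u + D" by (intro cSup_least[OF \<open>Y \<noteq> {}\<close>]) (use close in fastforce)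
    then show "Sup Y - D \<le> u" by simp
  qed
  moreover have "emeasure lborel X \<le> ennreal (Sup X - Inf X)"
  proof -
    have "emeasure lborel X \<le> emeasure lborel {Inf X..Sup X}"
      by (rule emeasure_mono) (use bX in \<open>auto intro: cInf_lower cSup_upper\<close>)
    then show ?thesis using le by simp
  qed
  moreover have "emeasure lborel Y \<le> ennreal (Sup Y - Inf Y)"
  proof -
    have "emeasure lborel Y \<le> emeasure lborel {Inf Y..Sup Y}"
      by (rule emeasure_mono) (use bY in \<open>auto intro: cInf_lower cSup_upper\<close>)
    then show ?thesis using le by simp
  qed
  ultimately show ?thesis using le
    by (intro exI[of _ "Sup X - Inf X"] exI[of _ "Sup Y - Inf Y"]) auto
qed

text \<open>With S the squared distance in the coordinates other than \<open>i\<close>, points of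
  the two slices differ by at most sqrt(\<delta>^2 - S). \<open>lengths_le_of_close\<close> bounds
  the sum of the slice lengths by twice this, and |x i| and |y i| lie below half of the respective
  lengths.\<close>

lemma steiner_diameter:
  assumes "finite I" "i \<in> I"
    and diam: "\<And>x y. x \<in> A \<Longrightarrow> y \<in> A \<Longrightarrow> (\<Sum>j\<in>I. (x j - y j)\<^sup>2) \<le> \<delta>\<^sup>2"
    and x: "x \<in> steiner I i A" and y: "y \<in> steiner I i A"
  shows "(\<Sum>j\<in>I. (x j - y j)\<^sup>2) \<le> \<delta>\<^sup>2"
proof -
  define X where "X = {t. x(i := t) \<in> A}"
  define Y where "Y = {t. y(i := t) \<in> A}"
  define S where "S = (\<Sum>j\<in>I-{i}. (x j - y j)\<^sup>2)"
  have sum: "(\<Sum>j\<in>I. (v j - w j)\<^sup>2) = (v i - w i)\<^sup>2 + (\<Sum>j\<in>I-{i}. (v j - w j)\<^sup>2)" for v w :: "_ \<Rightarrow> real"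
    using assms(1,2) by (rule sum.remove)
  have X: "ennreal (2 * \<bar>x i\<bar>) < emeasure lborel X" and Y: "ennreal (2 * \<bar>y i\<bar>) < emeasure lborel Y"
    using x y by (auto simp: steiner_def X_def Y_def)
  \<comment> \<open>The strict inequality in \<open>steiner\<close> forces positive slice measure,
    so neither slice is empty.\<close>
  then have ne: "X \<noteq> {}" "Y \<noteq> {}" by auto
  have le: "(t - u)\<^sup>2 + S \<le> \<delta>\<^sup>2" if "t \<in> X" "u \<in> Y" for t u
  proof -
    have "(\<Sum>j\<in>I-{i}. ((x(i := t)) j - (y(i := u)) j)\<^sup>2) = S"
      unfolding S_def by (rule sum.cong) auto
    then show ?thesis
      using diam[of "x(i:=t)" "y(i:=u)"] that sum[of "x(i:=t)" "y(i:=u)"] by (simp add: X_def Y_def)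
  qed
  have S: "S \<le> \<delta>\<^sup>2" using le ne by (smt (verit) ex_in_conv zero_le_power2)
  have "\<bar>t - u\<bar> \<le> sqrt (\<delta>\<^sup>2 - S)" if "t \<in> X" "u \<in> Y" for t u
    using le[OF that] by (intro real_le_rsqrt) auto
  from lengths_le_of_close[OF this ne] obtain p q where pq: "0 \<le> p" "0 \<le> q"
    "emeasure lborel X \<le> ennreal p" "emeasure lborel Y \<le> ennreal q" "p + q \<le> 2 * sqrt (\<delta>\<^sup>2 - S)" by blast
  have "2 * \<bar>x i\<bar> < p" "2 * \<bar>y i\<bar> < q"
    using order.strict_trans2[OF X pq(3)] order.strict_trans2[OF Y pq(4)] by (auto simp: ennreal_less_iff)
  then have "\<bar>x i - y i\<bar> \<le> sqrt (\<delta>\<^sup>2 - S)" using pq by linarith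
  then have "(x i - y i)\<^sup>2 \<le> \<delta>\<^sup>2 - S" using S
    by (metis abs_ge_zero diff_ge_0_iff_ge power2_abs power_mono real_sqrt_pow2)
  then show ?thesis using sum[of x y] by (simp add: S_def)
qed

lemma steiner_reflection_same:
  assumes "i \<in> I" "x \<in> steiner I i A" shows "x(i := - x i) \<in> steiner I i A"
  using assms by (auto simp: steiner_def space_PiM PiE_def extensional_def)

text \<open>A set symmetric in coordinate \<open>j\<close> has the same slice in direction
  \<open>i\<close> at a point and at its reflection, so symmetrizing in a new direction keeps the
  symmetries already obtained.\<close>

lemma steiner_reflection_other:
  assumes "i \<noteq> j" "j \<in> I" and sym: "\<And>x. x \<in> A \<Longrightarrow> x(j := - x j) \<in> A"
    and x: "x \<in> steiner I i A"
  shows "x(j := - x j) \<in> steiner I i A"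
proof -
  have "{t. (x(j := - x j))(i := t) \<in> A} = {t. x(i := t) \<in> A}"
  proof (intro Collect_cong iffI)
    fix t
    have eq: "(x(i := t))(j := - x j) = (x(j := - x j))(i := t)" using \<open>i \<noteq> j\<close> by (auto simp: fun_eq_iff)
    assume "x(i := t) \<in> A"
    from sym[OF this] show "(x(j := - x j))(i := t) \<in> A" using eq \<open>i \<noteq> j\<close> by simp
  next
    fix t
    have eq: "((x(j := - x j))(i := t))(j := x j) = x(i := t)" using \<open>i \<noteq> j\<close> by (auto simp: fun_eq_iff)
    assume "(x(j := - x j))(i := t) \<in> A"
    from sym[OF this] show "x(i := t) \<in> A" using eq \<open>i \<noteq> j\<close> by simp
  qed
  then show ?thesis using x assms(1,2) by (auto simp: steiner_def space_PiM PiE_def extensional_def)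
qed

text \<open>After symmetrizing in every coordinate the set contains -x together with x. The diameter
  bound then gives |2x| \<le> \<delta>, so the set lies in the ball of radius \<delta>/2, whose
  volume is the right-hand side.\<close>

lemma isodiametric_PiM_pos:
  fixes A :: "('i \<Rightarrow> real) set"
  assumes "finite I" and A: "A \<in> sets (Pi\<^sub>M I (\<lambda>_. lborel))" and "\<delta> > 0"
    and diam: "\<And>x y. x \<in> A \<Longrightarrow> y \<in> A \<Longrightarrow> (\<Sum>j\<in>I. (x j - y j)\<^sup>2) \<le> \<delta>\<^sup>2"
  shows "emeasure (Pi\<^sub>M I (\<lambda>_. lborel)) A \<le> ennreal (unit_ball_vol (real (card I)) * (\<delta> / 2) ^ card I)"
proof -
  let ?P = "Pi\<^sub>M I (\<lambda>_. lborel :: real measure)"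
  have "\<exists>A'. A' \<in> sets ?P \<and> emeasure ?P A' = emeasure ?P A \<and>
      (\<forall>x\<in>A'. \<forall>y\<in>A'. (\<Sum>j\<in>I. (x j - y j)\<^sup>2) \<le> \<delta>\<^sup>2) \<and> (\<forall>j\<in>K. \<forall>x\<in>A'. x(j := - x j) \<in> A')"
    if "finite K" "K \<subseteq> I" for K
    using that
  proof (induction K)
    case empty then show ?case using A diam by (intro exI[of _ A]) auto
  next
    case (insert i K)
    then have "K \<subseteq> I" by simp
    from insert.IH[OF this] obtain A' where "A' \<in> sets ?P \<and> emeasure ?P A' = emeasure ?P A \<and>
      (\<forall>x\<in>A'. \<forall>y\<in>A'. (\<Sum>j\<in>I. (x j - y j)\<^sup>2) \<le> \<delta>\<^sup>2) \<and> (\<forall>j\<in>K. \<forall>x\<in>A'. x(j := - x j) \<in> A')" ..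
    then have A': "A' \<in> sets ?P" "emeasure ?P A' = emeasure ?P A"
      "\<And>x y. x \<in> A' \<Longrightarrow> y \<in> A' \<Longrightarrow> (\<Sum>j\<in>I. (x j - y j)\<^sup>2) \<le> \<delta>\<^sup>2"
      "\<And>j x. j \<in> K \<Longrightarrow> x \<in> A' \<Longrightarrow> x(j := - x j) \<in> A'"
      by simp_all
    have i: "i \<in> I" using insert by auto
    show ?case
    proof (intro exI[of _ "steiner I i A'"] conjI ballI)
      show "steiner I i A' \<in> sets ?P" by (rule steiner_sets[OF i A'(1)])
      show "emeasure ?P (steiner I i A') = emeasure ?P A"
        using emeasure_steiner[OF \<open>finite I\<close> i A'(1)] A'(2) by simp
      show "(\<Sum>j\<in>I. (x j - y j)\<^sup>2) \<le> \<delta>\<^sup>2" if "x \<in> steiner I i A'" "y \<in> steiner I i A'" for x y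
        by (rule steiner_diameter[OF \<open>finite I\<close> i A'(3) that])
      show "x(j := - x j) \<in> steiner I i A'" if "j \<in> insert i K" "x \<in> steiner I i A'" for j x
      proof (cases "j = i")
        case True then show ?thesis using steiner_reflection_same[OF i] that by auto
      next
        case False
        then show ?thesis using steiner_reflection_other[of i j I A' x] that A'(4) insert.prems by auto
      qed
    qed
  qed
  from this[OF \<open>finite I\<close> order_refl] obtain A' where "A' \<in> sets ?P \<and> emeasure ?P A' = emeasure ?P A \<and>
      (\<forall>x\<in>A'. \<forall>y\<in>A'. (\<Sum>j\<in>I. (x j - y j)\<^sup>2) \<le> \<delta>\<^sup>2) \<and> (\<forall>j\<in>I. \<forall>x\<in>A'. x(j := - x j) \<in> A')" ..
  then have A': "A' \<in> sets ?P" "emeasure ?P A' = emeasure ?P A"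
      "\<And>x y. x \<in> A' \<Longrightarrow> y \<in> A' \<Longrightarrow> (\<Sum>j\<in>I. (x j - y j)\<^sup>2) \<le> \<delta>\<^sup>2"
      "\<And>j x. j \<in> I \<Longrightarrow> x \<in> A' \<Longrightarrow> x(j := - x j) \<in> A'"
    by simp_all
  \<comment> \<open>Coordinates are negated one at a time; with \<open>K = I\<close> this produces
    the antipodal point.\<close>
  have flip: "(\<lambda>j. if j \<in> K then - x j else x j) \<in> A'" if "finite K" "K \<subseteq> I" "x \<in> A'" for K x
    using that
  proof (induction K)
    case (insert j K)
    let ?y = "\<lambda>j. if j \<in> K then - x j else x j"
    have "?y(j := - ?y j) \<in> A'" by (rule A'(4)) (use insert in auto)
    moreover have "?y(j := - ?y j) = (\<lambda>i. if i \<in> insert j K then - x i else x i)"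
      using insert by (auto simp: fun_eq_iff)
    ultimately show ?case by simp
  qed simp
  have "A' \<subseteq> {f. sqrt (\<Sum>i\<in>I. (f i)\<^sup>2) \<le> \<delta> / 2} \<inter> space ?P"
  proof
    fix x assume x: "x \<in> A'"
    have "(\<Sum>j\<in>I. (x j - (if j \<in> I then - x j else x j))\<^sup>2) \<le> \<delta>\<^sup>2"
      by (rule A'(3)[OF x flip]) (use x \<open>finite I\<close> in auto)
    also have "(\<Sum>j\<in>I. (x j - (if j \<in> I then - x j else x j))\<^sup>2) = 4 * (\<Sum>j\<in>I. (x j)\<^sup>2)"
      unfolding sum_distrib_left by (rule sum.cong) (auto simp: power2_eq_square)
    finally have "(\<Sum>j\<in>I. (x j)\<^sup>2) \<le> (\<delta>/2)\<^sup>2" by (simp add: power_divide)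
    from real_sqrt_le_mono[OF this] have "sqrt (\<Sum>j\<in>I. (x j)\<^sup>2) \<le> \<delta>/2" using \<open>\<delta> > 0\<close> by simp
    then show "x \<in> {f. sqrt (\<Sum>i\<in>I. (f i)\<^sup>2) \<le> \<delta> / 2} \<inter> space ?P"
      using x sets.sets_into_space[OF A'(1)] by auto
  qed
  moreover have "{f. sqrt (\<Sum>i\<in>I. (f i)\<^sup>2) \<le> \<delta> / 2} \<inter> space ?P \<in> sets ?P"
  proof -
    have [measurable]: "(\<lambda>x. x j) \<in> borel_measurable ?P" if "j \<in> I" for j
      using measurable_component_singleton[OF that, of "\<lambda>_. lborel"] by simp
    have "{f \<in> space ?P. sqrt (\<Sum>i\<in>I. (f i)\<^sup>2) \<le> \<delta> / 2} \<in> sets ?P" by measurable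
    then show ?thesis by (simp add: Int_def conj_commute)
  qed
  ultimately have "emeasure ?P A' \<le> emeasure ?P ({f. sqrt (\<Sum>i\<in>I. (f i)\<^sup>2) \<le> \<delta> / 2} \<inter> space ?P)"
    by (rule emeasure_mono)
  then show ?thesis using emeasure_cball_aux[OF \<open>finite I\<close>, of "\<delta>/2"] \<open>\<delta> > 0\<close> A'(2) by simp
qed

text \<open>Covering sets may have diameter zero, as single points do; this case is reached by
  letting \<delta> + 1/(n+1) decrease to \<delta>.\<close>

lemma isodiametric_PiM:
  fixes A :: "('i \<Rightarrow> real) set"
  assumes "finite I" "I \<noteq> {}" and A: "A \<in> sets (Pi\<^sub>M I (\<lambda>_. lborel))" and "\<delta> \<ge> 0"
    and diam: "\<And>x y. x \<in> A \<Longrightarrow> y \<in> A \<Longrightarrow> (\<Sum>j\<in>I. (x j - y j)\<^sup>2) \<le> \<delta>\<^sup>2"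
  shows "emeasure (Pi\<^sub>M I (\<lambda>_. lborel)) A \<le> ennreal (unit_ball_vol (real (card I)) * (\<delta> / 2) ^ card I)"
proof (rule LIMSEQ_le_const)
  let ?d = "\<lambda>n. \<delta> + inverse (real (Suc n))"
  have "(\<lambda>n. ?d n) \<longlonglongrightarrow> \<delta> + 0" by (intro tendsto_add tendsto_const LIMSEQ_inverse_real_of_nat)
  then have "(\<lambda>n. ?d n) \<longlonglongrightarrow> \<delta>" by simp
  then show "(\<lambda>n. ennreal (unit_ball_vol (real (card I)) * (?d n / 2) ^ card I))
      \<longlonglongrightarrow> ennreal (unit_ball_vol (real (card I)) * (\<delta> / 2) ^ card I)"
    by (intro tendsto_ennrealI tendsto_mult tendsto_const tendsto_power tendsto_divide) auto
  have "emeasure (Pi\<^sub>M I (\<lambda>_. lborel)) A \<le> ennreal (unit_ball_vol (real (card I)) * (?d n / 2) ^ card I)" for n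
  proof (rule isodiametric_PiM_pos[OF \<open>finite I\<close> A])
    show "?d n > 0" using \<open>\<delta> \<ge> 0\<close> by (simp add: add_nonneg_pos)
    fix x y assume "x \<in> A" "y \<in> A"
    then have "(\<Sum>j\<in>I. (x j - y j)\<^sup>2) \<le> \<delta>\<^sup>2" by (rule diam)
    also have "\<dots> \<le> (?d n)\<^sup>2" using \<open>\<delta> \<ge> 0\<close> by (intro power_mono) auto
    finally show "(\<Sum>j\<in>I. (x j - y j)\<^sup>2) \<le> (?d n)\<^sup>2" .
  qed
  then show "\<exists>N. \<forall>n\<ge>N. emeasure (Pi\<^sub>M I (\<lambda>_. lborel)) A \<le> ennreal (unit_ball_vol (real (card I)) * (?d n / 2) ^ card I)"
    by auto
qed

text \<open>A cover of \<open>A\<close> projects to a cover of \<open>D\<close> by sets of no larger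
  diameter. \<open>hausdorff_const\<close> is the volume of the unit ball divided by 2^s, so the
  isodiametric inequality bounds the volume of each projection by precisely its term in the
  Hausdorff sum. \<open>D\<close> stands for a measurable part of the projection of
  \<open>A\<close>, which may itself fail to be measurable.\<close>

lemma projection_le_hausdorff:
  fixes A :: "'a::euclidean_space set" and b :: 'a
  assumes dim: "DIM('a) \<ge> 2" and b: "b \<in> Basis"
    and D: "D \<in> sets (Pi\<^sub>M (Basis - {b}) (\<lambda>_. lborel))"
    and proj: "\<And>x. x \<in> D \<Longrightarrow> \<exists>y\<in>A. \<forall>j\<in>Basis - {b}. x j = y \<bullet> j"
  shows "emeasure (Pi\<^sub>M (Basis - {b}) (\<lambda>_. lborel)) D \<le> hausdorff_outer (real DIM('a) - 1) A"
proof -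
  let ?I = "Basis - {b}" and ?P = "Pi\<^sub>M (Basis - {b}) (\<lambda>_. lborel :: real measure)"
  let ?s = "real DIM('a) - 1"
  have cI: "real (card ?I) = ?s" "?I \<noteq> {}" "card ?I > 0" and fI: "finite ?I"
  proof -
    show c: "real (card ?I) = ?s" using b dim by (simp add: of_nat_diff)
    then show "card ?I > 0" using dim by linarith
    then show "?I \<noteq> {}" by force
  qed simp
  \<comment> \<open>\<open>hausdorff_outer\<close> is a supremum over scales, so a bound at the
    scale 1 suffices.\<close>
  have "emeasure ?P D \<le> hausdorff_pre ?s 1 A"
    unfolding hausdorff_pre_def
  proof (rule INF_greatest)
    fix C :: "nat \<Rightarrow> 'a set"
    assume "C \<in> {C. A \<subseteq> (\<Union>i. C i) \<and> (\<forall>i. bounded (C i) \<and> diameter (C i) \<le> 1)}"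
    then have C: "A \<subseteq> (\<Union>i. C i)" "\<And>i. bounded (C i)" by auto
    \<comment> \<open>\<open>S\<close> places a coordinate tuple in the hyperplane orthogonal to
      \<open>b\<close>, and \<open>\<pi>\<close> is the orthogonal projection onto that
      hyperplane.\<close>
    define S where "S x = (\<Sum>j\<in>?I. x j *\<^sub>R j)" for x :: "'a \<Rightarrow> real"
    define \<pi> where "\<pi> y = y - (y \<bullet> b) *\<^sub>R b" for y :: 'a
    have \<pi>: "\<pi> y = (\<Sum>j\<in>?I. (y \<bullet> j) *\<^sub>R j)" for y
    proof -
      have "y = (\<Sum>j\<in>Basis. (y \<bullet> j) *\<^sub>R j)" by (simp add: euclidean_representation)
      also have "\<dots> = (y \<bullet> b) *\<^sub>R b + (\<Sum>j\<in>?I. (y \<bullet> j) *\<^sub>R j)" using b by (intro sum.remove) auto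
      finally show ?thesis unfolding \<pi>_def by (metis add_diff_cancel_left')
    qed
    have Sin: "S x \<bullet> j = x j" if "j \<in> ?I" for x j
      unfolding S_def using that by (simp add: inner_sum_left inner_Basis if_distrib[of "\<lambda>t. _ * t"] sum.delta cong: if_cong)
    have pin: "\<pi> y \<bullet> j = y \<bullet> j" if "j \<in> ?I" for y j
      using that b by (auto simp: \<pi>_def inner_diff_left inner_Basis)
    \<comment> \<open>Taking closures makes the projected sets compact, hence Borel, without
      changing diameters.\<close>
    define Q where "Q i = {x \<in> space ?P. S x \<in> \<pi> ` closure (C i)}" for i
    have [measurable]: "(\<lambda>x. x j) \<in> borel_measurable ?P" if "j \<in> ?I" for j
      using measurable_component_singleton[OF that, of "\<lambda>_. lborel"] by simp
    have Sm[measurable]: "S \<in> borel_measurable ?P" unfolding S_def by measurable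
    have Q: "Q i \<in> sets ?P" for i
    proof -
      have "compact (closure (C i))" using C(2) by (simp add: compact_closure)
      then have "compact (\<pi> ` closure (C i))"
        unfolding \<pi>_def by (intro compact_continuous_image continuous_intros)
      then have "\<pi> ` closure (C i) \<in> sets borel" by (intro borel_closed compact_imp_closed)
      then show ?thesis unfolding Q_def by measurable
    qed
    have Qd: "(\<Sum>j\<in>?I. (x j - x' j)\<^sup>2) \<le> (diameter (C i))\<^sup>2" if x: "x \<in> Q i" "x' \<in> Q i" for x x' i
    proof -
      obtain y y' where y: "y \<in> closure (C i)" "y' \<in> closure (C i)" "S x = \<pi> y" "S x' = \<pi> y'"
        using x by (auto simp: Q_def)
      have "(\<Sum>j\<in>?I. (x j - x' j)\<^sup>2) = (\<Sum>j\<in>?I. ((y - y') \<bullet> j)\<^sup>2)"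
        by (rule sum.cong) (use Sin[of _ x] Sin[of _ x'] y pin in \<open>auto simp: inner_diff_left\<close>)
      also have "\<dots> \<le> (\<Sum>j\<in>Basis. ((y - y') \<bullet> j)\<^sup>2)" by (rule sum_mono2) auto
      also have "\<dots> = (dist y y')\<^sup>2"
        by (simp add: dist_norm norm_eq_sqrt_inner[of "y - y'"] euclidean_inner[of "y-y'" "y-y'"] sum_nonneg power2_eq_square)
      also have "\<dots> \<le> (diameter (C i))\<^sup>2"
        using diameter_bounded_bound[OF bounded_closure[OF C(2)] y(1,2)] C(2)[of i]
        by (intro power_mono) (simp_all add: diameter_closure)
      finally show ?thesis .
    qed
    have "D \<subseteq> (\<Union>i. Q i)"
    proof
      fix x assume x: "x \<in> D"
      then obtain y where y: "y \<in> A" "\<And>j. j \<in> ?I \<Longrightarrow> x j = y \<bullet> j" using proj by blast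
      then obtain i where i: "y \<in> C i" using C by blast
      have "S x = \<pi> y" unfolding \<pi> S_def by (rule sum.cong) (use y in auto)
      then have "x \<in> Q i" using i x closure_subset sets.sets_into_space[OF D] by (auto simp: Q_def)
      then show "x \<in> (\<Union>i. Q i)" by blast
    qed
    then have "emeasure ?P D \<le> emeasure ?P (\<Union>i. Q i)" by (rule emeasure_mono) (use Q in auto)
    also have "\<dots> \<le> (\<Sum>i. emeasure ?P (Q i))" by (rule emeasure_subadditive_countably) (use Q in auto)
    also have "\<dots> \<le> (\<Sum>i. ennreal (hausdorff_const ?s * diameter (C i) powr ?s))"
    proof (rule suminf_le)
      fix i
      have dp: "diameter (C i) \<ge> 0" using C(2) by (rule diameter_ge_0)
      have "emeasure ?P (Q i) \<le> ennreal (unit_ball_vol (real (card ?I)) * (diameter (C i) / 2) ^ card ?I)"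
        by (rule isodiametric_PiM[OF fI cI(2) Q dp Qd])
      also have "unit_ball_vol (real (card ?I)) * (diameter (C i) / 2) ^ card ?I = hausdorff_const ?s * diameter (C i) powr ?s"
      \<comment> \<open>\<open>powr_realpow\<close> requires a positive base; for diameter zero both
        sides vanish because n - 1 is positive.\<close>
      proof (cases "diameter (C i) = 0")
        case True then show ?thesis using cI(3) by simp
      next
        case False
        then have "diameter (C i) ^ card ?I = diameter (C i) powr ?s" using dp cI(1) by (metis less_eq_real_def powr_realpow)
        moreover have "(2::real) ^ card ?I = 2 powr ?s" using cI(1) by (metis powr_realpow zero_less_numeral)
        ultimately show ?thesis using cI(1) by (simp add: hausdorff_const_def unit_ball_vol_def power_divide)
      qed
      finally show "emeasure ?P (Q i) \<le> ennreal (hausdorff_const ?s * diameter (C i) powr ?s)" .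
    qed auto
    finally show "emeasure ?P D \<le> (\<Sum>i. ennreal (hausdorff_const ?s * diameter (C i) powr ?s))" .
  qed
  also have "\<dots> \<le> hausdorff_outer ?s A" unfolding hausdorff_outer_def by (rule SUP_upper) simp
  finally show ?thesis .
qed

section \<open>Slicing in a coordinate direction\<close>

lemma sets_surface_measure: "sets (surface_measure \<Omega>) = sets (restrict_space borel (frontier \<Omega>))"
  unfolding surface_measure_def by (rule sets_restrict_space_cong) simp

lemma space_surface_measure[simp]: "space (surface_measure \<Omega>) = frontier \<Omega>"
  unfolding surface_measure_def by (simp add: space_restrict_space)

lemma measurable_ident_surface: "(\<lambda>x. x) \<in> surface_measure \<Omega> \<rightarrow>\<^sub>M borel"
  unfolding surface_measure_def by (rule measurable_restrict_space1) simp

lemma measurable_surface: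
  assumes "f \<in> borel \<rightarrow>\<^sub>M N" shows "f \<in> surface_measure \<Omega> \<rightarrow>\<^sub>M N"
  using measurable_compose[OF measurable_ident_surface assms] .

lemma emeasure_surface_measure:
  fixes \<Omega> :: "'a::euclidean_space set"
  assumes "A \<in> sets borel" "A \<subseteq> frontier \<Omega>"
  shows "emeasure (surface_measure \<Omega>) A = hausdorff_outer (real DIM('a) - 1) A"
  unfolding surface_measure_def using assms
  by (subst emeasure_restrict_space) (auto simp: emeasure_hausdorff_measure)

text \<open>The layer-cake form of the exponential, in which the boundary integral can be compared
  with slices level by level. The substitution t = -u leads to a half-line bounded below, where the
  fundamental theorem for improper integrals applies.\<close>

lemma nn_integral_exp_atMost:
  assumes "k > 0"
  shows "(\<integral>\<^sup>+t. ennreal (2 * k * exp (2 * k * t)) * indicator {..a} t \<partial>lborel) = ennreal (exp (2 * k * a))"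
proof -
  have "(\<integral>\<^sup>+t. ennreal (2 * k * exp (2 * k * t)) * indicator {..a} t \<partial>lborel)
      = (\<integral>\<^sup>+u. ennreal (2 * k * exp (2 * k * (- u))) * indicator {..a} (- u) \<partial>lborel)"
    using nn_integral_real_affine[of "\<lambda>t. ennreal (2 * k * exp (2 * k * t)) * indicator {..a} t" "-1" 0] by simp
  also have "\<dots> = (\<integral>\<^sup>+u. ennreal (2 * k * exp (2 * k * (- u))) * indicator {-a..} u \<partial>lborel)"
    by (intro nn_integral_cong) (auto simp: indicator_def)
  also have "\<dots> = ennreal (0 - (- exp (2 * k * (- (- a)))))"
  proof (rule nn_integral_FTC_atLeast)
    have "((\<lambda>u. - exp (2 * k * (- u))) \<longlongrightarrow> - 0) at_top"
    proof (intro tendsto_minus filterlim_compose[OF exp_at_bot])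
      show "filterlim (\<lambda>u. 2 * k * (- u)) at_bot at_top"
        using assms by (intro filterlim_tendsto_pos_mult_at_bot[OF tendsto_const _ filterlim_uminus_at_bot_at_top]) auto
    qed
    then show "((\<lambda>u. - exp (2 * k * (- u))) \<longlongrightarrow> 0) at_top" by simp
  qed (use assms in \<open>auto intro!: derivative_eq_intros\<close>)
  finally show ?thesis by simp
qed

text \<open>Let \<open>D t\<close> be the slice of \<Omega> at height t and \<open>F t\<close> the
  part of the frontier at height at least t. From each point of the slice the ray in direction
  \<open>b\<close> leaves the bounded set through a point of \<open>F t\<close>, so
  \<open>D t\<close> is covered by the projection of \<open>F t\<close> and its area is at most the
  surface measure of \<open>F t\<close>. Integrating against the derivative of exp(2 k t) and
  exchanging the integrals gives the claim.\<close>

lemma exp_interior_le_boundary: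
  fixes \<Omega> :: "'a::euclidean_space set" and b :: 'a
  assumes dim: "DIM('a) \<ge> 2" and "open \<Omega>" "bounded \<Omega>" and b: "b \<in> Basis" and k: "k > 0"
    and fin: "finite_measure (surface_measure \<Omega>)"
  shows "(\<integral>\<^sup>+x. indicator \<Omega> x * ennreal (2 * k * exp (2 * k * (x \<bullet> b))) \<partial>lborel)
      \<le> (\<integral>\<^sup>+x. ennreal (exp (2 * k * (x \<bullet> b))) \<partial>surface_measure \<Omega>)"
proof -
  interpret finite_measure "surface_measure \<Omega>" by fact
  interpret PS: product_sigma_finite "\<lambda>_::'a. lborel :: real measure" by standard
  interpret pair_sigma_finite lborel "surface_measure \<Omega>" by standard
  let ?I = "Basis - {b} :: 'a set"
  let ?P = "\<lambda>I. Pi\<^sub>M I (\<lambda>_::'a. lborel :: real measure)"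
  define S where "S f = (\<Sum>j\<in>Basis. f j *\<^sub>R j)" for f :: "'a \<Rightarrow> real"
  define g where "g t = ennreal (2 * k * exp (2 * k * t))" for t
  define F where "F t = {y \<in> frontier \<Omega>. t \<le> y \<bullet> b}" for t
  define D where "D t = {x \<in> space (?P ?I). S (x(b := t)) \<in> \<Omega>}" for t
  have ins: "insert b ?I = Basis" using b by auto
  have [measurable]: "g \<in> borel_measurable borel" unfolding g_def by measurable
  have [measurable]: "\<Omega> \<in> sets borel" using \<open>open \<Omega>\<close> by simp
  have comp: "(\<lambda>x. x j) \<in> borel_measurable (?P I)" if "j \<in> I" for j I
    using measurable_component_singleton[OF that, of "\<lambda>_. lborel"] by simp
  have Sm[measurable]: "S \<in> borel_measurable (?P Basis)"
    unfolding S_def by (intro borel_measurable_sum borel_measurable_scaleR comp) auto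
  have Sb: "S f \<bullet> b = f b" for f
    unfolding S_def using b by (simp add: inner_sum_left inner_Basis if_distrib[of "\<lambda>t. _ * t"] sum.delta cong: if_cong)
  have upd: "(\<lambda>x. x(b := t)) \<in> ?P ?I \<rightarrow>\<^sub>M ?P Basis" for t
    by (rule measurable_fun_upd[where J="?I"]) (use ins in auto)
  have Dm: "D t \<in> sets (?P ?I)" for t
    unfolding D_def using measurable_compose[OF upd Sm] by measurable
  \<comment> \<open>Lebesgue measure is the image under \<open>S\<close> of the product measure over
    \<open>Basis\<close>; the coordinate \<open>b\<close> is then split off as the outer variable
    t.\<close>
  have "(\<integral>\<^sup>+x. indicator \<Omega> x * g (x \<bullet> b) \<partial>lborel) = (\<integral>\<^sup>+f. indicator \<Omega> (S f) * g (S f \<bullet> b) \<partial>?P Basis)"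
    by (subst lborel_eq, subst nn_integral_distr) (use Sm in \<open>auto simp: S_def[symmetric] S_def[abs_def, symmetric]\<close>)
  also have "\<dots> = (\<integral>\<^sup>+f. indicator \<Omega> (S f) * g (f b) \<partial>?P (insert b ?I))" by (simp only: Sb ins)
  also have "\<dots> = (\<integral>\<^sup>+t. (\<integral>\<^sup>+x. indicator \<Omega> (S (x(b := t))) * g ((x(b := t)) b) \<partial>?P ?I) \<partial>lborel)"
  proof (rule PS.product_nn_integral_insert_rev)
    have [measurable]: "(\<lambda>f. f b) \<in> borel_measurable (?P Basis)" using comp b by blast
    show "(\<lambda>f. indicator \<Omega> (S f) * g (f b)) \<in> borel_measurable (?P (insert b ?I))"
      unfolding ins by measurable
  qed auto
  also have "\<dots> = (\<integral>\<^sup>+t. emeasure (?P ?I) (D t) * g t \<partial>lborel)"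
  proof (rule nn_integral_cong)
    fix t
    have "(\<integral>\<^sup>+x. indicator \<Omega> (S (x(b := t))) * g ((x(b := t)) b) \<partial>?P ?I) = (\<integral>\<^sup>+x. indicator (D t) x * g t \<partial>?P ?I)"
      by (rule nn_integral_cong) (auto simp: D_def indicator_def)
    also have "\<dots> = emeasure (?P ?I) (D t) * g t"
      using Dm[of t] by (simp add: nn_integral_multc)
    finally show "(\<integral>\<^sup>+x. indicator \<Omega> (S (x(b := t))) * g ((x(b := t)) b) \<partial>?P ?I) = emeasure (?P ?I) (D t) * g t" .
  qed
  also have "\<dots> \<le> (\<integral>\<^sup>+t. emeasure (surface_measure \<Omega>) (F t) * g t \<partial>lborel)"
  proof (intro nn_integral_mono mult_right_mono)
    fix t
    have Fc: "closed (F t)"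
    proof -
      have "F t = frontier \<Omega> \<inter> {y. b \<bullet> y \<ge> t}" by (auto simp: F_def inner_commute)
      then show ?thesis by (simp add: closed_Int closed_halfspace_ge)
    qed
    have "emeasure (?P ?I) (D t) \<le> hausdorff_outer (real DIM('a) - 1) (F t)"
    proof (rule projection_le_hausdorff[OF dim b Dm])
      fix x assume x: "x \<in> D t"
      then have "S (x(b := t)) \<in> interior \<Omega>" using \<open>open \<Omega>\<close> by (simp add: D_def interior_open)
      from ray_to_frontier[OF \<open>bounded \<Omega>\<close> this, of b] obtain d where
        d: "0 < d" "S (x(b := t)) + d *\<^sub>R b \<in> frontier \<Omega>" using b by (metis nonzero_Basis)
      show "\<exists>y\<in>F t. \<forall>j\<in>?I. x j = y \<bullet> j"
      proof (intro bexI[of _ "S (x(b := t)) + d *\<^sub>R b"] ballI)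
        fix j assume j: "j \<in> ?I"
        have "S (x(b := t)) \<bullet> j = x j"
          unfolding S_def using j by (simp add: inner_sum_left inner_Basis if_distrib[of "\<lambda>t. _ * t"] sum.delta cong: if_cong)
        then show "x j = (S (x(b := t)) + d *\<^sub>R b) \<bullet> j" using j b by (auto simp: inner_add_left inner_Basis)
      next
        show "S (x(b := t)) + d *\<^sub>R b \<in> F t"
          using d b by (simp add: F_def inner_add_left Sb)
      qed
    qed
    also have "\<dots> = emeasure (surface_measure \<Omega>) (F t)"
      by (rule emeasure_surface_measure[symmetric]) (use Fc in \<open>auto simp: F_def\<close>)
    finally show "emeasure (?P ?I) (D t) \<le> emeasure (surface_measure \<Omega>) (F t)" .
  qed simp
  also have "\<dots> = (\<integral>\<^sup>+t. (\<integral>\<^sup>+y. g t * indicator {..y \<bullet> b} t \<partial>surface_measure \<Omega>) \<partial>lborel)"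
  proof (rule nn_integral_cong)
    fix t
    have [measurable]: "(\<lambda>y. y \<bullet> b) \<in> borel_measurable (surface_measure \<Omega>)" by (rule measurable_surface) simp
    have "{y \<in> space (surface_measure \<Omega>). t \<le> y \<bullet> b} \<in> sets (surface_measure \<Omega>)" by measurable
    then have Fs: "F t \<in> sets (surface_measure \<Omega>)" by (simp add: F_def)
    have "(\<integral>\<^sup>+y. g t * indicator {..y \<bullet> b} t \<partial>surface_measure \<Omega>) = (\<integral>\<^sup>+y. g t * indicator (F t) y \<partial>surface_measure \<Omega>)"
      by (rule nn_integral_cong) (auto simp: F_def indicator_def)
    also have "\<dots> = emeasure (surface_measure \<Omega>) (F t) * g t" using Fs by (simp add: nn_integral_cmult mult.commute)
    finally show "emeasure (surface_measure \<Omega>) (F t) * g t = (\<integral>\<^sup>+y. g t * indicator {..y \<bullet> b} t \<partial>surface_measure \<Omega>)" by simp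
  qed
  \<comment> \<open>Exchanging the integrals requires a sigma-finite surface measure; this is where
    its finiteness enters.\<close>
  also have "\<dots> = (\<integral>\<^sup>+y. (\<integral>\<^sup>+t. g t * indicator {..y \<bullet> b} t \<partial>lborel) \<partial>surface_measure \<Omega>)"
  proof (rule Fubini'[symmetric])
    have [measurable]: "(\<lambda>p. snd p) \<in> lborel \<Otimes>\<^sub>M surface_measure \<Omega> \<rightarrow>\<^sub>M borel"
      by (rule measurable_compose[OF measurable_snd measurable_ident_surface])
    have "(\<lambda>p. g (fst p) * indicator {p. fst p \<le> snd p \<bullet> b} p) \<in> borel_measurable (lborel \<Otimes>\<^sub>M surface_measure \<Omega>)"
      by measurable
    then show "(\<lambda>(t, y). g t * indicator {..y \<bullet> b} t) \<in> borel_measurable (lborel \<Otimes>\<^sub>M surface_measure \<Omega>)"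
      by (simp add: case_prod_beta' indicator_def)
  qed
  also have "\<dots> = (\<integral>\<^sup>+y. ennreal (exp (2 * k * (y \<bullet> b))) \<partial>surface_measure \<Omega>)"
    by (simp add: g_def nn_integral_exp_atMost[OF k])
  finally show ?thesis by (simp add: g_def)
qed

section \<open>Hausdorff measure of Lipschitz graphs\<close>

text \<open>The family is enumerated and padded with empty sets, which cost nothing because their
  diameter is 0 and 0 powr s = 0.\<close>

lemma hausdorff_pre_finite_cover:
  fixes C :: "'i \<Rightarrow> 'a::euclidean_space set"
  assumes F: "finite F" and cov: "A \<subseteq> (\<Union>i\<in>F. C i)"
    and C: "\<And>i. i \<in> F \<Longrightarrow> bounded (C i)" "\<And>i. i \<in> F \<Longrightarrow> diameter (C i) \<le> \<delta>" and "\<delta> > 0"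
  shows "hausdorff_pre s \<delta> A \<le> (\<Sum>i\<in>F. ennreal (hausdorff_const s * diameter (C i) powr s))"
proof -
  obtain h where h: "bij_betw h {0..<card F} F" using ex_bij_betw_nat_finite[OF F] by blast
  define C' where "C' n = (if n \<in> {0..<card F} then C (h n) else {})" for n
  have "A \<subseteq> (\<Union>n. C' n)"
  proof
    fix x assume "x \<in> A"
    then obtain i where "i \<in> F" "x \<in> C i" using cov by auto
    have "i \<in> h ` {0..<card F}" using bij_betw_imp_surj_on[OF h] \<open>i \<in> F\<close> by simp
    then obtain n where "n \<in> {0..<card F}" "h n = i" by auto
    then have "x \<in> C' n" using \<open>x \<in> C i\<close> by (simp add: C'_def)
    then show "x \<in> (\<Union>n. C' n)" by (rule UN_I[OF UNIV_I])
  qed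
  moreover have "bounded (C' n) \<and> diameter (C' n) \<le> \<delta>" for n
    using C \<open>\<delta> > 0\<close> bij_betwE[OF h] by (auto simp: C'_def)
  ultimately have "hausdorff_pre s \<delta> A \<le> (\<Sum>n. ennreal (hausdorff_const s * diameter (C' n) powr s))"
    by (rule hausdorff_pre_le)
  also have "\<dots> = (\<Sum>n\<in>{0..<card F}. ennreal (hausdorff_const s * diameter (C' n) powr s))"
    by (rule suminf_finite) (auto simp: C'_def)
  also have "\<dots> = (\<Sum>n\<in>{0..<card F}. ennreal (hausdorff_const s * diameter (C (h n)) powr s))"
    by (rule sum.cong) (auto simp: C'_def)
  also have "\<dots> = (\<Sum>i\<in>F. ennreal (hausdorff_const s * diameter (C i) powr s))"
    using h by (rule sum.reindex_bij_betw)
  finally show ?thesis .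
qed

text \<open>Orthogonality to \<open>e\<close> determines the \<open>b\<close>-component of
  \<open>v\<close> from the others, at the price of a factor 1/|e.b|. Thus the coordinates other
  than \<open>b\<close> parametrise the hyperplane orthogonal to \<open>e\<close>, and a coordinate
  grid takes the place of a rotation.\<close>

lemma norm_le_coordinates_hyperplane:
  fixes v e b :: "'a::euclidean_space"
  assumes b: "b \<in> Basis" "e \<bullet> b \<noteq> 0" and "norm e = 1" and "v \<bullet> e = 0"
    and small: "\<And>j. j \<in> Basis - {b} \<Longrightarrow> \<bar>v \<bullet> j\<bar> \<le> \<tau>" and "\<tau> \<ge> 0"
  shows "norm v \<le> real DIM('a) * (1 + 1 / \<bar>e \<bullet> b\<bar>) * \<tau>"
proof -
  let ?n = "real DIM('a)"
  have cn: "(\<Sum>j\<in>Basis - {b}. \<tau>) \<le> ?n * \<tau>"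
    using \<open>\<tau> \<ge> 0\<close> b by (simp add: mult_right_mono)
  have "0 = (\<Sum>j\<in>Basis. (v \<bullet> j) * (e \<bullet> j))" using \<open>v \<bullet> e = 0\<close> euclidean_inner[of v e] by simp
  also have "\<dots> = (v \<bullet> b) * (e \<bullet> b) + (\<Sum>j\<in>Basis-{b}. (v \<bullet> j) * (e \<bullet> j))" using b by (intro sum.remove) auto
  finally have "\<bar>(v \<bullet> b) * (e \<bullet> b)\<bar> = \<bar>\<Sum>j\<in>Basis-{b}. (v \<bullet> j) * (e \<bullet> j)\<bar>" by linarith
  also have "\<dots> \<le> (\<Sum>j\<in>Basis-{b}. \<tau>)"
  proof (rule order_trans[OF sum_abs sum_mono])
    fix j assume j: "j \<in> Basis - {b}"
    have "\<bar>e \<bullet> j\<bar> \<le> 1" using Basis_le_norm[of j e] j \<open>norm e = 1\<close> by simp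
    then have "\<bar>v \<bullet> j\<bar> * \<bar>e \<bullet> j\<bar> \<le> \<tau> * 1" using small[OF j] \<open>\<tau> \<ge> 0\<close> by (intro mult_mono) auto
    then show "\<bar>(v \<bullet> j) * (e \<bullet> j)\<bar> \<le> \<tau>" by (simp add: abs_mult)
  qed
  also note cn
  finally have "\<bar>v \<bullet> b\<bar> \<le> ?n * \<tau> / \<bar>e \<bullet> b\<bar>" using b(2) by (simp add: abs_mult pos_le_divide_eq)
  moreover have "norm v \<le> \<bar>v \<bullet> b\<bar> + (\<Sum>j\<in>Basis-{b}. \<bar>v \<bullet> j\<bar>)"
    using norm_le_l1[of v] b by (simp add: sum.remove[of Basis b])
  moreover have "(\<Sum>j\<in>Basis-{b}. \<bar>v \<bullet> j\<bar>) \<le> ?n * \<tau>" by (rule order_trans[OF sum_mono cn]) (rule small)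
  ultimately show ?thesis by (simp add: algebra_simps)
qed

text \<open>The difference of two graph points splits into a part orthogonal to \<open>e\<close> and
  a height difference, and the latter is at most \<open>L\<close> times the former.\<close>

lemma dist_graph_le:
  fixes e :: "'a::euclidean_space" and \<gamma> :: "'a \<Rightarrow> real"
  assumes e: "norm e = 1" and lip: "L-lipschitz_on {y. y \<bullet> e = 0} \<gamma>"
    and x: "x \<bullet> e = \<gamma> (x - (x \<bullet> e) *\<^sub>R e)" and y: "y \<bullet> e = \<gamma> (y - (y \<bullet> e) *\<^sub>R e)"
  shows "dist x y \<le> (1 + L) * norm ((x - (x \<bullet> e) *\<^sub>R e) - (y - (y \<bullet> e) *\<^sub>R e))"
proof -
  let ?p = "\<lambda>x. x - (x \<bullet> e) *\<^sub>R e"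
  have ee: "e \<bullet> e = 1" using e by (simp add: dot_square_norm)
  have perp: "?p z \<bullet> e = 0" for z by (simp add: inner_diff_left ee)
  have "x - y = (?p x - ?p y) + (x \<bullet> e - y \<bullet> e) *\<^sub>R e" by (simp add: algebra_simps)
  then have "norm (x - y) \<le> norm (?p x - ?p y) + norm ((x \<bullet> e - y \<bullet> e) *\<^sub>R e)"
    by (metis norm_triangle_ineq)
  then have "norm (x - y) \<le> norm (?p x - ?p y) + \<bar>x \<bullet> e - y \<bullet> e\<bar>"
    using e by simp
  moreover have "dist (\<gamma> (?p x)) (\<gamma> (?p y)) \<le> L * dist (?p x) (?p y)"
    by (rule lipschitz_onD[OF lip]) (use perp in auto)
  then have "\<bar>x \<bullet> e - y \<bullet> e\<bar> \<le> L * norm (?p x - ?p y)" unfolding x[symmetric] y[symmetric] by (simp add: dist_norm)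
  ultimately show ?thesis by (simp add: dist_norm algebra_simps)
qed

lemma hausdorff_const_nonneg: "s \<ge> 0 \<Longrightarrow> hausdorff_const s \<ge> 0"
  unfolding hausdorff_const_def by (intro divide_nonneg_nonneg mult_nonneg_nonneg less_imp_le[OF Gamma_real_pos]) auto

lemma norm_perp_le:
  fixes e :: "'a::real_inner"
  assumes "norm e = 1" shows "norm (x - (x \<bullet> e) *\<^sub>R e) \<le> norm x"
proof -
  have ee: "e \<bullet> e = 1" using assms by (simp add: dot_square_norm)
  have "(norm (x - (x \<bullet> e) *\<^sub>R e))\<^sup>2 = (norm x)\<^sup>2 - (x \<bullet> e)\<^sup>2"
    unfolding power2_norm_eq_inner by (simp add: algebra_simps inner_commute ee power2_eq_square)
  then have "(norm (x - (x \<bullet> e) *\<^sub>R e))\<^sup>2 \<le> (norm x)\<^sup>2" by simp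
  then show ?thesis by (rule power2_le_imp_le) simp
qed

text \<open>The graph inside a ball of radius \<rho> is cut into at most (N+1)^(n-1) pieces by a
  coordinate grid of mesh \<tau> = 2\<rho>/N. The Lipschitz bound gives each piece a diameter at
  most a multiple of \<tau>, so the sum of the (n-1)-th powers of the diameters is bounded by a
  multiple of \<rho>^(n-1), uniformly in N.\<close>

lemma hausdorff_outer_graph_ball_le:
  fixes e :: "'a::euclidean_space" and \<gamma> :: "'a \<Rightarrow> real"
  assumes dim: "DIM('a) \<ge> 2" and e: "norm e = 1" and lip: "L-lipschitz_on {y. y \<bullet> e = 0} \<gamma>"
  shows "\<exists>K\<ge>0. \<forall>z. \<forall>\<rho>>0. hausdorff_outer (real DIM('a) - 1)
      ({x. x \<bullet> e = \<gamma> (x - (x \<bullet> e) *\<^sub>R e)} \<inter> cball z \<rho>) \<le> ennreal (K * \<rho> ^ (DIM('a) - 1))"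
proof -
  let ?n = "DIM('a)" and ?s = "real DIM('a) - 1"
  have s: "?s = real (?n - 1)" using dim by (simp add: of_nat_diff)
  have L0: "L \<ge> 0" using lipschitz_on_nonneg[OF lip] .
  have "e \<noteq> 0" using e by auto
  then obtain b where b: "b \<in> Basis" "e \<bullet> b \<noteq> 0" using euclidean_all_zero_iff[of e] by auto
  let ?I = "Basis - {b}"
  have cI: "card ?I = ?n - 1" using b by simp
  define \<kappa> where "\<kappa> = real ?n * (1 + 1 / \<bar>e \<bullet> b\<bar>)"
  have \<kappa>: "\<kappa> \<ge> 0" by (simp add: \<kappa>_def)
  define \<Gamma> where "\<Gamma> = {x. x \<bullet> e = \<gamma> (x - (x \<bullet> e) *\<^sub>R e)}"
  define p where "p x = x - (x \<bullet> e) *\<^sub>R e" for x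
  have ee: "e \<bullet> e = 1" using e by (simp add: dot_square_norm)
  have perp: "p x \<bullet> e = 0" for x by (simp add: p_def inner_diff_left ee)
  have pdiff: "p x - p y = p (x - y)" for x y by (simp add: p_def algebra_simps)
  have pnorm: "norm (p x) \<le> norm x" for x unfolding p_def by (rule norm_perp_le[OF e])
  define hc where "hc = hausdorff_const ?s"
  have hc: "hc \<ge> 0" unfolding hc_def using dim by (intro hausdorff_const_nonneg) simp
  \<comment> \<open>In the 4, one factor 2 comes from N + 1 \<le> 2N and the other from \<tau> N =
    2\<rho>.\<close>
  define K where "K = hc * (4 * ((1 + L) * \<kappa>)) ^ (?n - 1)"
  have main: "hausdorff_pre ?s \<delta> (\<Gamma> \<inter> cball z \<rho>) \<le> ennreal (K * \<rho> ^ (?n - 1))" if "\<rho> > 0" "\<delta> > 0" for z \<rho> \<delta>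
  proof -
    \<comment> \<open>\<open>N\<close> is taken so large that the pieces have diameter at most
      \<delta>, and at least 1 so that the mesh \<tau> is meaningful.\<close>
    obtain N0 :: nat where N0: "(1 + L) * \<kappa> * (2 * \<rho>) / \<delta> < real N0" using reals_Archimedean2 by blast
    define N where "N = Suc N0"
    define \<tau> where "\<tau> = 2 * \<rho> / real N"
    have \<tau>: "\<tau> > 0" "\<tau> * real N = 2 * \<rho>" using \<open>\<rho> > 0\<close> by (auto simp: \<tau>_def N_def)
    have dd: "(1 + L) * (\<kappa> * \<tau>) \<le> \<delta>"
    proof -
      have "(1 + L) * \<kappa> * (2 * \<rho>) / \<delta> \<le> real N" using N0 by (simp add: N_def)
      then have "(1 + L) * \<kappa> * (2 * \<rho>) \<le> real N * \<delta>" using \<open>\<delta> > 0\<close> by (simp add: pos_divide_le_eq)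
      then show ?thesis by (simp add: \<tau>_def N_def field_simps)
    qed
    \<comment> \<open>Index of the grid cell containing the shifted j-th coordinate. It ranges over
      \<open>{..N}\<close>: the right endpoint of [0, N] has index N, which is why N + 1 values
      occur.\<close>
    define q where "q x j = nat \<lfloor>((p x - p z) \<bullet> j + \<rho>) / \<tau>\<rfloor>" for x j
    define C where "C f = {x \<in> \<Gamma> \<inter> cball z \<rho>. \<forall>j\<in>?I. q x j = f j}" for f
    define FF where "FF = PiE ?I (\<lambda>_. {..N})"
    have range: "0 \<le> ((p x - p z) \<bullet> j + \<rho>) / \<tau> \<and> ((p x - p z) \<bullet> j + \<rho>) / \<tau> \<le> real N"
      if "x \<in> cball z \<rho>" "j \<in> ?I" for x j
    proof -
      have "\<bar>(p x - p z) \<bullet> j\<bar> \<le> norm (p x - p z)" using that by (intro Basis_le_norm) auto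
      also have "\<dots> \<le> norm (x - z)" unfolding pdiff by (rule pnorm)
      also have "\<dots> \<le> \<rho>" using that by (simp add: dist_norm norm_minus_commute)
      finally have "- \<rho> \<le> (p x - p z) \<bullet> j" "(p x - p z) \<bullet> j \<le> \<rho>" by auto
      then show ?thesis using \<tau> by (simp add: pos_divide_le_eq mult.commute)
    qed
    have Cd: "norm (x - y) \<le> (1 + L) * (\<kappa> * \<tau>)" if "x \<in> C f" "y \<in> C f" for x y f
    proof -
      have "\<bar>(p x - p y) \<bullet> j\<bar> \<le> \<tau>" if j: "j \<in> ?I" for j
      proof -
        let ?u = "\<lambda>x. ((p x - p z) \<bullet> j + \<rho>) / \<tau>"
        have u: "?u x \<ge> 0" "?u y \<ge> 0" using range[OF _ j] \<open>x \<in> C f\<close> \<open>y \<in> C f\<close> by (auto simp: C_def)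
        have "nat \<lfloor>?u x\<rfloor> = nat \<lfloor>?u y\<rfloor>" using \<open>x \<in> C f\<close> \<open>y \<in> C f\<close> j by (auto simp: C_def q_def)
        then have "\<lfloor>?u x\<rfloor> = \<lfloor>?u y\<rfloor>" using u by (simp add: eq_nat_nat_iff)
        then have "\<bar>?u x - ?u y\<bar> \<le> 1" by linarith
        moreover have "?u x - ?u y = ((p x - p y) \<bullet> j) / \<tau>"
          by (simp add: inner_diff_left diff_divide_distrib[symmetric])
        ultimately show ?thesis using \<tau> by (simp add: abs_divide pos_divide_le_eq)
      qed
      then have "norm (p x - p y) \<le> \<kappa> * \<tau>"
        unfolding \<kappa>_def by (intro norm_le_coordinates_hyperplane[OF b e])
          (use \<tau> in \<open>auto simp: inner_diff_left[of "p x"] perp\<close>)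
      moreover have "norm (x - y) \<le> (1 + L) * norm (p x - p y)"
        using dist_graph_le[OF e lip, of x y] that by (simp add: C_def \<Gamma>_def dist_norm p_def)
      moreover have "(1 + L) * norm (p x - p y) \<le> (1 + L) * (\<kappa> * \<tau>)"
        by (intro mult_left_mono) (use L0 calculation in auto)
      ultimately show ?thesis by linarith
    qed
    have dia: "diameter (C f) \<le> (1 + L) * (\<kappa> * \<tau>)" for f
      by (rule diameter_le) (use Cd L0 \<kappa> \<tau> in auto)
    have bdd: "bounded (C f)" for f by (rule bounded_subset[OF bounded_cball, of _ z \<rho>]) (auto simp: C_def)
    have "hausdorff_pre ?s \<delta> (\<Gamma> \<inter> cball z \<rho>) \<le> (\<Sum>f\<in>FF. ennreal (hausdorff_const ?s * diameter (C f) powr ?s))"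
    proof (rule hausdorff_pre_finite_cover[OF _ _ bdd])
      show "finite FF" unfolding FF_def by (intro finite_PiE) auto
      show "\<Gamma> \<inter> cball z \<rho> \<subseteq> (\<Union>f\<in>FF. C f)"
      proof
        fix x assume x: "x \<in> \<Gamma> \<inter> cball z \<rho>"
        have "restrict (q x) ?I \<in> FF" unfolding FF_def
        proof (intro restrict_PiE_iff[THEN iffD2] ballI)
          fix j assume "j \<in> ?I"
          from range[OF _ this, of x] x have "((p x - p z) \<bullet> j + \<rho>) / \<tau> \<le> real N" by auto
          then show "q x j \<in> {..N}" by (simp add: q_def) linarith
        qed
        moreover have "x \<in> C (restrict (q x) ?I)" using x by (auto simp: C_def)
        ultimately show "x \<in> (\<Union>f\<in>FF. C f)" by blast
      qed
      show "diameter (C f) \<le> \<delta>" for f using dia dd order_trans by blast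
    qed fact
    also have "\<dots> \<le> (\<Sum>f\<in>FF. ennreal (hc * ((1 + L) * (\<kappa> * \<tau>)) ^ (?n - 1)))"
    proof (rule sum_mono)
      fix f
      have d0: "diameter (C f) \<ge> 0" by (rule diameter_ge_0[OF bdd])
      have "diameter (C f) powr ?s = diameter (C f) ^ (?n - 1)"
      proof (cases "diameter (C f) = 0")
        case True then show ?thesis using dim by simp
      next
        case False
        then show ?thesis unfolding s using d0 by (intro powr_realpow) simp
      qed
      also have "\<dots> \<le> ((1 + L) * (\<kappa> * \<tau>)) ^ (?n - 1)" by (intro power_mono dia d0)
      finally show "ennreal (hausdorff_const ?s * diameter (C f) powr ?s) \<le> ennreal (hc * ((1 + L) * (\<kappa> * \<tau>)) ^ (?n - 1))"
        unfolding hc_def[symmetric] using hc by (intro ennreal_leI mult_left_mono)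
    qed
    also have "\<dots> = ennreal (real (card FF) * (hc * ((1 + L) * (\<kappa> * \<tau>)) ^ (?n - 1)))"
      using hc L0 \<kappa> \<tau> by (simp add: ennreal_mult ennreal_of_nat_eq_real_of_nat)
    also have "\<dots> \<le> ennreal (K * \<rho> ^ (?n - 1))"
    proof (rule ennreal_leI)
      have "card FF = (N + 1) ^ (?n - 1)" unfolding FF_def using cI by (simp add: card_PiE)
      then have "real (card FF) = (real N + 1) ^ (?n - 1)" by (simp add: add.commute)
      also have "\<dots> \<le> (2 * real N) ^ (?n - 1)" by (intro power_mono) (auto simp: N_def)
      finally have "real (card FF) * (hc * ((1 + L) * (\<kappa> * \<tau>)) ^ (?n - 1))
          \<le> (2 * real N) ^ (?n - 1) * (hc * ((1 + L) * (\<kappa> * \<tau>)) ^ (?n - 1))"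
        using hc L0 \<kappa> \<tau> by (intro mult_right_mono mult_nonneg_nonneg zero_le_power) auto
      also have "\<dots> = hc * (2 * ((1 + L) * \<kappa>) * (\<tau> * real N)) ^ (?n - 1)"
        unfolding power_mult_distrib by (simp add: mult_ac)
      also have "\<dots> = K * \<rho> ^ (?n - 1)"
        unfolding \<tau>(2) K_def mult.assoc power_mult_distrib[symmetric] by (simp add: mult_ac)
      finally show "real (card FF) * (hc * ((1 + L) * (\<kappa> * \<tau>)) ^ (?n - 1)) \<le> K * \<rho> ^ (?n - 1)" .
    qed
    finally show ?thesis .
  qed
  have "K \<ge> 0" unfolding K_def using hc L0 \<kappa> by simp
  moreover have "hausdorff_outer ?s (\<Gamma> \<inter> cball z \<rho>) \<le> ennreal (K * \<rho> ^ (?n - 1))" if "\<rho> > 0" for z \<rho>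
    unfolding hausdorff_outer_def by (rule SUP_least) (use main that in auto)
  ultimately show ?thesis unfolding \<Gamma>_def by blast
qed

section \<open>Affine substitution and differences of C1 functions along segments\<close>

lemma nn_integral_lborel_affine:
  fixes f :: "'a::euclidean_space \<Rightarrow> ennreal"
  assumes [measurable]: "f \<in> borel_measurable borel" and c: "c \<noteq> 0"
  shows "(\<integral>\<^sup>+x. f x \<partial>lborel) = ennreal (\<bar>c\<bar> ^ DIM('a)) * (\<integral>\<^sup>+x. f (a + c *\<^sub>R x) \<partial>lborel)"
  by (subst lborel_affine[OF c, of a])
     (simp add: nn_integral_density nn_integral_distr nn_integral_cmult ennreal_power)

lemma C1_grad_continuous:
  assumes "C1_grad \<phi> D\<phi>"
  shows "continuous_on UNIV \<phi>" "continuous_on UNIV D\<phi>" "\<phi> \<in> borel_measurable borel" "D\<phi> \<in> borel_measurable borel"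
proof -
  show c: "continuous_on UNIV \<phi>" "continuous_on UNIV D\<phi>"
    using assms by (auto simp: C1_grad_def intro!: has_derivative_continuous_on)
  then show "\<phi> \<in> borel_measurable borel" "D\<phi> \<in> borel_measurable borel"
    by (auto intro: borel_measurable_continuous_onI)
qed

text \<open>The fundamental theorem of calculus along the segment, followed by Cauchy-Schwarz in t.
  Nonnegative integrals are used so that the right side can be integrated further over
  \<open>x\<close> and \<open>w\<close> by Tonelli.\<close>

lemma C1_difference_along_segment:
  fixes \<phi> :: "'a::euclidean_space \<Rightarrow> real"
  assumes C1: "C1_grad \<phi> D\<phi>" and "\<delta> \<ge> 0"
  shows "ennreal ((\<phi> x - \<phi> (x + \<delta> *\<^sub>R w))\<^sup>2)
    \<le> ennreal (\<delta> * (norm w)\<^sup>2) * (\<integral>\<^sup>+t. indicator {0..\<delta>} t * ennreal ((norm (D\<phi> (x + t *\<^sub>R w)))\<^sup>2) \<partial>lborel)"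
proof -
  note [measurable] = C1_grad_continuous(4)[OF C1]
  define h where "h t = \<phi> (x + t *\<^sub>R w)" for t
  define h' where "h' t = D\<phi> (x + t *\<^sub>R w) \<bullet> w" for t
  have der: "DERIV h t :> h' t" for t
  proof -
    have "((\<lambda>t. \<phi> (x + t *\<^sub>R w)) has_derivative (\<lambda>s. D\<phi> (x + t *\<^sub>R w) \<bullet> (s *\<^sub>R w))) (at t)"
      using C1 unfolding C1_grad_def
      by (intro has_derivative_compose[of "\<lambda>t. x + t *\<^sub>R w" _ _ _ \<phi>]) (auto intro!: derivative_eq_intros)
    then show ?thesis unfolding has_field_derivative_def h_def h'_def
      by (simp add: mult.commute[of _ "_ \<bullet> _"])
  qed
  have cont: "continuous_on UNIV h'" unfolding h'_def
    by (intro continuous_intros continuous_on_compose2[OF C1_grad_continuous(2)[OF C1]]) auto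
  then have "has_bochner_integral lborel (\<lambda>t. h' t * indicator {0..\<delta>} t) (h \<delta> - h 0)"
    by (intro has_bochner_integral_FTC_Icc_real[OF \<open>\<delta> \<ge> 0\<close> der]) (simp add: continuous_on_eq_continuous_at)
  then have int: "integrable lborel (\<lambda>t. h' t * indicator {0..\<delta>} t)"
    and val: "(\<integral>t. h' t * indicator {0..\<delta>} t \<partial>lborel) = h \<delta> - h 0"
    by (auto simp: has_bochner_integral_iff)
  let ?g = "\<lambda>t. indicator {0..\<delta>} t * ennreal (norm (D\<phi> (x + t *\<^sub>R w)))"
  have "ennreal \<bar>h \<delta> - h 0\<bar> \<le> (\<integral>\<^sup>+t. ennreal (norm (h' t * indicator {0..\<delta>} t)) \<partial>lborel)"
    using integral_norm_bound_ennreal[OF int] unfolding val by simp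
  \<comment> \<open>The indicator is doubled so that in Cauchy-Schwarz one copy forms a factor of
    its own, with integral \<delta>, while the other stays with the gradient.\<close>
  also have "\<dots> \<le> (\<integral>\<^sup>+t. ennreal (norm w) * (indicator {0..\<delta>} t * ?g t) \<partial>lborel)"
  proof (rule nn_integral_mono)
    fix t
    have "\<bar>h' t\<bar> \<le> norm w * norm (D\<phi> (x + t *\<^sub>R w))"
      unfolding h'_def using Cauchy_Schwarz_ineq2[of "D\<phi> (x + t *\<^sub>R w)" w] by (simp add: mult.commute)
    then show "ennreal (norm (h' t * indicator {0..\<delta>} t)) \<le> ennreal (norm w) * (indicator {0..\<delta>} t * ?g t)"
      by (auto simp: indicator_def ennreal_mult[symmetric] intro!: ennreal_leI)
  qed
  also have "\<dots> = ennreal (norm w) * (\<integral>\<^sup>+t. indicator {0..\<delta>} t * ?g t \<partial>lborel)"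
    by (rule nn_integral_cmult) measurable
  finally have "(ennreal \<bar>h \<delta> - h 0\<bar>)\<^sup>2 \<le> (ennreal (norm w) * (\<integral>\<^sup>+t. indicator {0..\<delta>} t * ?g t \<partial>lborel))\<^sup>2"
    by (rule power_mono) simp
  also have "\<dots> = (ennreal (norm w))\<^sup>2 * (\<integral>\<^sup>+t. indicator {0..\<delta>} t * ?g t \<partial>lborel)\<^sup>2"
    by (rule power_mult_distrib)
  also have "\<dots> \<le> (ennreal (norm w))\<^sup>2 * ((\<integral>\<^sup>+t. (indicator {0..\<delta>} t)\<^sup>2 \<partial>lborel) * (\<integral>\<^sup>+t. (?g t)\<^sup>2 \<partial>lborel))"
    by (intro mult_left_mono Cauchy_Schwarz_nn_integral) auto
  also have "(\<integral>\<^sup>+t. (indicator {0..\<delta>} t)\<^sup>2 \<partial>lborel) = (\<integral>\<^sup>+t. indicator {0..\<delta>} t \<partial>lborel)"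
    by (intro nn_integral_cong) (auto simp: indicator_def)
  also have "\<dots> = ennreal \<delta>" using \<open>\<delta> \<ge> 0\<close> by simp
  also have "(\<integral>\<^sup>+t. (?g t)\<^sup>2 \<partial>lborel) = (\<integral>\<^sup>+t. indicator {0..\<delta>} t * ennreal ((norm (D\<phi> (x + t *\<^sub>R w)))\<^sup>2) \<partial>lborel)"
    by (intro nn_integral_cong) (auto simp: indicator_def ennreal_power)
  finally have *: "(ennreal \<bar>h \<delta> - h 0\<bar>)\<^sup>2 \<le> (ennreal (norm w))\<^sup>2 * (ennreal \<delta> *
      (\<integral>\<^sup>+t. indicator {0..\<delta>} t * ennreal ((norm (D\<phi> (x + t *\<^sub>R w)))\<^sup>2) \<partial>lborel))" .
  have "ennreal ((\<phi> x - \<phi> (x + \<delta> *\<^sub>R w))\<^sup>2) = (ennreal \<bar>h \<delta> - h 0\<bar>)\<^sup>2"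
    by (simp add: ennreal_power h_def power2_commute)
  moreover have "(ennreal (norm w))\<^sup>2 * ennreal \<delta> = ennreal (\<delta> * (norm w)\<^sup>2)"
    using \<open>\<delta> \<ge> 0\<close> by (simp add: ennreal_power ennreal_mult mult.commute)
  ultimately show ?thesis using * by (simp add: mult.assoc[symmetric])
qed

section \<open>Lipschitz charts, depth below the graph and inward cones\<close>

definition boundary_chart :: "'a::euclidean_space set \<Rightarrow> 'a \<Rightarrow> 'a \<Rightarrow> real \<Rightarrow> real \<Rightarrow> ('a \<Rightarrow> real) \<Rightarrow> bool" where
  "boundary_chart \<Omega> p e r L \<gamma> \<longleftrightarrow>
     norm e = 1 \<and> r > 0 \<and> L-lipschitz_on {y. y \<bullet> e = 0} \<gamma> \<and>
     (\<forall>x \<in> ball p r. x \<in> \<Omega> \<longleftrightarrow> x \<bullet> e < \<gamma> (x - (x \<bullet> e) *\<^sub>R e))"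

text \<open>The projection orthogonal to \<open>e\<close> annihilates t e, so any multiple of
  \<open>e\<close> may be added to x - y. The free t serves the cone around the inward direction -e,
  where y - x + t e is the small quantity.\<close>

lemma chart_gamma_diff:
  fixes e :: "'a::euclidean_space"
  assumes "norm e = 1" "L-lipschitz_on {y. y \<bullet> e = 0} \<gamma>"
  shows "\<bar>\<gamma> (x - (x \<bullet> e) *\<^sub>R e) - \<gamma> (y - (y \<bullet> e) *\<^sub>R e)\<bar> \<le> L * norm (x - y + t *\<^sub>R e)"
proof -
  have ee: "e \<bullet> e = 1" using assms by (simp add: dot_square_norm)
  have "dist (\<gamma> (x - (x \<bullet> e) *\<^sub>R e)) (\<gamma> (y - (y \<bullet> e) *\<^sub>R e)) \<le> L * dist (x - (x \<bullet> e) *\<^sub>R e) (y - (y \<bullet> e) *\<^sub>R e)"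
    by (rule lipschitz_onD[OF assms(2)]) (auto simp: inner_diff_left ee)
  also have "dist (x - (x \<bullet> e) *\<^sub>R e) (y - (y \<bullet> e) *\<^sub>R e)
      = norm ((x - y + t *\<^sub>R e) - ((x - y + t *\<^sub>R e) \<bullet> e) *\<^sub>R e)"
    by (simp add: dist_norm algebra_simps inner_add_left inner_diff_left ee)
  also have "L * \<dots> \<le> L * norm (x - y + t *\<^sub>R e)"
    by (intro mult_left_mono norm_perp_le assms lipschitz_on_nonneg[OF assms(2)])
  finally show ?thesis by (simp add: dist_norm)
qed

text \<open>A frontier point is outside the open set \<Omega>, hence not below the graph. Strictly
  above the graph it would have a neighbourhood free of points of \<Omega>, contradicting membership
  in the closure.\<close>

lemma frontier_in_chart:
  fixes \<Omega> :: "'a::euclidean_space set"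
  assumes ch: "boundary_chart \<Omega> p e r L \<gamma>" and "open \<Omega>" and x: "x \<in> frontier \<Omega>" "x \<in> ball p r"
  shows "x \<bullet> e = \<gamma> (x - (x \<bullet> e) *\<^sub>R e)"
proof (rule ccontr)
  assume ne: "x \<bullet> e \<noteq> \<gamma> (x - (x \<bullet> e) *\<^sub>R e)"
  let ?h = "\<lambda>y. y \<bullet> e - \<gamma> (y - (y \<bullet> e) *\<^sub>R e)"
  have L: "L \<ge> 0" and e: "norm e = 1" and lip: "L-lipschitz_on {y. y \<bullet> e = 0} \<gamma>"
    using ch lipschitz_on_nonneg by (auto simp: boundary_chart_def)
  have "x \<notin> \<Omega>" using x \<open>open \<Omega>\<close> by (simp add: frontier_def interior_open)
  then have pos: "?h x > 0" using ch x(2) ne unfolding boundary_chart_def by fastforce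
  \<comment> \<open>Height minus \<gamma> is Lipschitz with constant 1 + L, so closer than
    \<open>?h x / (1 + L)\<close> it stays positive; the other entry keeps the point inside the
    chart.\<close>
  define d where "d = min (r - dist p x) (?h x / (1 + L))"
  have d: "d > 0" using pos L x by (auto simp: d_def)
  have "x \<in> closure \<Omega>" using x by (simp add: frontier_def)
  then obtain y where y: "y \<in> \<Omega>" "dist y x < d" using d closure_approachable by blast
  have "dist p y < r" using y dist_triangle[of p y x] by (auto simp: d_def dist_commute)
  then have "?h y < 0" using ch y(1) unfolding boundary_chart_def by auto
  moreover have "\<bar>y \<bullet> e - x \<bullet> e\<bar> \<le> norm (y - x)"
    using Cauchy_Schwarz_ineq2[of "y - x" e] e by (simp add: inner_diff_left)
  moreover have "\<bar>\<gamma> (y - (y \<bullet> e) *\<^sub>R e) - \<gamma> (x - (x \<bullet> e) *\<^sub>R e)\<bar> \<le> L * norm (y - x)"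
    using chart_gamma_diff[OF e lip, of y x 0] by simp
  ultimately have "?h x < (1 + L) * norm (y - x)" by (simp add: algebra_simps)
  also have "\<dots> \<le> (1 + L) * (?h x / (1 + L))"
    using y L by (intro mult_left_mono) (auto simp: d_def dist_norm)
  finally show False using L by simp
qed

text \<open>The domain lies below the graph, so -e points inward and \<gamma> minus the height of y
  is the depth of y. At x - t e the depth is exactly t. Depth is Lipschitz with constant 1 + L, so
  on the ball of radius c t around that point it changes by at most c (1 + L) t \<le> t/2 and
  remains comparable to t.\<close>

lemma cone_in_chart:
  fixes \<Omega> :: "'a::euclidean_space set"
  assumes ch: "boundary_chart \<Omega> p e r L \<gamma>" and op: "open \<Omega>"
    and x: "x \<in> frontier \<Omega> \<inter> cball p (r/2)" and t: "0 < t" "2 * t < r / 2"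
    and c: "c > 0" "c * (1 + L) \<le> 1/2" and y: "norm (y - x + t *\<^sub>R e) \<le> c * t"
  shows "y \<in> \<Omega>" "t / 2 \<le> \<gamma> (y - (y \<bullet> e) *\<^sub>R e) - y \<bullet> e" "\<gamma> (y - (y \<bullet> e) *\<^sub>R e) - y \<bullet> e \<le> 2 * t"
proof -
  let ?\<eta> = "\<gamma> (y - (y \<bullet> e) *\<^sub>R e) - y \<bullet> e"
  have L: "L \<ge> 0" and e: "norm e = 1" and lip: "L-lipschitz_on {y. y \<bullet> e = 0} \<gamma>" and r: "r > 0"
    using ch lipschitz_on_nonneg by (auto simp: boundary_chart_def)
  have ee: "e \<bullet> e = 1" using e by (simp add: dot_square_norm)
  have xg: "x \<bullet> e = \<gamma> (x - (x \<bullet> e) *\<^sub>R e)"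
    by (rule frontier_in_chart[OF ch op]) (use x r in auto)
  let ?v = "y - x + t *\<^sub>R e"
  have "y \<bullet> e = x \<bullet> e - t + ?v \<bullet> e" by (simp add: inner_add_left inner_diff_left ee)
  moreover have "\<bar>?v \<bullet> e\<bar> \<le> norm ?v" using Cauchy_Schwarz_ineq2[of ?v e] e by simp
  moreover have "\<bar>\<gamma> (y - (y \<bullet> e) *\<^sub>R e) - \<gamma> (x - (x \<bullet> e) *\<^sub>R e)\<bar> \<le> L * norm ?v"
    by (rule chart_gamma_diff[OF e lip])
  ultimately have "\<bar>?\<eta> - t\<bar> \<le> norm ?v + L * norm ?v" using xg by linarith
  also have "\<dots> = (1 + L) * norm ?v" by (simp only: distrib_right mult_1)
  also have "\<dots> \<le> (1 + L) * (c * t)" using L y by (intro mult_left_mono) auto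
  also have "\<dots> = (c * (1 + L)) * t" by simp
  also have "\<dots> \<le> 1/2 * t" using c t by (intro mult_right_mono) auto
  finally have *: "\<bar>?\<eta> - t\<bar> \<le> 1/2 * t" .
  then show "t / 2 \<le> ?\<eta>" "?\<eta> \<le> 2 * t" using t by linarith+
  \<comment> \<open>Now c \<le> 1 keeps y within 2 t < r/2 of x, and hence inside the chart ball of
    radius r.\<close>
  have "c * 1 \<le> c * (1 + L)" using c L by (intro mult_left_mono) auto
  then have "c \<le> 1" using c by linarith
  then have "norm ?v \<le> t" using y t mult_right_mono[of c 1 t] by linarith
  then have "norm (y - x) \<le> 2 * t" using norm_triangle_ineq4[of ?v "t *\<^sub>R e"] e t by simp
  then have "dist p y < r" using x t dist_triangle[of p y x] by (simp add: dist_norm norm_minus_commute)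
  then show "y \<in> \<Omega>" using ch * t unfolding boundary_chart_def by auto
qed

lemma emeasure_surface_chart_ball_le:
  fixes \<Omega> :: "'a::euclidean_space set"
  assumes dim: "DIM('a) \<ge> 2" and ch: "boundary_chart \<Omega> p e r L \<gamma>" and op: "open \<Omega>"
  shows "\<exists>K\<ge>0. \<forall>z. \<forall>\<rho>>0. emeasure (surface_measure \<Omega>) (frontier \<Omega> \<inter> cball p (r/2) \<inter> cball z \<rho>)
     \<le> ennreal (K * \<rho> ^ (DIM('a) - 1))"
proof -
  have e: "norm e = 1" and lip: "L-lipschitz_on {y. y \<bullet> e = 0} \<gamma>" and r: "r > 0"
    using ch by (auto simp: boundary_chart_def)
  from hausdorff_outer_graph_ball_le[OF dim e lip] obtain K where K: "K \<ge> 0"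
    "\<And>z \<rho>. \<rho> > 0 \<Longrightarrow> hausdorff_outer (real DIM('a) - 1)
      ({x. x \<bullet> e = \<gamma> (x - (x \<bullet> e) *\<^sub>R e)} \<inter> cball z \<rho>) \<le> ennreal (K * \<rho> ^ (DIM('a) - 1))" by blast
  show ?thesis
  proof (intro exI[of _ K] conjI allI impI K(1))
    fix z \<rho> assume \<rho>: "(0::real) < \<rho>"
    have "emeasure (surface_measure \<Omega>) (frontier \<Omega> \<inter> cball p (r/2) \<inter> cball z \<rho>)
       = hausdorff_outer (real DIM('a) - 1) (frontier \<Omega> \<inter> cball p (r/2) \<inter> cball z \<rho>)"
      by (rule emeasure_surface_measure) auto
    also have "\<dots> \<le> hausdorff_outer (real DIM('a) - 1) ({x. x \<bullet> e = \<gamma> (x - (x \<bullet> e) *\<^sub>R e)} \<inter> cball z \<rho>)"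
    proof (rule hausdorff_outer_mono, rule subsetI)
      fix x assume x: "x \<in> frontier \<Omega> \<inter> cball p (r/2) \<inter> cball z \<rho>"
      have "x \<bullet> e = \<gamma> (x - (x \<bullet> e) *\<^sub>R e)"
        by (rule frontier_in_chart[OF ch op]) (use x r in auto)
      then show "x \<in> {x. x \<bullet> e = \<gamma> (x - (x \<bullet> e) *\<^sub>R e)} \<inter> cball z \<rho>" using x by simp
    qed
    also have "\<dots> \<le> ennreal (K * \<rho> ^ (DIM('a) - 1))" by (rule K(2)[OF \<rho>])
    finally show "emeasure (surface_measure \<Omega>) (frontier \<Omega> \<inter> cball p (r/2) \<inter> cball z \<rho>) \<le> ennreal (K * \<rho> ^ (DIM('a) - 1))" .
  qed
qed

lemma finite_chart_cover:
  fixes \<Omega> :: "'a::euclidean_space set"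
  assumes "bounded \<Omega>" "lipschitz_domain \<Omega>"
  shows "\<exists>P e r L \<gamma>. finite P \<and> P \<subseteq> frontier \<Omega> \<and> (\<forall>p\<in>P. boundary_chart \<Omega> p (e p) (r p) (L p) (\<gamma> p))
     \<and> frontier \<Omega> \<subseteq> (\<Union>p\<in>P. cball p (r p / 2))"
proof -
  have "\<forall>p\<in>frontier \<Omega>. \<exists>e r L \<gamma>. boundary_chart \<Omega> p e r L \<gamma>"
    using assms(2) unfolding lipschitz_domain_def boundary_chart_def by blast
  then obtain e r L \<gamma> where ch: "\<And>p. p \<in> frontier \<Omega> \<Longrightarrow> boundary_chart \<Omega> p (e p) (r p) (L p) (\<gamma> p)"
    by metis
  have comp: "compact (frontier \<Omega>)" using assms(1) by (rule compact_frontier_bounded)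
  have cov: "frontier \<Omega> \<subseteq> (\<Union>p\<in>frontier \<Omega>. ball p (r p / 2))"
  proof
    fix p assume p: "p \<in> frontier \<Omega>"
    with ch have "r p > 0" by (auto simp: boundary_chart_def)
    then show "p \<in> (\<Union>p\<in>frontier \<Omega>. ball p (r p / 2))" using p by (intro UN_I[of p]) auto
  qed
  obtain P where P: "P \<subseteq> frontier \<Omega>" "finite P" "frontier \<Omega> \<subseteq> (\<Union>p\<in>P. ball p (r p / 2))"
    by (rule compactE_image[OF comp open_ball cov])
  have "frontier \<Omega> \<subseteq> (\<Union>p\<in>P. cball p (r p / 2))"
    by (rule subset_trans[OF P(3)]) (intro UN_mono order_refl ball_subset_cball)
  then show ?thesis using P(1,2) ch
    by (intro exI[of _ P] exI[of _ e] exI[of _ r] exI[of _ L] exI[of _ \<gamma>] conjI ballI) (assumption | rule ch subsetD)+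
qed

lemma finite_measure_surface:
  fixes \<Omega> :: "'a::euclidean_space set"
  assumes dim: "DIM('a) \<ge> 2" and "bounded \<Omega>" "lipschitz_domain \<Omega>"
  shows "finite_measure (surface_measure \<Omega>)"
proof
  from finite_chart_cover[OF assms(2,3)] obtain P e r L \<gamma> where P: "finite P"
    "\<And>p. p \<in> P \<Longrightarrow> boundary_chart \<Omega> p (e p) (r p) (L p) (\<gamma> p)"
    "frontier \<Omega> \<subseteq> (\<Union>p\<in>P. cball p (r p / 2))" by blast
  have op: "open \<Omega>" using assms(3) by (simp add: lipschitz_domain_def)
  have meas: "frontier \<Omega> \<inter> cball p (r p / 2) \<in> sets (surface_measure \<Omega>)" for p
    unfolding sets_surface_measure by (auto simp: sets_restrict_space)
  have fin: "emeasure (surface_measure \<Omega>) (frontier \<Omega> \<inter> cball p (r p / 2)) < top" if p: "p \<in> P" for p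
  proof -
    from emeasure_surface_chart_ball_le[OF dim P(2)[OF p] op] obtain K where
      K: "\<And>z \<rho>. \<rho> > 0 \<Longrightarrow> emeasure (surface_measure \<Omega>) (frontier \<Omega> \<inter> cball p (r p/2) \<inter> cball z \<rho>)
        \<le> ennreal (K * \<rho> ^ (DIM('a) - 1))" by blast
    have "r p > 0" using P(2)[OF p] by (auto simp: boundary_chart_def)
    from K[of "r p / 2" p] this have "emeasure (surface_measure \<Omega>) (frontier \<Omega> \<inter> cball p (r p/2)) \<le> ennreal (K * (r p/2) ^ (DIM('a) - 1))"
      by (simp add: Int_assoc)
    then show ?thesis by (rule order.strict_trans1) simp
  qed
  have "space (surface_measure \<Omega>) = (\<Union>p\<in>P. frontier \<Omega> \<inter> cball p (r p / 2))" using P(3) by auto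
  then have "emeasure (surface_measure \<Omega>) (space (surface_measure \<Omega>)) \<le> (\<Sum>p\<in>P. emeasure (surface_measure \<Omega>) (frontier \<Omega> \<inter> cball p (r p / 2)))"
    using emeasure_subadditive_finite[OF P(1), of "\<lambda>p. frontier \<Omega> \<inter> cball p (r p / 2)" "surface_measure \<Omega>"] meas by auto
  also have "\<dots> < top" using fin P(1) by (simp add: ennreal_sum_less_top)
  finally show "emeasure (surface_measure \<Omega>) (space (surface_measure \<Omega>)) \<noteq> \<infinity>" by simp
qed

section \<open>Compactness of boundary values\<close>

text \<open>The substitution y = x + t (\<zeta> - e) turns the left side into the integral of f(y)
  against a kernel 1/t^n in x and t. For fixed y the depth estimate confines t to an interval of
  length 3\<eta>/2, and the x that contribute at a given t lie in a ball of radius c t, of mass at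
  most K (c t)^(n-1). Hence the kernel has total mass at most K c^(n-1) * (2/\<eta>) * (3\<eta>/2),
  whatever the depth \<eta> of y: this is the constant 3 K c^(n-1).\<close>

lemma cone_kernel_estimate:
  fixes \<nu> :: "'a::euclidean_space measure" and \<eta> :: "'a \<Rightarrow> real" and f :: "'a \<Rightarrow> ennreal"
  assumes s\<nu>[measurable_cong]: "sets \<nu> = sets borel" and fin: "finite_measure \<nu>"
    and [measurable]: "S \<in> sets borel" "f \<in> borel_measurable borel" "\<Omega> \<in> sets borel"
    and K: "K \<ge> 0" "\<And>z \<rho>. \<rho> > 0 \<Longrightarrow> emeasure \<nu> (S \<inter> cball z \<rho>) \<le> ennreal (K * \<rho> ^ (DIM('a) - 1))"
    and c: "c > 0"
    and cone: "\<And>x t y. x \<in> S \<Longrightarrow> 0 < t \<Longrightarrow> t \<le> \<delta> \<Longrightarrow> norm (y - x + t *\<^sub>R e) \<le> c * t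
      \<Longrightarrow> y \<in> \<Omega> \<and> t / 2 \<le> \<eta> y \<and> \<eta> y \<le> 2 * t"
  shows "(\<integral>\<^sup>+x. indicator S x * (\<integral>\<^sup>+t. indicator {0<..\<delta>} t *
            (\<integral>\<^sup>+\<zeta>. indicator (cball 0 c) \<zeta> * f (x + t *\<^sub>R (\<zeta> - e)) \<partial>lborel) \<partial>lborel) \<partial>\<nu>)
     \<le> ennreal (3 * K * c ^ (DIM('a) - 1)) * (\<integral>\<^sup>+y. indicator \<Omega> y * f y \<partial>lborel)"
proof -
  interpret finite_measure \<nu> by fact
  interpret P1: pair_sigma_finite \<nu> "lborel :: 'a measure" by standard
  interpret P2: pair_sigma_finite \<nu> "lborel :: real measure" by standard
  let ?n = "DIM('a)"
  define W where "W x t y = indicator S x * (indicator {0<..\<delta>} t * (ennreal (1 / t ^ ?n) *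
      ((if norm (y - x + t *\<^sub>R e) \<le> c * t then 1 else 0) * f y)))" for x :: 'a and t :: real and y :: 'a
  have [measurable (raw)]: "(\<lambda>p. W (X p) (T p) (Y p)) \<in> borel_measurable N"
    if [measurable]: "X \<in> borel_measurable N" "T \<in> borel_measurable N" "Y \<in> borel_measurable N" for X T Y N
    unfolding W_def by measurable
  have inner: "indicator {0<..\<delta>} t * (\<integral>\<^sup>+\<zeta>. indicator (cball 0 c) \<zeta> * f (x + t *\<^sub>R (\<zeta> - e)) \<partial>lborel)
      = (\<integral>\<^sup>+y. indicator {0<..\<delta>} t * (ennreal (1 / t ^ ?n) * ((if norm (y - x + t *\<^sub>R e) \<le> c * t then 1 else 0) * f y)) \<partial>lborel)"
    for t :: real and x :: 'a
  proof (cases "t \<in> {0<..\<delta>}")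
    case True
    then have t: "t > 0" by simp
    let ?g = "\<lambda>y. (if norm (y - x + t *\<^sub>R e) \<le> c * t then 1 else 0) * f y"
    have "(\<integral>\<^sup>+y. ?g y \<partial>lborel) = ennreal (t ^ ?n) * (\<integral>\<^sup>+\<zeta>. ?g ((x - t *\<^sub>R e) + t *\<^sub>R \<zeta>) \<partial>lborel)"
      using t by (subst nn_integral_lborel_affine[where c=t and a="x - t *\<^sub>R e"]) auto
    also have "(\<integral>\<^sup>+\<zeta>. ?g ((x - t *\<^sub>R e) + t *\<^sub>R \<zeta>) \<partial>lborel) = (\<integral>\<^sup>+\<zeta>. indicator (cball 0 c) \<zeta> * f (x + t *\<^sub>R (\<zeta> - e)) \<partial>lborel)"
    proof (rule nn_integral_cong)
      fix \<zeta> :: 'a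
      have e1: "(x - t *\<^sub>R e) + t *\<^sub>R \<zeta> - x + t *\<^sub>R e = t *\<^sub>R \<zeta>" by simp
      have e2: "(x - t *\<^sub>R e) + t *\<^sub>R \<zeta> = x + t *\<^sub>R (\<zeta> - e)" by (simp add: algebra_simps)
      have e3: "norm (t *\<^sub>R \<zeta>) \<le> c * t \<longleftrightarrow> \<zeta> \<in> cball 0 c" using t by (simp add: mult.commute)
      show "?g ((x - t *\<^sub>R e) + t *\<^sub>R \<zeta>) = indicator (cball 0 c) \<zeta> * f (x + t *\<^sub>R (\<zeta> - e))"
        unfolding e1 e3 unfolding e2 by (simp only: indicator_def of_bool_def)
    qed
    finally have "ennreal (1 / t ^ ?n) * (\<integral>\<^sup>+y. ?g y \<partial>lborel) = (ennreal (1 / t ^ ?n) * ennreal (t ^ ?n)) *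
        (\<integral>\<^sup>+\<zeta>. indicator (cball 0 c) \<zeta> * f (x + t *\<^sub>R (\<zeta> - e)) \<partial>lborel)" by (simp add: mult.assoc)
    also have "ennreal (1 / t ^ ?n) * ennreal (t ^ ?n) = 1" using t by (simp add: ennreal_mult[symmetric])
    finally have "ennreal (1 / t ^ ?n) * (\<integral>\<^sup>+y. ?g y \<partial>lborel) = (\<integral>\<^sup>+\<zeta>. indicator (cball 0 c) \<zeta> * f (x + t *\<^sub>R (\<zeta> - e)) \<partial>lborel)" by simp
    moreover have "(\<integral>\<^sup>+y. ennreal (1 / t ^ ?n) * ?g y \<partial>lborel) = ennreal (1 / t ^ ?n) * (\<integral>\<^sup>+y. ?g y \<partial>lborel)"
      by (rule nn_integral_cmult) measurable
    ultimately show ?thesis using True by simp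
  qed simp
  have "(\<integral>\<^sup>+x. indicator S x * (\<integral>\<^sup>+t. indicator {0<..\<delta>} t *
            (\<integral>\<^sup>+\<zeta>. indicator (cball 0 c) \<zeta> * f (x + t *\<^sub>R (\<zeta> - e)) \<partial>lborel) \<partial>lborel) \<partial>\<nu>)
      = (\<integral>\<^sup>+x. (\<integral>\<^sup>+t. (\<integral>\<^sup>+y. W x t y \<partial>lborel) \<partial>lborel) \<partial>\<nu>)"
  proof (rule nn_integral_cong)
    fix x
    show "indicator S x * (\<integral>\<^sup>+t. indicator {0<..\<delta>} t *
            (\<integral>\<^sup>+\<zeta>. indicator (cball 0 c) \<zeta> * f (x + t *\<^sub>R (\<zeta> - e)) \<partial>lborel) \<partial>lborel)
        = (\<integral>\<^sup>+t. (\<integral>\<^sup>+y. W x t y \<partial>lborel) \<partial>lborel)"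
      unfolding inner W_def by (cases "x \<in> S") simp_all
  qed
  \<comment> \<open>Three exchanges move the integration over \<open>x\<close> to the innermost
    place, where for fixed t and y it measures a ball.\<close>
  also have "\<dots> = (\<integral>\<^sup>+t. (\<integral>\<^sup>+x. (\<integral>\<^sup>+y. W x t y \<partial>lborel) \<partial>\<nu>) \<partial>lborel)"
    by (rule P2.Fubini'[symmetric]) measurable
  also have "\<dots> = (\<integral>\<^sup>+t. (\<integral>\<^sup>+y. (\<integral>\<^sup>+x. W x t y \<partial>\<nu>) \<partial>lborel) \<partial>lborel)"
    by (intro nn_integral_cong P1.Fubini'[symmetric]) measurable
  also have "\<dots> = (\<integral>\<^sup>+y. (\<integral>\<^sup>+t. (\<integral>\<^sup>+x. W x t y \<partial>\<nu>) \<partial>lborel) \<partial>lborel)"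
    by (rule lborel_pair.Fubini'[symmetric]) measurable
  also have "\<dots> \<le> (\<integral>\<^sup>+y. ennreal (3 * K * c ^ (?n - 1)) * (indicator \<Omega> y * f y) \<partial>lborel)"
  proof (rule nn_integral_mono)
    fix y :: 'a
    \<comment> \<open>The cone condition places t in [\<eta>/2, 2\<eta>], where 1/t \<le> 2/\<eta>.
      The mass bound of order t^(n-1) leaves a single factor 1/t of 1/t^n.\<close>
    have pt: "(\<integral>\<^sup>+x. W x t y \<partial>\<nu>) \<le> (if \<eta> y > 0 then ennreal (K * c ^ (?n - 1) * 2 / \<eta> y) * (indicator \<Omega> y * f y) else 0) * indicator {\<eta> y / 2..2 * \<eta> y} t"
      for t
    proof (cases "0 < t \<and> t \<le> \<delta> \<and> (\<exists>x\<in>S. norm (y - x + t *\<^sub>R e) \<le> c * t)")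
      case False
      then have "W x t y = 0" for x by (auto simp: W_def indicator_def)
      then show ?thesis by simp
    next
      case True
      then have t: "t > 0" "t \<le> \<delta>" by auto
      with True cone have y: "y \<in> \<Omega>" "t / 2 \<le> \<eta> y" "\<eta> y \<le> 2 * t" by blast+
      then have pos: "\<eta> y > 0" using t by linarith
      have "(\<integral>\<^sup>+x. W x t y \<partial>\<nu>) = (\<integral>\<^sup>+x. (ennreal (1 / t ^ ?n) * f y) * indicator (S \<inter> cball (y + t *\<^sub>R e) (c * t)) x \<partial>\<nu>)"
        by (intro nn_integral_cong) (use t in \<open>auto simp: W_def indicator_def dist_norm algebra_simps\<close>)
      also have "\<dots> = (ennreal (1 / t ^ ?n) * f y) * emeasure \<nu> (S \<inter> cball (y + t *\<^sub>R e) (c * t))"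
        by (rule nn_integral_cmult_indicator) (simp add: s\<nu>)
      also have "\<dots> \<le> (ennreal (1 / t ^ ?n) * f y) * ennreal (K * (c * t) ^ (?n - 1))"
        by (intro mult_left_mono K(2)) (use t c in auto)
      also have "\<dots> = ennreal (1 / t ^ ?n * (K * (c * t) ^ (?n - 1))) * f y"
        using t c K by (subst ennreal_mult) (auto simp: mult_ac)
      also have "\<dots> \<le> ennreal (K * c ^ (?n - 1) * 2 / \<eta> y) * f y"
      proof (intro mult_right_mono ennreal_leI)
        have "t ^ ?n = t * t ^ (?n - 1)" by (simp add: power_eq_if)
        then have "1 / t ^ ?n * (K * (c * t) ^ (?n - 1)) = (K * c ^ (?n - 1)) * (1 / t)"
          using t by (simp add: power_mult_distrib)
        also have "\<dots> \<le> (K * c ^ (?n - 1)) * (2 / \<eta> y)"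
          using t pos y K c by (intro mult_left_mono) (auto simp: field_simps)
        finally show "1 / t ^ ?n * (K * (c * t) ^ (?n - 1)) \<le> K * c ^ (?n - 1) * 2 / \<eta> y" by simp
      qed simp
      finally show ?thesis using y pos by (simp add: field_simps)
    qed
    have "(\<integral>\<^sup>+t. (\<integral>\<^sup>+x. W x t y \<partial>\<nu>) \<partial>lborel)
      \<le> (\<integral>\<^sup>+t. (if \<eta> y > 0 then ennreal (K * c ^ (?n - 1) * 2 / \<eta> y) * (indicator \<Omega> y * f y) else 0) * indicator {\<eta> y / 2..2 * \<eta> y} t \<partial>lborel)"
      by (rule nn_integral_mono) (rule pt)
    also have "\<dots> = (if \<eta> y > 0 then ennreal (K * c ^ (?n - 1) * 2 / \<eta> y) * (indicator \<Omega> y * f y) else 0) * emeasure lborel {\<eta> y / 2..2 * \<eta> y}"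
      by (rule nn_integral_cmult_indicator) simp
    also have "\<dots> \<le> ennreal (3 * K * c ^ (?n - 1)) * (indicator \<Omega> y * f y)"
    proof (cases "\<eta> y > 0")
      case True
      have "ennreal (K * c ^ (?n - 1) * 2 / \<eta> y) * emeasure lborel {\<eta> y / 2..2 * \<eta> y}
          = ennreal (K * c ^ (?n - 1) * 2 / \<eta> y * (2 * \<eta> y - \<eta> y / 2))"
        using True K c by (subst ennreal_mult) auto
      also have "K * c ^ (?n - 1) * 2 / \<eta> y * (2 * \<eta> y - \<eta> y / 2) = 3 * K * c ^ (?n - 1)"
        using True by (simp add: field_simps)
      finally show ?thesis using True by (simp add: mult_ac)
    qed simp
    finally show "(\<integral>\<^sup>+t. (\<integral>\<^sup>+x. W x t y \<partial>\<nu>) \<partial>lborel) \<le> ennreal (3 * K * c ^ (?n - 1)) * (indicator \<Omega> y * f y)" .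
  qed
  also have "\<dots> = ennreal (3 * K * c ^ (?n - 1)) * (\<integral>\<^sup>+y. indicator \<Omega> y * f y \<partial>lborel)"
    by (rule nn_integral_cmult) measurable
  finally show ?thesis .
qed

lemma integrable_continuous_on_compact:
  fixes g :: "'a::euclidean_space \<Rightarrow> 'b::{banach, second_countable_topology}"
  assumes "compact B" "continuous_on UNIV g"
  shows "integrable lborel (\<lambda>y. indicator B y *\<^sub>R g y)"
  by (rule borel_integrable_compact[OF assms(1)]) (rule continuous_on_subset[OF assms(2)], simp)

lemma square_integral_compact_le:
  fixes g :: "'a::euclidean_space \<Rightarrow> real"
  assumes B: "compact B" and g: "continuous_on UNIV g"
  shows "ennreal ((LINT y|lborel. indicator B y * g y)\<^sup>2)
    \<le> emeasure lborel B * (\<integral>\<^sup>+y. indicator B y * ennreal ((g y)\<^sup>2) \<partial>lborel)"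
proof -
  have [measurable]: "g \<in> borel_measurable borel" "B \<in> sets borel"
    using g borel_compact[OF B] by (auto intro: borel_measurable_continuous_onI)
  have int: "integrable lborel (\<lambda>y. indicator B y * g y)"
    using integrable_continuous_on_compact[OF assms] by simp
  let ?g = "\<lambda>y. indicator B y * ennreal \<bar>g y\<bar>"
  have "ennreal \<bar>LINT y|lborel. indicator B y * g y\<bar> \<le> (\<integral>\<^sup>+y. ennreal (norm (indicator B y * g y)) \<partial>lborel)"
    using integral_norm_bound_ennreal[OF int] by simp
  also have "\<dots> = (\<integral>\<^sup>+y. indicator B y * ?g y \<partial>lborel)"
    by (intro nn_integral_cong) (auto simp: indicator_def)
  finally have "(ennreal \<bar>LINT y|lborel. indicator B y * g y\<bar>)\<^sup>2 \<le> (\<integral>\<^sup>+y. indicator B y * ?g y \<partial>lborel)\<^sup>2"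
    by (rule power_mono) simp
  also have "\<dots> \<le> (\<integral>\<^sup>+y. (indicator B y)\<^sup>2 \<partial>lborel) * (\<integral>\<^sup>+y. (?g y)\<^sup>2 \<partial>lborel)"
    by (rule Cauchy_Schwarz_nn_integral) auto
  also have "(\<integral>\<^sup>+y. (indicator B y)\<^sup>2 \<partial>lborel) = (\<integral>\<^sup>+y. indicator B y \<partial>lborel)"
    by (intro nn_integral_cong) (auto simp: indicator_def)
  also have "\<dots> = emeasure lborel B" by simp
  also have "(\<integral>\<^sup>+y. (?g y)\<^sup>2 \<partial>lborel) = (\<integral>\<^sup>+y. indicator B y * ennreal ((g y)\<^sup>2) \<partial>lborel)"
    by (intro nn_integral_cong) (auto simp: indicator_def ennreal_power)
  finally show ?thesis by (simp add: ennreal_power)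
qed

text \<open>\<phi>(x) is the mean of \<phi> over B plus the mean of \<phi>(x) - \<phi>(y). The
  inequality (a+b)^2 \<le> 2a^2 + 2b^2 and Cauchy-Schwarz on the second mean give the constants
  2/V^2 and 2/V.\<close>

lemma square_le_average_plus_oscillation:
  fixes \<phi> :: "'a::euclidean_space \<Rightarrow> real"
  assumes B: "compact B" and \<phi>: "continuous_on UNIV \<phi>" and V: "V > 0" "emeasure lborel B = ennreal V"
  shows "ennreal ((\<phi> x)\<^sup>2) \<le> ennreal (2 / V\<^sup>2 * (LINT y|lborel. indicator B y * \<phi> y)\<^sup>2)
     + ennreal (2 / V) * (\<integral>\<^sup>+y. indicator B y * ennreal ((\<phi> x - \<phi> y)\<^sup>2) \<partial>lborel)"
proof -
  define m where "m = (LINT y|lborel. indicator B y * \<phi> y)"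
  define D where "D = (LINT y|lborel. indicator B y * (\<phi> x - \<phi> y))"
  have [measurable]: "B \<in> sets borel" by (rule borel_compact[OF B])
  have mB: "measure lborel B = V" using V by (simp add: measure_def)
  have "integrable lborel (\<lambda>y. indicator B y * \<phi> y)" "integrable lborel (\<lambda>y. indicator B y * \<phi> x)"
    using integrable_continuous_on_compact[OF B \<phi>] integrable_continuous_on_compact[OF B, of "\<lambda>_. \<phi> x"] by auto
  then have "D = V * \<phi> x - m" unfolding D_def m_def using mB
    by (simp add: right_diff_distrib)
  then have "\<phi> x = m / V + D / V" using V by (simp add: field_simps)
  then have "(\<phi> x)\<^sup>2 \<le> 2 * (m / V)\<^sup>2 + 2 * (D / V)\<^sup>2"
    using sum_squares_bound[of "m / V" "D / V"] by (simp add: power2_sum)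
  then have "ennreal ((\<phi> x)\<^sup>2) \<le> ennreal (2 / V\<^sup>2 * m\<^sup>2 + 2 / V\<^sup>2 * D\<^sup>2)"
    by (intro ennreal_leI) (simp add: power_divide)
  also have "\<dots> = ennreal (2 / V\<^sup>2 * m\<^sup>2) + ennreal (2 / V\<^sup>2) * ennreal (D\<^sup>2)"
    using ennreal_mult[of "2 / V\<^sup>2" "D\<^sup>2"] by simp
  also have "ennreal (D\<^sup>2) \<le> ennreal V * (\<integral>\<^sup>+y. indicator B y * ennreal ((\<phi> x - \<phi> y)\<^sup>2) \<partial>lborel)"
    unfolding D_def V(2)[symmetric] by (intro square_integral_compact_le B continuous_intros \<phi>)
  finally have "ennreal ((\<phi> x)\<^sup>2) \<le> ennreal (2 / V\<^sup>2 * m\<^sup>2) +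
      ennreal (2 / V\<^sup>2) * (ennreal V * (\<integral>\<^sup>+y. indicator B y * ennreal ((\<phi> x - \<phi> y)\<^sup>2) \<partial>lborel))"
    by (simp add: add_left_mono mult_left_mono)
  also have "ennreal (2 / V\<^sup>2) * (ennreal V * (\<integral>\<^sup>+y. indicator B y * ennreal ((\<phi> x - \<phi> y)\<^sup>2) \<partial>lborel))
      = ennreal (2 / V) * (\<integral>\<^sup>+y. indicator B y * ennreal ((\<phi> x - \<phi> y)\<^sup>2) \<partial>lborel)"
    using V by (simp add: mult.assoc[symmetric] ennreal_mult[symmetric] power2_eq_square)
  finally show ?thesis unfolding m_def .
qed

text \<open>Each boundary point x is compared with the average over one of finitely many balls at
  depth about \<delta>. The deviation is integrated along the segments from x in the directions
  \<zeta> - e with |\<zeta>| \<le> c, and \<open>cone_kernel_estimate\<close> bounds the total over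
  x by the Dirichlet energy with a constant independent of \<delta>. The length of the segments
  contributes the factor \<delta> that is made small against \<epsilon>.\<close>

lemma local_boundary_compactness:
  fixes \<Omega> :: "'a::euclidean_space set"
  assumes dim: "DIM('a) \<ge> 2" and ch: "boundary_chart \<Omega> p e r L \<gamma>" and op: "open \<Omega>"
    and fin: "finite_measure (surface_measure \<Omega>)" and \<epsilon>: "\<epsilon> > 0"
  shows "\<exists>M\<ge>0. \<exists>F. finite F \<and> (\<forall>B\<in>F. compact B \<and> B \<subseteq> \<Omega>) \<and>
    (\<forall>\<phi> D\<phi>. C1_grad \<phi> D\<phi> \<longrightarrow>
      (\<integral>\<^sup>+x. indicator (cball p (r/2)) x * ennreal ((\<phi> x)\<^sup>2) \<partial>surface_measure \<Omega>)
       \<le> ennreal \<epsilon> * (\<integral>\<^sup>+y. indicator \<Omega> y * ennreal ((norm (D\<phi> y))\<^sup>2) \<partial>lborel)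
         + ennreal (M * (\<Sum>B\<in>F. (LINT y|lborel. indicator B y * \<phi> y)\<^sup>2)))"
proof -
  let ?n = "DIM('a)"
  have L: "L \<ge> 0" and e: "norm e = 1" and r: "r > 0"
    using ch lipschitz_on_nonneg by (auto simp: boundary_chart_def)
  \<comment> \<open>The surface measure lives on the frontier only; its image on the whole space has
    the Borel sets as sigma-algebra, as \<open>cone_kernel_estimate\<close> requires.\<close>
  define \<nu> where "\<nu> = distr (surface_measure \<Omega>) borel (\<lambda>x. x)"
  have s\<nu>[measurable_cong, simp]: "sets \<nu> = sets borel" by (simp add: \<nu>_def)
  interpret F: finite_measure "surface_measure \<Omega>" by fact
  interpret \<nu>: finite_measure \<nu> unfolding \<nu>_def by (rule F.finite_measure_distr[OF measurable_ident_surface])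
  define S where "S = frontier \<Omega> \<inter> cball p (r/2)"
  have Sc: "compact S" unfolding S_def by (intro closed_Int_compact) auto
  have [measurable]: "S \<in> sets borel" "\<Omega> \<in> sets borel" using Sc op by (auto intro: borel_compact)
  obtain K where K: "K \<ge> 0" "\<And>z \<rho>. \<rho> > 0 \<Longrightarrow> emeasure (surface_measure \<Omega>) (S \<inter> cball z \<rho>) \<le> ennreal (K * \<rho> ^ (?n - 1))"
    using emeasure_surface_chart_ball_le[OF dim ch op] unfolding S_def by blast
  have K\<nu>: "emeasure \<nu> (S \<inter> cball z \<rho>) \<le> ennreal (K * \<rho> ^ (?n - 1))" if "\<rho> > 0" for z \<rho>
  proof -
    have "S \<inter> cball z \<rho> \<inter> frontier \<Omega> = S \<inter> cball z \<rho>" by (auto simp: S_def)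
    then have "emeasure \<nu> (S \<inter> cball z \<rho>) = emeasure (surface_measure \<Omega>) (S \<inter> cball z \<rho>)"
      unfolding \<nu>_def by (subst emeasure_distr[OF measurable_ident_surface]) auto
    then show ?thesis using K(2)[OF that] by simp
  qed
  define c where "c = 1 / (2 * (1 + L))"
  have c: "c > 0" "c * (1 + L) \<le> 1/2" "c \<le> 1" using L by (auto simp: c_def field_simps)
  define \<omega> where "\<omega> = unit_ball_vol (real ?n)"
  have \<omega>: "\<omega> > 0" by (simp add: \<omega>_def)
  define A where "A = 3 * K * c ^ (?n - 1)"
  have A: "A \<ge> 0" using K c by (simp add: A_def)
  \<comment> \<open>In 2/V * \<delta>^n * 4\<delta> * A all powers of \<delta> but one cancel
    against V = \<omega> (c\<delta>/2)^n; \<open>A'\<close> is the factor left in front of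
    \<delta>.\<close>
  define A' where "A' = 8 * (2 / c) ^ ?n / \<omega> * A"
  have A': "A' \<ge> 0" using A \<omega> c by (simp add: A'_def)
  \<comment> \<open>The bound r/8 keeps the cones inside the chart, and \<epsilon>/(1 + A') yields
    A' \<delta> \<le> \<epsilon>, also when A' = 0.\<close>
  define \<delta> where "\<delta> = min (r / 8) (\<epsilon> / (1 + A'))"
  have \<delta>: "\<delta> > 0" "2 * \<delta> < r / 2" using r \<epsilon> A' by (auto simp: \<delta>_def)
  have "A' * \<delta> \<le> A' * (\<epsilon> / (1 + A'))" using A' by (intro mult_left_mono) (auto simp: \<delta>_def)
  also have "\<dots> \<le> \<epsilon>" using A' \<epsilon> by (simp add: field_simps)
  finally have \<delta>\<epsilon>: "A' * \<delta> \<le> \<epsilon>" .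
  define V where "V = \<omega> * (c * \<delta> / 2) ^ ?n"
  have V: "V > 0" using \<omega> c \<delta> by (simp add: V_def)
  have cone: "y \<in> \<Omega> \<and> t / 2 \<le> \<gamma> (y - (y \<bullet> e) *\<^sub>R e) - y \<bullet> e \<and> \<gamma> (y - (y \<bullet> e) *\<^sub>R e) - y \<bullet> e \<le> 2 * t"
    if "x \<in> S" "0 < t" "t \<le> \<delta>" "norm (y - x + t *\<^sub>R e) \<le> c * t" for x t y
    using cone_in_chart[OF ch op _ that(2) _ c(1,2) that(4)] that \<delta> by (auto simp: S_def)
  \<comment> \<open>A finite net of mesh c\<delta>/2: if x is that close to z, then the ball
    \<open>B z\<close> of radius c\<delta>/2 lies in the ball of radius c\<delta> around x -
    \<delta> e, so finitely many averages serve all of \<open>S\<close>.\<close>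
  have "S \<subseteq> (\<Union>z\<in>S. ball z (c * \<delta> / 2))" using c \<delta> by auto
  then obtain Z where Z: "Z \<subseteq> S" "finite Z" "S \<subseteq> (\<Union>z\<in>Z. ball z (c * \<delta> / 2))"
    by (rule compactE_image[OF Sc open_ball])
  define B where "B z = cball (z - \<delta> *\<^sub>R e) (c * \<delta> / 2)" for z
  have Bc: "compact (B z)" for z by (simp add: B_def)
  have BO: "B z \<subseteq> \<Omega>" if "z \<in> S" for z
  proof
    fix y assume "y \<in> B z"
    then have "norm (y - z + \<delta> *\<^sub>R e) \<le> c * \<delta> / 2"
      by (simp add: B_def dist_norm norm_minus_commute algebra_simps)
    also have "\<dots> \<le> c * \<delta>" using c \<delta> by simp
    finally show "y \<in> \<Omega>" using cone[OF that \<delta>(1)] by auto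
  qed
  have BV: "emeasure lborel (B z) = ennreal V" for z
    unfolding B_def V_def \<omega>_def using c \<delta> by (intro emeasure_cball) simp
  define \<mu>S where "\<mu>S = measure \<nu> S"
  define M where "M = 2 / V\<^sup>2 * \<mu>S"
  have main: "(\<integral>\<^sup>+x. indicator (cball p (r/2)) x * ennreal ((\<phi> x)\<^sup>2) \<partial>surface_measure \<Omega>)
       \<le> ennreal \<epsilon> * (\<integral>\<^sup>+y. indicator \<Omega> y * ennreal ((norm (D\<phi> y))\<^sup>2) \<partial>lborel)
         + ennreal (M * (\<Sum>C\<in>B ` Z. (LINT y|lborel. indicator C y * \<phi> y)\<^sup>2))"
    if C1: "C1_grad \<phi> D\<phi>" for \<phi> D\<phi>
  proof -
    note [measurable] = C1_grad_continuous(3,4)[OF C1]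
    define Q where "Q = (\<Sum>C\<in>B ` Z. (LINT y|lborel. indicator C y * \<phi> y)\<^sup>2)"
    define f where "f y = ennreal ((norm (D\<phi> y))\<^sup>2)" for y
    have [measurable]: "f \<in> borel_measurable borel" unfolding f_def by measurable
    have [measurable]: "cball z \<rho> \<in> sets (borel :: 'a measure)" for z \<rho> by simp
    have [measurable (raw)]: "(\<lambda>q. f (X q + T q *\<^sub>R (Y q - e))) \<in> borel_measurable N"
      if [measurable]: "X \<in> borel_measurable N" "T \<in> borel_measurable N" "Y \<in> borel_measurable N" for X T Y N
      by measurable
    define T where "T x = (\<integral>\<^sup>+t. indicator {0<..\<delta>} t *
            (\<integral>\<^sup>+\<zeta>. indicator (cball 0 c) \<zeta> * f (x + t *\<^sub>R (\<zeta> - e)) \<partial>lborel) \<partial>lborel)" for x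
    have [measurable]: "T \<in> borel_measurable borel" unfolding T_def by measurable
    have osc: "(\<integral>\<^sup>+y. indicator (B z) y * ennreal ((\<phi> x - \<phi> y)\<^sup>2) \<partial>lborel) \<le> ennreal (\<delta> ^ ?n * (4 * \<delta>)) * T x"
      if "dist x z \<le> c * \<delta> / 2" for x z
    proof -
      have "(\<integral>\<^sup>+y. indicator (B z) y * ennreal ((\<phi> x - \<phi> y)\<^sup>2) \<partial>lborel)
          \<le> (\<integral>\<^sup>+y. indicator (cball (x - \<delta> *\<^sub>R e) (c * \<delta>)) y * ennreal ((\<phi> x - \<phi> y)\<^sup>2) \<partial>lborel)"
      proof (intro nn_integral_mono mult_right_mono)
        fix y
        have "y \<in> cball (x - \<delta> *\<^sub>R e) (c * \<delta>)" if "y \<in> B z"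
        proof -
          have "dist (x - \<delta> *\<^sub>R e) (z - \<delta> *\<^sub>R e) \<le> c * \<delta> / 2" using \<open>dist x z \<le> c * \<delta> / 2\<close> by (simp add: dist_norm)
          moreover have "dist (z - \<delta> *\<^sub>R e) y \<le> c * \<delta> / 2" using that by (simp add: B_def)
          ultimately show ?thesis using dist_triangle[of "x - \<delta> *\<^sub>R e" y "z - \<delta> *\<^sub>R e"] by simp
        qed
        then show "indicator (B z) y \<le> (indicator (cball (x - \<delta> *\<^sub>R e) (c * \<delta>)) y :: ennreal)"
          by (auto simp: indicator_def)
      qed simp
      also have "\<dots> = ennreal (\<delta> ^ ?n) * (\<integral>\<^sup>+\<zeta>. indicator (cball (x - \<delta> *\<^sub>R e) (c * \<delta>)) ((x - \<delta> *\<^sub>R e) + \<delta> *\<^sub>R \<zeta>)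
            * ennreal ((\<phi> x - \<phi> ((x - \<delta> *\<^sub>R e) + \<delta> *\<^sub>R \<zeta>))\<^sup>2) \<partial>lborel)"
      proof (subst nn_integral_lborel_affine[where c=\<delta> and a="x - \<delta> *\<^sub>R e"])
        show "(\<lambda>y. indicator (cball (x - \<delta> *\<^sub>R e) (c * \<delta>)) y * ennreal ((\<phi> x - \<phi> y)\<^sup>2)) \<in> borel_measurable borel"
          by measurable
      qed (use \<delta>(1) in auto)
      also have "\<dots> \<le> ennreal (\<delta> ^ ?n) * (\<integral>\<^sup>+\<zeta>. ennreal (4 * \<delta>) * (\<integral>\<^sup>+t. indicator {0<..\<delta>} t * (indicator (cball 0 c) \<zeta> * f (x + t *\<^sub>R (\<zeta> - e))) \<partial>lborel) \<partial>lborel)"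
      proof (intro mult_left_mono nn_integral_mono)
        fix \<zeta> :: 'a
        have e1: "(x - \<delta> *\<^sub>R e) + \<delta> *\<^sub>R \<zeta> \<in> cball (x - \<delta> *\<^sub>R e) (c * \<delta>) \<longleftrightarrow> \<zeta> \<in> cball 0 c"
        proof -
          have "dist (x - \<delta> *\<^sub>R e) ((x - \<delta> *\<^sub>R e) + \<delta> *\<^sub>R \<zeta>) = \<delta> * norm \<zeta>" using \<delta>(1) by (simp add: dist_norm)
          then show ?thesis unfolding mem_cball mult.commute[of c \<delta>] using \<delta>(1) by simp
        qed
        have e2: "(x - \<delta> *\<^sub>R e) + \<delta> *\<^sub>R \<zeta> = x + \<delta> *\<^sub>R (\<zeta> - e)" by (simp add: algebra_simps)
        show "indicator (cball (x - \<delta> *\<^sub>R e) (c * \<delta>)) ((x - \<delta> *\<^sub>R e) + \<delta> *\<^sub>R \<zeta>)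
            * ennreal ((\<phi> x - \<phi> ((x - \<delta> *\<^sub>R e) + \<delta> *\<^sub>R \<zeta>))\<^sup>2)
          \<le> ennreal (4 * \<delta>) * (\<integral>\<^sup>+t. indicator {0<..\<delta>} t * (indicator (cball 0 c) \<zeta> * f (x + t *\<^sub>R (\<zeta> - e))) \<partial>lborel)"
        proof (cases "\<zeta> \<in> cball 0 c")
          case True
          \<comment> \<open>Since c \<le> 1 and |e| = 1, directions have length at most 2, whence
            the factor 4.\<close>
          have "norm (\<zeta> - e) \<le> 2" using norm_triangle_ineq4[of \<zeta> e] True c e by simp
          then have "(norm (\<zeta> - e))\<^sup>2 \<le> 2\<^sup>2" by (intro power_mono) auto
          then have nw: "\<delta> * (norm (\<zeta> - e))\<^sup>2 \<le> 4 * \<delta>" using \<delta>(1) by simp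
          have "ennreal ((\<phi> x - \<phi> (x + \<delta> *\<^sub>R (\<zeta> - e)))\<^sup>2)
            \<le> ennreal (\<delta> * (norm (\<zeta> - e))\<^sup>2) * (\<integral>\<^sup>+t. indicator {0..\<delta>} t * ennreal ((norm (D\<phi> (x + t *\<^sub>R (\<zeta> - e))))\<^sup>2) \<partial>lborel)"
            using C1_difference_along_segment[OF C1] \<delta>(1) by simp
          also have "\<dots> \<le> ennreal (4 * \<delta>) * (\<integral>\<^sup>+t. indicator {0..\<delta>} t * ennreal ((norm (D\<phi> (x + t *\<^sub>R (\<zeta> - e))))\<^sup>2) \<partial>lborel)"
            by (intro mult_right_mono ennreal_leI nw) simp
          also have "(\<integral>\<^sup>+t. indicator {0..\<delta>} t * ennreal ((norm (D\<phi> (x + t *\<^sub>R (\<zeta> - e))))\<^sup>2) \<partial>lborel)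
              = (\<integral>\<^sup>+t. indicator {0<..\<delta>} t * (indicator (cball 0 c) \<zeta> * f (x + t *\<^sub>R (\<zeta> - e))) \<partial>lborel)"
          \<comment> \<open>The point t = 0 is a null set; it is dropped because the kernel divides
            by t^n.\<close>
          proof (rule nn_integral_cong_AE)
            have "AE t in lborel. t \<noteq> (0::real)" by (rule AE_lborel_singleton)
            then show "AE t in lborel. indicator {0..\<delta>} t * ennreal ((norm (D\<phi> (x + t *\<^sub>R (\<zeta> - e))))\<^sup>2)
                = indicator {0<..\<delta>} t * (indicator (cball 0 c) \<zeta> * f (x + t *\<^sub>R (\<zeta> - e)))"
              by eventually_elim (use True in \<open>auto simp: indicator_def f_def\<close>)
          qed
          finally show ?thesis unfolding e2 using True e1 unfolding e2 by simp
        next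
          case False then show ?thesis using e1 by simp
        qed
      qed simp
      also have "(\<integral>\<^sup>+\<zeta>. ennreal (4 * \<delta>) * (\<integral>\<^sup>+t. indicator {0<..\<delta>} t * (indicator (cball 0 c) \<zeta> * f (x + t *\<^sub>R (\<zeta> - e))) \<partial>lborel) \<partial>lborel)
          = ennreal (4 * \<delta>) * (\<integral>\<^sup>+\<zeta>. (\<integral>\<^sup>+t. indicator {0<..\<delta>} t * (indicator (cball 0 c) \<zeta> * f (x + t *\<^sub>R (\<zeta> - e))) \<partial>lborel) \<partial>lborel)"
        by (rule nn_integral_cmult) measurable
      also have "(\<integral>\<^sup>+\<zeta>. (\<integral>\<^sup>+t. indicator {0<..\<delta>} t * (indicator (cball 0 c) \<zeta> * f (x + t *\<^sub>R (\<zeta> - e))) \<partial>lborel) \<partial>lborel)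
          = (\<integral>\<^sup>+t. (\<integral>\<^sup>+\<zeta>. indicator {0<..\<delta>} t * (indicator (cball 0 c) \<zeta> * f (x + t *\<^sub>R (\<zeta> - e))) \<partial>lborel) \<partial>lborel)"
        by (rule lborel_pair.Fubini') measurable
      also have "\<dots> = T x" unfolding T_def
        by (intro nn_integral_cong nn_integral_cmult) measurable
      finally show ?thesis using \<delta>(1) by (simp add: ennreal_mult mult.assoc)
    qed
    have pt: "indicator S x * ennreal ((\<phi> x)\<^sup>2)
        \<le> ennreal (2 / V\<^sup>2 * Q) * indicator S x + ennreal (2 / V * (\<delta> ^ ?n * (4 * \<delta>))) * (indicator S x * T x)" for x
    proof (cases "x \<in> S")
      case True
      then obtain z where z: "z \<in> Z" "dist x z \<le> c * \<delta> / 2" using Z(3) by (auto simp: dist_commute intro: less_imp_le)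
      have "ennreal ((\<phi> x)\<^sup>2) \<le> ennreal (2 / V\<^sup>2 * (LINT y|lborel. indicator (B z) y * \<phi> y)\<^sup>2)
        + ennreal (2 / V) * (\<integral>\<^sup>+y. indicator (B z) y * ennreal ((\<phi> x - \<phi> y)\<^sup>2) \<partial>lborel)"
        by (rule square_le_average_plus_oscillation[OF Bc C1_grad_continuous(1)[OF C1] V BV])
      also have "\<dots> \<le> ennreal (2 / V\<^sup>2 * Q) + ennreal (2 / V) * (ennreal (\<delta> ^ ?n * (4 * \<delta>)) * T x)"
      proof (intro add_mono mult_left_mono osc z(2) ennreal_leI)
        show "(LINT y|lborel. indicator (B z) y * \<phi> y)\<^sup>2 \<le> Q"
          unfolding Q_def by (rule member_le_sum) (use z Z in auto)
      qed (use V in auto)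
      finally show ?thesis using True V \<delta>(1)
        by (simp add: mult.assoc[symmetric] ennreal_mult[symmetric])
    qed simp
    have kern: "(\<integral>\<^sup>+x. indicator S x * T x \<partial>\<nu>) \<le> ennreal A * (\<integral>\<^sup>+y. indicator \<Omega> y * f y \<partial>lborel)"
      unfolding T_def A_def
      by (rule cone_kernel_estimate[OF s\<nu> \<nu>.finite_measure_axioms _ _ _ K(1) K\<nu> c(1) cone]) measurable
    have fr: "x \<in> space (surface_measure \<Omega>) \<Longrightarrow> indicator (cball p (r/2)) x = (indicator S x :: ennreal)" for x
      by (auto simp: S_def indicator_def)
    have "(\<integral>\<^sup>+x. indicator (cball p (r/2)) x * ennreal ((\<phi> x)\<^sup>2) \<partial>surface_measure \<Omega>)
        = (\<integral>\<^sup>+x. indicator S x * ennreal ((\<phi> x)\<^sup>2) \<partial>surface_measure \<Omega>)"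
      by (rule nn_integral_cong) (simp add: fr)
    also have "\<dots> = (\<integral>\<^sup>+x. indicator S x * ennreal ((\<phi> x)\<^sup>2) \<partial>\<nu>)"
      unfolding \<nu>_def by (rule nn_integral_distr[symmetric, OF measurable_ident_surface]) measurable
    also have "\<dots> \<le> (\<integral>\<^sup>+x. ennreal (2 / V\<^sup>2 * Q) * indicator S x + ennreal (2 / V * (\<delta> ^ ?n * (4 * \<delta>))) * (indicator S x * T x) \<partial>\<nu>)"
      by (rule nn_integral_mono) (rule pt)
    also have "\<dots> = (\<integral>\<^sup>+x. ennreal (2 / V\<^sup>2 * Q) * indicator S x \<partial>\<nu>) + (\<integral>\<^sup>+x. ennreal (2 / V * (\<delta> ^ ?n * (4 * \<delta>))) * (indicator S x * T x) \<partial>\<nu>)"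
      by (rule nn_integral_add) measurable
    also have "(\<integral>\<^sup>+x. ennreal (2 / V\<^sup>2 * Q) * indicator S x \<partial>\<nu>) = ennreal (2 / V\<^sup>2 * Q) * emeasure \<nu> S"
      by (rule nn_integral_cmult_indicator) simp
    also have "(\<integral>\<^sup>+x. ennreal (2 / V * (\<delta> ^ ?n * (4 * \<delta>))) * (indicator S x * T x) \<partial>\<nu>)
       = ennreal (2 / V * (\<delta> ^ ?n * (4 * \<delta>))) * (\<integral>\<^sup>+x. indicator S x * T x \<partial>\<nu>)"
      by (rule nn_integral_cmult) measurable
    also have "ennreal (2 / V\<^sup>2 * Q) * emeasure \<nu> S = ennreal (M * Q)"
    proof -
      have "Q \<ge> 0" unfolding Q_def by (intro sum_nonneg) auto
      then show ?thesis unfolding M_def \<mu>S_def \<nu>.emeasure_eq_measure by (simp add: ennreal_mult[symmetric] mult_ac)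
    qed
    also have "ennreal (M * Q) + ennreal (2 / V * (\<delta> ^ ?n * (4 * \<delta>))) * (\<integral>\<^sup>+x. indicator S x * T x \<partial>\<nu>)
       \<le> ennreal (M * Q) + ennreal (2 / V * (\<delta> ^ ?n * (4 * \<delta>))) * (ennreal A * (\<integral>\<^sup>+y. indicator \<Omega> y * f y \<partial>lborel))"
      by (intro add_left_mono mult_left_mono kern) simp
    also have "ennreal (2 / V * (\<delta> ^ ?n * (4 * \<delta>))) * (ennreal A * (\<integral>\<^sup>+y. indicator \<Omega> y * f y \<partial>lborel))
       = ennreal (2 / V * (\<delta> ^ ?n * (4 * \<delta>)) * A) * (\<integral>\<^sup>+y. indicator \<Omega> y * f y \<partial>lborel)"
      using V \<delta>(1) A by (subst (2) ennreal_mult) (auto simp: mult.assoc)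
    also have "2 / V * (\<delta> ^ ?n * (4 * \<delta>)) * A = A' * \<delta>"
      unfolding V_def A'_def using \<omega> c \<delta>(1) by (simp add: power_divide power_mult_distrib mult_ac)
    also have "ennreal (M * Q) + ennreal (A' * \<delta>) * (\<integral>\<^sup>+y. indicator \<Omega> y * f y \<partial>lborel)
       \<le> ennreal (M * Q) + ennreal \<epsilon> * (\<integral>\<^sup>+y. indicator \<Omega> y * f y \<partial>lborel)"
      by (intro add_left_mono mult_right_mono ennreal_leI \<delta>\<epsilon>) simp
    finally show ?thesis unfolding Q_def f_def by (simp only: add.commute)
  qed
  show ?thesis
  proof (intro exI[of _ M] conjI exI[of _ "B ` Z"] allI impI ballI)
    show "M \<ge> 0" unfolding M_def \<mu>S_def by simp
    show "finite (B ` Z)" using Z by simp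
    show "compact C" "C \<subseteq> \<Omega>" if C: "C \<in> B ` Z" for C
    proof -
      from C obtain z where "z \<in> Z" "C = B z" by auto
      then show "compact C" "C \<subseteq> \<Omega>" using Bc BO[of z] Z(1) by auto
    qed
  qed (rule main)
qed

text \<open>Finitely many charts cover the frontier and their estimates are added. The energy term
  then occurs once per chart, so each chart receives only the share \<epsilon>/(1 + number of
  charts), while all the finite families of balls are united.\<close>

lemma boundary_compactness:
  fixes \<Omega> :: "'a::euclidean_space set"
  assumes dim: "DIM('a) \<ge> 2" and bd: "bounded \<Omega>" and lip: "lipschitz_domain \<Omega>" and \<epsilon>: "\<epsilon> > 0"
  shows "\<exists>M\<ge>0. \<exists>F. finite F \<and> (\<forall>B\<in>F. compact B \<and> B \<subseteq> \<Omega>) \<and>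
    (\<forall>\<phi> D\<phi>. C1_grad \<phi> D\<phi> \<longrightarrow>
      (\<integral>\<^sup>+x. ennreal ((\<phi> x)\<^sup>2) \<partial>surface_measure \<Omega>)
       \<le> ennreal \<epsilon> * (\<integral>\<^sup>+y. indicator \<Omega> y * ennreal ((norm (D\<phi> y))\<^sup>2) \<partial>lborel)
         + ennreal (M * (\<Sum>B\<in>F. (LINT y|lborel. indicator B y * \<phi> y)\<^sup>2)))"
proof -
  have op: "open \<Omega>" using lip by (simp add: lipschitz_domain_def)
  have fin: "finite_measure (surface_measure \<Omega>)" by (rule finite_measure_surface[OF dim bd lip])
  from finite_chart_cover[OF bd lip] obtain P e r L \<gamma> where P: "finite P"
    "\<And>p. p \<in> P \<Longrightarrow> boundary_chart \<Omega> p (e p) (r p) (L p) (\<gamma> p)"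
    "frontier \<Omega> \<subseteq> (\<Union>p\<in>P. cball p (r p / 2))" by blast
  define \<epsilon>' where "\<epsilon>' = \<epsilon> / (1 + real (card P))"
  have \<epsilon>': "\<epsilon>' > 0" using \<epsilon> by (simp add: \<epsilon>'_def add_pos_nonneg)
  have P\<epsilon>: "real (card P) * \<epsilon>' \<le> \<epsilon>" using \<epsilon> by (simp add: \<epsilon>'_def field_simps)
  define E where "E D\<phi> = (\<integral>\<^sup>+y. indicator \<Omega> y * ennreal ((norm (D\<phi> y))\<^sup>2) \<partial>lborel)" for D\<phi> :: "'a \<Rightarrow> 'a"
  define Q where "Q F \<phi> = (\<Sum>B\<in>F. (LINT y|lborel. indicator B y * \<phi> y)\<^sup>2)" for F :: "'a set set" and \<phi> :: "'a \<Rightarrow> real"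
  have Q0: "Q F \<phi> \<ge> 0" for F \<phi> unfolding Q_def by (intro sum_nonneg) auto
  have "\<forall>p. \<exists>M F. p \<in> P \<longrightarrow> M \<ge> 0 \<and> finite F \<and> (\<forall>B\<in>F. compact B \<and> B \<subseteq> \<Omega>) \<and>
    (\<forall>\<phi> D\<phi>. C1_grad \<phi> D\<phi> \<longrightarrow>
      (\<integral>\<^sup>+x. indicator (cball p (r p/2)) x * ennreal ((\<phi> x)\<^sup>2) \<partial>surface_measure \<Omega>)
       \<le> ennreal \<epsilon>' * E D\<phi> + ennreal (M * Q F \<phi>))"
    unfolding E_def Q_def using local_boundary_compactness[OF dim P(2) op fin \<epsilon>'] by meson
  from choice[OF this] obtain M where "\<forall>p. \<exists>F. p \<in> P \<longrightarrow> M p \<ge> 0 \<and> finite F \<and> (\<forall>B\<in>F. compact B \<and> B \<subseteq> \<Omega>) \<and>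
    (\<forall>\<phi> D\<phi>. C1_grad \<phi> D\<phi> \<longrightarrow>
      (\<integral>\<^sup>+x. indicator (cball p (r p/2)) x * ennreal ((\<phi> x)\<^sup>2) \<partial>surface_measure \<Omega>)
       \<le> ennreal \<epsilon>' * E D\<phi> + ennreal (M p * Q F \<phi>))" ..
  from choice[OF this] obtain F where *: "\<forall>p. p \<in> P \<longrightarrow> M p \<ge> 0 \<and> finite (F p) \<and> (\<forall>B\<in>F p. compact B \<and> B \<subseteq> \<Omega>) \<and>
    (\<forall>\<phi> D\<phi>. C1_grad \<phi> D\<phi> \<longrightarrow>
      (\<integral>\<^sup>+x. indicator (cball p (r p/2)) x * ennreal ((\<phi> x)\<^sup>2) \<partial>surface_measure \<Omega>)
       \<le> ennreal \<epsilon>' * E D\<phi> + ennreal (M p * Q (F p) \<phi>))" ..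
  have MF: "M p \<ge> 0" "finite (F p)" "\<forall>B\<in>F p. compact B \<and> B \<subseteq> \<Omega>" if "p \<in> P" for p
    using * that by simp_all
  have MFb: "(\<integral>\<^sup>+x. indicator (cball p (r p/2)) x * ennreal ((\<phi> x)\<^sup>2) \<partial>surface_measure \<Omega>)
       \<le> ennreal \<epsilon>' * E D\<phi> + ennreal (M p * Q (F p) \<phi>)" if "p \<in> P" "C1_grad \<phi> D\<phi>" for p \<phi> D\<phi>
    using *[THEN spec, of p] that by simp
  define FF where "FF = (\<Union>p\<in>P. F p)"
  have FF: "finite FF" unfolding FF_def using P MF by auto
  have main: "(\<integral>\<^sup>+x. ennreal ((\<phi> x)\<^sup>2) \<partial>surface_measure \<Omega>) \<le> ennreal \<epsilon> * E D\<phi> + ennreal (sum M P * Q FF \<phi>)"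
    if C1: "C1_grad \<phi> D\<phi>" for \<phi> D\<phi>
  proof -
    have [measurable]: "(\<lambda>x. indicator (cball p (r p/2)) x * ennreal ((\<phi> x)\<^sup>2)) \<in> borel_measurable (surface_measure \<Omega>)" for p
    proof (rule measurable_surface)
      note [measurable] = C1_grad_continuous(3)[OF C1]
      have [measurable]: "cball z \<rho> \<in> sets (borel :: 'a measure)" for z \<rho> by simp
      show "(\<lambda>x. indicator (cball p (r p/2)) x * ennreal ((\<phi> x)\<^sup>2)) \<in> borel_measurable borel" by measurable
    qed
    have "(\<integral>\<^sup>+x. ennreal ((\<phi> x)\<^sup>2) \<partial>surface_measure \<Omega>)
      \<le> (\<integral>\<^sup>+x. (\<Sum>p\<in>P. indicator (cball p (r p/2)) x * ennreal ((\<phi> x)\<^sup>2)) \<partial>surface_measure \<Omega>)"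
    proof (rule nn_integral_mono)
      fix x assume "x \<in> space (surface_measure \<Omega>)"
      then obtain p where p: "p \<in> P" "x \<in> cball p (r p / 2)" using P(3) by auto
      then have "ennreal ((\<phi> x)\<^sup>2) = indicator (cball p (r p/2)) x * ennreal ((\<phi> x)\<^sup>2)" by simp
      also have "\<dots> \<le> (\<Sum>p\<in>P. indicator (cball p (r p/2)) x * ennreal ((\<phi> x)\<^sup>2))"
        by (rule member_le_sum) (use p P in auto)
      finally show "ennreal ((\<phi> x)\<^sup>2) \<le> (\<Sum>p\<in>P. indicator (cball p (r p/2)) x * ennreal ((\<phi> x)\<^sup>2))" .
    qed
    also have "\<dots> = (\<Sum>p\<in>P. \<integral>\<^sup>+x. indicator (cball p (r p/2)) x * ennreal ((\<phi> x)\<^sup>2) \<partial>surface_measure \<Omega>)"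
      by (rule nn_integral_sum) measurable
    also have "\<dots> \<le> (\<Sum>p\<in>P. ennreal \<epsilon>' * E D\<phi> + ennreal (M p * Q FF \<phi>))"
    proof (rule sum_mono)
      fix p assume p: "p \<in> P"
      have "Q (F p) \<phi> \<le> Q FF \<phi>" unfolding Q_def by (rule sum_mono2[OF FF]) (use p in \<open>auto simp: FF_def\<close>)
      then have "ennreal (M p * Q (F p) \<phi>) \<le> ennreal (M p * Q FF \<phi>)"
        using MF(1)[OF p] by (intro ennreal_leI mult_left_mono)
      then show "(\<integral>\<^sup>+x. indicator (cball p (r p/2)) x * ennreal ((\<phi> x)\<^sup>2) \<partial>surface_measure \<Omega>)
          \<le> ennreal \<epsilon>' * E D\<phi> + ennreal (M p * Q FF \<phi>)"
        using order_trans[OF MFb[OF p C1] add_left_mono] by blast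
    qed
    also have "\<dots> = (\<Sum>p\<in>P. ennreal \<epsilon>' * E D\<phi>) + (\<Sum>p\<in>P. ennreal (M p * Q FF \<phi>))" by (rule sum.distrib)
    also have "(\<Sum>p\<in>P. ennreal (M p * Q FF \<phi>)) = ennreal (sum M P * Q FF \<phi>)"
      using MF(1) Q0 by (subst sum_ennreal) (auto simp: sum_distrib_right)
    also have "(\<Sum>p\<in>P. ennreal \<epsilon>' * E D\<phi>) + ennreal (sum M P * Q FF \<phi>) \<le> ennreal \<epsilon> * E D\<phi> + ennreal (sum M P * Q FF \<phi>)"
    proof (rule add_right_mono)
      have "(\<Sum>p\<in>P. ennreal \<epsilon>' * E D\<phi>) = ennreal (real (card P) * \<epsilon>') * E D\<phi>"
      using \<epsilon>' by (simp add: ennreal_mult ennreal_of_nat_eq_real_of_nat mult.assoc)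
      also have "\<dots> \<le> ennreal \<epsilon> * E D\<phi>" by (intro mult_right_mono ennreal_leI P\<epsilon>) simp
      finally show "(\<Sum>p\<in>P. ennreal \<epsilon>' * E D\<phi>) \<le> ennreal \<epsilon> * E D\<phi>" .
    qed
    finally show ?thesis .
  qed
  show ?thesis
  proof (intro exI[of _ "sum M P"] conjI exI[of _ FF] allI impI)
    show "sum M P \<ge> 0" using MF(1) by (rule sum_nonneg)
    show "finite FF" by (rule FF)
    show "\<forall>B\<in>FF. compact B \<and> B \<subseteq> \<Omega>" unfolding FF_def using MF(3) by blast
  qed (use main in \<open>simp add: E_def Q_def\<close>)
qed

section \<open>Minimisers of Rayleigh quotients\<close>

definition sq_integrable :: "'a measure \<Rightarrow> ('a \<Rightarrow> 'b::euclidean_space) \<Rightarrow> bool" where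
  "sq_integrable M f \<longleftrightarrow> f \<in> borel_measurable M \<and> integrable M (\<lambda>x. (norm (f x))\<^sup>2)"

text \<open>Defined on functions rather than on classes modulo null sets, so \<open>L2_sq\<close> is
  only a seminorm. Euclidean values cover scalar boundary values and the pairs (k U, grad U)
  alike.\<close>

definition L2_inner :: "'a measure \<Rightarrow> ('a \<Rightarrow> 'b::euclidean_space) \<Rightarrow> ('a \<Rightarrow> 'b) \<Rightarrow> real" where
  "L2_inner M f g = (LINT x|M. f x \<bullet> g x)"

abbreviation L2_sq :: "'a measure \<Rightarrow> ('a \<Rightarrow> 'b::euclidean_space) \<Rightarrow> real" where
  "L2_sq M f \<equiv> L2_inner M f f"

lemma integrable_inner_sq:
  assumes "sq_integrable M f" "sq_integrable M g"
  shows "integrable M (\<lambda>x. f x \<bullet> g x)"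
proof (rule Bochner_Integration.integrable_bound)
  show "integrable M (\<lambda>x. (norm (f x))\<^sup>2 + (norm (g x))\<^sup>2)"
    using assms by (auto simp: sq_integrable_def)
  show "(\<lambda>x. f x \<bullet> g x) \<in> borel_measurable M"
    using assms by (auto simp: sq_integrable_def intro: borel_measurable_inner)
  show "AE x in M. norm (f x \<bullet> g x) \<le> norm ((norm (f x))\<^sup>2 + (norm (g x))\<^sup>2)"
  proof (rule AE_I2)
    fix x
    have "\<bar>f x \<bullet> g x\<bar> \<le> norm (f x) * norm (g x)" by (rule Cauchy_Schwarz_ineq2)
    also have "2 * (norm (f x) * norm (g x)) \<le> (norm (f x))\<^sup>2 + (norm (g x))\<^sup>2"
      using sum_squares_bound[of "norm (f x)" "norm (g x)"] by simp
    finally show "norm (f x \<bullet> g x) \<le> norm ((norm (f x))\<^sup>2 + (norm (g x))\<^sup>2)" by simp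
  qed
qed

lemma sq_integrable_scaleR:
  assumes "sq_integrable M f" shows "sq_integrable M (\<lambda>x. c *\<^sub>R f x)"
  using assms by (auto simp: sq_integrable_def power_mult_distrib)

lemma sq_integrable_add:
  assumes f: "sq_integrable M f" and g: "sq_integrable M g"
  shows "sq_integrable M (\<lambda>x. f x + g x)"
proof -
  have "integrable M (\<lambda>x. (norm (f x))\<^sup>2 + 2 * (f x \<bullet> g x) + (norm (g x))\<^sup>2)"
    using f g integrable_inner_sq[OF f g] by (auto simp: sq_integrable_def)
  moreover have "(norm (f x + g x))\<^sup>2 = (norm (f x))\<^sup>2 + 2 * (f x \<bullet> g x) + (norm (g x))\<^sup>2" for x
    by (simp add: power2_norm_eq_inner inner_add_left inner_add_right inner_commute)
  ultimately show ?thesis using f g by (auto simp: sq_integrable_def)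
qed

lemma sq_integrable_diff:
  assumes f: "sq_integrable M f" and g: "sq_integrable M g"
  shows "sq_integrable M (\<lambda>x. f x - g x)"
  using sq_integrable_add[OF f sq_integrable_scaleR[OF g, of "-1"]] by simp

lemma L2_inner_commute: "L2_inner M f g = L2_inner M g f"
  by (simp add: L2_inner_def inner_commute)

lemma L2_inner_nonneg: "L2_sq M f \<ge> 0"
  unfolding L2_inner_def by (intro integral_nonneg_AE) simp

lemma L2_inner_add_left:
  assumes "sq_integrable M f" "sq_integrable M g" "sq_integrable M h"
  shows "L2_inner M (\<lambda>x. f x + g x) h = L2_inner M f h + L2_inner M g h"
  using assms by (simp add: L2_inner_def inner_add_left integrable_inner_sq)

lemma L2_inner_diff_left:
  assumes "sq_integrable M f" "sq_integrable M g" "sq_integrable M h"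
  shows "L2_inner M (\<lambda>x. f x - g x) h = L2_inner M f h - L2_inner M g h"
  using assms by (simp add: L2_inner_def inner_diff_left integrable_inner_sq)

lemma L2_inner_scaleR_left: "L2_inner M (\<lambda>x. c *\<^sub>R f x) h = c * L2_inner M f h"
  by (simp add: L2_inner_def)

lemma L2_inner_add_right:
  assumes "sq_integrable M f" "sq_integrable M g" "sq_integrable M h"
  shows "L2_inner M h (\<lambda>x. f x + g x) = L2_inner M h f + L2_inner M h g"
  using L2_inner_add_left[OF assms] by (simp add: L2_inner_commute)

lemma L2_inner_diff_right:
  assumes "sq_integrable M f" "sq_integrable M g" "sq_integrable M h"
  shows "L2_inner M h (\<lambda>x. f x - g x) = L2_inner M h f - L2_inner M h g"
  using L2_inner_diff_left[OF assms] by (simp add: L2_inner_commute)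

lemma L2_inner_scaleR_right: "L2_inner M h (\<lambda>x. c *\<^sub>R f x) = c * L2_inner M h f"
  by (simp add: L2_inner_def)

text \<open>Passage between the nonnegative integrals of the geometric estimates and the real
  quadratic forms of the minimisation.\<close>

lemma nn_integral_sq_eq:
  assumes "sq_integrable M f"
  shows "(\<integral>\<^sup>+x. ennreal ((norm (f x))\<^sup>2) \<partial>M) = ennreal (L2_sq M f)"
  using assms by (subst nn_integral_eq_integral) (auto simp: sq_integrable_def L2_inner_def power2_norm_eq_inner)

lemma L2_inner_add_self:
  assumes f: "sq_integrable M f" and g: "sq_integrable M g"
  shows "L2_sq M (\<lambda>x. f x + t *\<^sub>R g x)
    = L2_sq M f + 2 * t * L2_inner M f g + t\<^sup>2 * L2_sq M g"
proof -
  note tg = sq_integrable_scaleR[OF g, of t]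
  note s = sq_integrable_add[OF f tg]
  show ?thesis
    by (simp add: L2_inner_add_left[OF f tg s] L2_inner_add_right[OF f tg f] L2_inner_add_right[OF f tg tg] L2_inner_add_right[OF f tg g]
        L2_inner_scaleR_left L2_inner_scaleR_right L2_inner_commute[of M g f] power2_eq_square algebra_simps)
qed

text \<open>First-order condition at a minimum: for t = -s \<alpha> with small s > 0 the linear term
  dominates, so \<alpha> \<noteq> 0 would make the quadratic negative. The choice s = 1/(1 +
  |\<beta>|) is small enough.\<close>

lemma nonneg_quadratic_imp:
  fixes \<alpha> \<beta> :: real
  assumes "\<And>t. 0 \<le> 2 * t * \<alpha> + t\<^sup>2 * \<beta>" shows "\<alpha> = 0"
proof (rule ccontr)
  assume "\<alpha> \<noteq> 0"
  define s where "s = 1 / (1 + \<bar>\<beta>\<bar>)"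
  have s: "s > 0" "s * \<beta> \<le> 1" by (auto simp: s_def divide_simps)
  have "0 \<le> 2 * (- s * \<alpha>) * \<alpha> + (- s * \<alpha>)\<^sup>2 * \<beta>" by (rule assms)
  also have "\<dots> = s * \<alpha>\<^sup>2 * (s * \<beta> - 2)" by (simp add: power2_eq_square algebra_simps)
  also have "\<dots> < 0" using s \<open>\<alpha> \<noteq> 0\<close> by (intro mult_pos_neg) auto
  finally show False by simp
qed

lemma L2_Cauchy_Schwarz:
  assumes f: "sq_integrable M f" and g: "sq_integrable M g"
  shows "\<bar>L2_inner M f g\<bar> \<le> sqrt (L2_sq M f) * sqrt (L2_sq M g)"
proof -
  let ?a = "L2_sq M f" and ?b = "L2_inner M f g" and ?c = "L2_sq M g"
  have q: "0 \<le> ?a + 2 * t * ?b + t\<^sup>2 * ?c" for t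
    using L2_inner_nonneg[of M "\<lambda>x. f x + t *\<^sub>R g x"] L2_inner_add_self[OF f g, of t] by simp
  have "?b\<^sup>2 \<le> ?a * ?c"
  proof (cases "?c = 0")
    \<comment> \<open>For a degenerate \<open>g\<close> the quadratic in t is affine and
      nonnegative, so its slope must vanish.\<close>
    case True
    have "?b = 0"
    proof (rule ccontr)
      assume b: "?b \<noteq> 0"
      have "0 \<le> ?a + 2 * (- (?a + 1) / (2 * ?b)) * ?b" using q[of "- (?a + 1) / (2 * ?b)"] unfolding True by simp
      moreover have "2 * (- (?a + 1) / (2 * ?b)) * ?b = - (?a + 1)" using b by simp
      ultimately show False by linarith
    qed
    then show ?thesis using True by simp
  next
    case False
    then have c: "?c > 0" using L2_inner_nonneg[of M g] by simp
    have "0 \<le> ?a + 2 * (- ?b / ?c) * ?b + (- ?b / ?c)\<^sup>2 * ?c" by (rule q)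
    also have "\<dots> = ?a - ?b\<^sup>2 / ?c" using c by (simp add: power2_eq_square)
    finally show ?thesis using c by (simp add: pos_divide_le_eq)
  qed
  then have "sqrt (?b\<^sup>2) \<le> sqrt (?a * ?c)" by (rule real_sqrt_le_mono)
  then show ?thesis by (simp add: real_sqrt_mult)
qed

section \<open>Convergence and completeness in L2\<close>

definition L2_tendsto :: "'a measure \<Rightarrow> (nat \<Rightarrow> 'a \<Rightarrow> 'b::euclidean_space) \<Rightarrow> ('a \<Rightarrow> 'b) \<Rightarrow> bool" where
  "L2_tendsto M f g \<longleftrightarrow> (\<forall>n. sq_integrable M (f n)) \<and> sq_integrable M g \<and>
     (\<lambda>n. L2_sq M (\<lambda>x. f n x - g x)) \<longlonglongrightarrow> 0"

lemma L2_tendsto_const: "sq_integrable M f \<Longrightarrow> L2_tendsto M (\<lambda>_. f) f"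
  by (simp add: L2_tendsto_def L2_inner_def)

lemma L2_tendsto_inner:
  assumes F: "L2_tendsto M F f" and G: "L2_tendsto M G g"
  shows "(\<lambda>n. L2_inner M (F n) (G n)) \<longlonglongrightarrow> L2_inner M f g"
proof -
  let ?N = "\<lambda>f. sqrt (L2_sq M f)"
  let ?u = "\<lambda>n x. F n x - f x" and ?v = "\<lambda>n x. G n x - g x"
  have s: "sq_integrable M (F n)" "sq_integrable M f" "sq_integrable M (G n)" "sq_integrable M g" for n
    using F G by (auto simp: L2_tendsto_def)
  have su: "sq_integrable M (?u n)" "sq_integrable M (?v n)" for n using s by (auto intro: sq_integrable_diff)
  have "(\<lambda>n. L2_inner M (F n) (G n) - L2_inner M f g) \<longlonglongrightarrow> 0"
  proof (rule Lim_null_comparison)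
    show "\<forall>\<^sub>F n in sequentially. norm (L2_inner M (F n) (G n) - L2_inner M f g)
       \<le> ?N (?u n) * ?N (?v n) + ?N (?u n) * ?N g + ?N f * ?N (?v n)"
    proof (rule always_eventually, rule allI)
      fix n
      have "L2_inner M (F n) (G n) - L2_inner M f g
         = L2_inner M (?u n) (?v n) + L2_inner M (?u n) g + L2_inner M f (?v n)"
        by (simp add: L2_inner_diff_left[OF s(1,2) su(2)] L2_inner_diff_right[OF s(3,4) s(1)]
            L2_inner_diff_right[OF s(3,4) s(2)] L2_inner_diff_left[OF s(1,2,4)])
      then show "norm (L2_inner M (F n) (G n) - L2_inner M f g)
         \<le> ?N (?u n) * ?N (?v n) + ?N (?u n) * ?N g + ?N f * ?N (?v n)"
        using L2_Cauchy_Schwarz[OF su(1,2), of n n] L2_Cauchy_Schwarz[OF su(1) s(4), of n] L2_Cauchy_Schwarz[OF s(2) su(2), of n]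
        by simp
    qed
    have "(\<lambda>n. ?N (?u n)) \<longlonglongrightarrow> sqrt 0" by (rule tendsto_real_sqrt) (use F in \<open>simp add: L2_tendsto_def\<close>)
    moreover have "(\<lambda>n. ?N (?v n)) \<longlonglongrightarrow> sqrt 0" by (rule tendsto_real_sqrt) (use G in \<open>simp add: L2_tendsto_def\<close>)
    ultimately have "(\<lambda>n. ?N (?u n) * ?N (?v n) + ?N (?u n) * ?N g + ?N f * ?N (?v n))
        \<longlonglongrightarrow> sqrt 0 * sqrt 0 + sqrt 0 * ?N g + ?N f * sqrt 0"
      by (intro tendsto_add tendsto_mult tendsto_const)
    then show "(\<lambda>n. ?N (?u n) * ?N (?v n) + ?N (?u n) * ?N g + ?N f * ?N (?v n)) \<longlonglongrightarrow> 0" by simp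
  qed
  then show ?thesis by (simp add: LIM_zero_iff)
qed

text \<open>Along a subsequence whose consecutive differences have squared norm at most \<open>4^(-n)\<close> the sum of
  \<open>2^n |f (n+1) - f n|^2\<close> is integrable, so almost everywhere the differences are
  dominated by a geometric series.\<close>
lemma L2_complete:
  fixes f :: "nat \<Rightarrow> 'a \<Rightarrow> 'b::euclidean_space"
  assumes s: "\<And>n. sq_integrable M (f n)"
    and cauchy: "\<And>\<epsilon>. \<epsilon> > 0 \<Longrightarrow> \<exists>N. \<forall>i\<ge>N. \<forall>j\<ge>N. L2_sq M (\<lambda>x. f i x - f j x) < \<epsilon>"
  shows "\<exists>g. L2_tendsto M f g"
proof -
  have [measurable]: "f n \<in> borel_measurable M" for n using s by (auto simp: sq_integrable_def)
  let ?d = "\<lambda>i j. L2_sq M (\<lambda>x. f i x - f j x)"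
  obtain N where N: "\<And>\<epsilon> i j. \<epsilon> > 0 \<Longrightarrow> i \<ge> N \<epsilon> \<Longrightarrow> j \<ge> N \<epsilon> \<Longrightarrow> ?d i j < \<epsilon>"
    using cauchy by metis
  \<comment> \<open>Partial sums of the thresholds give nondecreasing indices that are at least n
    and beyond \<open>N ((1/4)^n)\<close>.\<close>
  define r where "r n = n + (\<Sum>k\<le>n. N ((1/4)^k))" for n
  have rN: "r n \<ge> N ((1/4)^n)" "r n \<ge> n" "r n \<le> r (Suc n)" for n
  proof -
    have "N ((1/4)^n) \<le> (\<Sum>k\<le>n. N ((1/4)^k))" by (rule member_le_sum) auto
    then show "r n \<ge> N ((1/4)^n)" unfolding r_def by (rule trans_le_add2)
  qed (auto simp: r_def)
  have step: "?d (r (Suc n)) (r n) \<le> (1/4)^n" for n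
    by (rule less_imp_le, rule N) (use rN[of n] in auto)
  have dn: "(\<integral>\<^sup>+x. ennreal ((norm (f i x - f j x))\<^sup>2) \<partial>M) = ennreal (?d i j)" for i j
    by (rule nn_integral_sq_eq) (intro sq_integrable_diff s)
  let ?h = "\<lambda>n x. ennreal (2^n * (norm (f (r (Suc n)) x - f (r n) x))\<^sup>2)"
  have "(\<integral>\<^sup>+x. (\<Sum>n. ?h n x) \<partial>M) = (\<Sum>n. \<integral>\<^sup>+x. ?h n x \<partial>M)"
    by (rule nn_integral_suminf) measurable
  also have "\<dots> \<le> (\<Sum>n. ennreal ((1/2)^n))"
  proof (rule suminf_le)
    fix n
    have "(\<integral>\<^sup>+x. ?h n x \<partial>M) = (\<integral>\<^sup>+x. ennreal (2^n) * ennreal ((norm (f (r (Suc n)) x - f (r n) x))\<^sup>2) \<partial>M)"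
      by (intro nn_integral_cong) (simp add: ennreal_mult)
    also have "\<dots> = ennreal (2^n) * ennreal (?d (r (Suc n)) (r n))"
      unfolding dn[symmetric] by (rule nn_integral_cmult) measurable
    also have "\<dots> \<le> ennreal (2^n) * ennreal ((1/4)^n)" by (intro mult_left_mono ennreal_leI step) simp
    also have "\<dots> = ennreal ((1/2)^n)" by (simp add: ennreal_mult[symmetric] power_mult_distrib[symmetric])
    finally show "(\<integral>\<^sup>+x. ?h n x \<partial>M) \<le> ennreal ((1/2)^n)" .
  qed auto
  also have "\<dots> < top" by (subst suminf_ennreal2) (auto intro!: summable_geometric)
  finally have "(\<integral>\<^sup>+x. (\<Sum>n. ?h n x) \<partial>M) \<noteq> \<infinity>" by simp
  then have "AE x in M. (\<Sum>n. ?h n x) \<noteq> \<infinity>" by (intro nn_integral_PInf_AE) measurable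
  then have conv: "AE x in M. convergent (\<lambda>n. f (r n) x)"
  proof eventually_elim
    case (elim x)
    let ?a = "\<lambda>n. 2^n * (norm (f (r (Suc n)) x - f (r n) x))\<^sup>2"
    have "summable ?a" by (rule summable_suminf_not_top) (use elim in auto)
    then have "?a \<longlonglongrightarrow> 0" by (rule summable_LIMSEQ_zero)
    then have "Bseq ?a" by (intro convergent_imp_Bseq convergentI)
    then obtain C where C: "C > 0" "\<And>n. norm (?a n) \<le> C" by (auto simp: Bseq_def)
    have "summable (\<lambda>n. norm (f (r (Suc n)) x - f (r n) x))"
    proof (rule summable_comparison_test)
      show "\<exists>N. \<forall>n\<ge>N. norm (norm (f (r (Suc n)) x - f (r n) x)) \<le> sqrt C * (sqrt (1/2))^n"
      proof (intro exI allI impI)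
        fix n :: nat
        have "(norm (f (r (Suc n)) x - f (r n) x))\<^sup>2 \<le> C * (1/2)^n"
          using C(2)[of n] by (simp add: field_simps power_divide)
        then have "sqrt ((norm (f (r (Suc n)) x - f (r n) x))\<^sup>2) \<le> sqrt (C * (1/2)^n)" by (rule real_sqrt_le_mono)
        then show "norm (norm (f (r (Suc n)) x - f (r n) x)) \<le> sqrt C * (sqrt (1/2))^n"
          by (simp add: real_sqrt_mult real_sqrt_power)
      qed
      show "summable (\<lambda>n. sqrt C * (sqrt (1/2))^n)"
        by (intro summable_mult summable_geometric) (simp add: real_sqrt_lt_1_iff)
    qed
    then have "summable (\<lambda>n. f (r (Suc n)) x - f (r n) x)" by (rule summable_norm_cancel)
    then have "convergent (\<lambda>n. \<Sum>i<n. f (r (Suc i)) x - f (r i) x)" by (simp add: summable_iff_convergent)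
    then have "convergent (\<lambda>n. f (r n) x - f (r 0) x)" 
      unfolding sum_lessThan_telescope[of "\<lambda>i. f (r i) x"] .
    then have "convergent (\<lambda>n. (f (r n) x - f (r 0) x) + f (r 0) x)" by (intro convergent_add convergent_const)
    then show ?case by simp
  qed
  define g where "g x = lim (\<lambda>n. f (r n) x)" for x
  have gm[measurable]: "g \<in> borel_measurable M" unfolding g_def by (rule borel_measurable_lim_metric) measurable
  have glim: "AE x in M. (\<lambda>n. f (r n) x) \<longlonglongrightarrow> g x"
    using conv by eventually_elim (simp add: g_def convergent_LIMSEQ_iff)
  \<comment> \<open>Fatou's lemma turns the pointwise limit along the subsequence into a norm
    estimate for every late index of the full sequence.\<close>
  have fatou: "(\<integral>\<^sup>+x. ennreal ((norm (f n x - g x))\<^sup>2) \<partial>M) \<le> ennreal \<epsilon>" if "\<epsilon> > 0" "n \<ge> N \<epsilon>" for n \<epsilon>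
  proof -
    have "(\<integral>\<^sup>+x. ennreal ((norm (f n x - g x))\<^sup>2) \<partial>M)
        = (\<integral>\<^sup>+x. liminf (\<lambda>k. ennreal ((norm (f n x - f (r k) x))\<^sup>2)) \<partial>M)"
    proof (rule nn_integral_cong_AE)
      show "AE x in M. ennreal ((norm (f n x - g x))\<^sup>2) = liminf (\<lambda>k. ennreal ((norm (f n x - f (r k) x))\<^sup>2))"
        using glim
      proof eventually_elim
        case (elim x)
        then have "(\<lambda>k. ennreal ((norm (f n x - f (r k) x))\<^sup>2)) \<longlonglongrightarrow> ennreal ((norm (f n x - g x))\<^sup>2)"
          by (intro tendsto_ennrealI tendsto_intros)
        then show ?case by (intro lim_imp_Liminf[symmetric] trivial_limit_sequentially)
      qed
    qed
    also have "\<dots> \<le> liminf (\<lambda>k. \<integral>\<^sup>+x. ennreal ((norm (f n x - f (r k) x))\<^sup>2) \<partial>M)"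
      by (rule nn_integral_liminf) measurable
    also have "\<dots> \<le> ennreal \<epsilon>"
    proof -
      have "eventually (\<lambda>k. (\<integral>\<^sup>+x. ennreal ((norm (f n x - f (r k) x))\<^sup>2) \<partial>M) \<le> ennreal \<epsilon>) sequentially"
      proof (rule eventually_sequentiallyI)
        fix k assume "N \<epsilon> \<le> k"
        then have "r k \<ge> N \<epsilon>" using rN(2)[of k] by simp
        then show "(\<integral>\<^sup>+x. ennreal ((norm (f n x - f (r k) x))\<^sup>2) \<partial>M) \<le> ennreal \<epsilon>"
          unfolding dn using N[OF that(1,2)] by (intro ennreal_leI) (simp add: less_imp_le)
      qed
      then have "liminf (\<lambda>k. \<integral>\<^sup>+x. ennreal ((norm (f n x - f (r k) x))\<^sup>2) \<partial>M) \<le> liminf (\<lambda>k. ennreal \<epsilon>)"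
        by (rule Liminf_mono)
      also have "\<dots> = ennreal \<epsilon>" by (simp add: Liminf_const)
      finally show ?thesis .
    qed
    finally show ?thesis .
  qed
  have sqd: "sq_integrable M (\<lambda>x. f (N 1) x - g x)"
    unfolding sq_integrable_def
  proof
    show "integrable M (\<lambda>x. (norm (f (N 1) x - g x))\<^sup>2)"
      by (rule integrableI_bounded) (use fatou[of 1 "N 1"] in \<open>auto intro: order.strict_trans1[of _ "1::ennreal"]\<close>)
  qed measurable
  have sg: "sq_integrable M g" using sq_integrable_diff[OF s[of "N 1"] sqd] by simp
  have "(\<lambda>n. L2_sq M (\<lambda>x. f n x - g x)) \<longlonglongrightarrow> 0"
  proof (rule LIMSEQ_I)
    fix e :: real assume e: "e > 0"
    show "\<exists>no. \<forall>n\<ge>no. norm (L2_sq M (\<lambda>x. f n x - g x) - 0) < e"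
    proof (intro exI[of _ "N (e/2)"] allI impI)
      fix n assume n: "n \<ge> N (e/2)"
      have "ennreal (L2_sq M (\<lambda>x. f n x - g x)) \<le> ennreal (e/2)"
        using fatou[of "e/2" n] n e nn_integral_sq_eq[OF sq_integrable_diff[OF s[of n] sg]] by simp
      then have "L2_sq M (\<lambda>x. f n x - g x) \<le> e/2" using e by simp
      then show "norm (L2_sq M (\<lambda>x. f n x - g x) - 0) < e"
        using e L2_inner_nonneg[of M "\<lambda>x. f n x - g x"] by simp
    qed
  qed
  then show ?thesis unfolding L2_tendsto_def using s sg by blast
qed

lemma L2_parallelogram:
  assumes f: "sq_integrable M f" and g: "sq_integrable M g"
  shows "L2_sq M (\<lambda>x. f x - g x) + L2_sq M (\<lambda>x. f x + g x)
    = 2 * L2_sq M f + 2 * L2_sq M g"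
  using L2_inner_add_self[OF f g, of 1] L2_inner_add_self[OF f g, of "-1"] by simp

text \<open>Normalised minimising sequences converge: compactness makes the \<open>B\<close>-components Cauchy, and the
  parallelogram law transfers this to the \<open>A\<close>-components.\<close>
lemma rayleigh_minimizer:
  fixes C :: "(('a \<Rightarrow> 'b::euclidean_space) \<times> ('c \<Rightarrow> real)) set"
  assumes sA: "\<And>X u. (X, u) \<in> C \<Longrightarrow> sq_integrable A X" and sB: "\<And>X u. (X, u) \<in> C \<Longrightarrow> sq_integrable B u"
    and lin: "\<And>X u Y v t. (X, u) \<in> C \<Longrightarrow> (Y, v) \<in> C \<Longrightarrow> (\<lambda>x. X x + t *\<^sub>R Y x, \<lambda>x. u x + t *\<^sub>R v x) \<in> C"
    and compact: "\<And>X u K. (\<And>n::nat. (X n, u n) \<in> C) \<Longrightarrow> (\<And>n. L2_sq A (X n) \<le> K) \<Longrightarrow>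
       \<exists>r :: nat \<Rightarrow> nat. strict_mono r \<and> (\<forall>\<epsilon>>0. \<exists>N. \<forall>i\<ge>N. \<forall>j\<ge>N.
         L2_sq B (\<lambda>x. u (r i) x - u (r j) x) < \<epsilon>)"
    and nontriv: "(X0, u0) \<in> C" "L2_sq B u0 > 0"
  shows "\<exists>m X u Xs us. (\<forall>n. (Xs n, us n) \<in> C) \<and> L2_tendsto A Xs X \<and> L2_tendsto B us u \<and> L2_sq B u = 1
     \<and> (\<forall>(Y, v)\<in>C. m * L2_sq B v \<le> L2_sq A Y)
     \<and> (\<forall>(Y, v)\<in>C. L2_inner A X Y = m * L2_inner B u v)"
proof -
  let ?qA = "\<lambda>X. L2_sq A X" and ?qB = "\<lambda>u. L2_sq B u"
  define R where "R = {?qA X / ?qB u | X u. (X, u) \<in> C \<and> ?qB u > 0}"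
  define m where "m = Inf R"
  have Rne: "R \<noteq> {}" using nontriv by (auto simp: R_def)
  have Rb: "bdd_below R" by (rule bdd_belowI[of _ 0]) (auto simp: R_def L2_inner_nonneg)
  have low: "m * ?qB u \<le> ?qA X" if "(X, u) \<in> C" for X u
  proof (cases "?qB u = 0")
    case False
    then have pos: "?qB u > 0" using L2_inner_nonneg[of B u] by simp
    then have "m \<le> ?qA X / ?qB u" unfolding m_def using that by (intro cInf_lower[OF _ Rb]) (auto simp: R_def)
    then show ?thesis using pos by (simp add: pos_le_divide_eq)
  qed (simp add: L2_inner_nonneg)
  have m0: "m \<ge> 0" unfolding m_def by (rule cInf_greatest[OF Rne]) (auto simp: R_def L2_inner_nonneg)
  \<comment> \<open>Since X + (c-1) X = c X, the single closure hypothesis \<open>lin\<close> covers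
    scalings as well as sums.\<close>
  have scale: "(\<lambda>x. c *\<^sub>R X x, \<lambda>x. c *\<^sub>R u x) \<in> C" if "(X, u) \<in> C" for X u c
    using lin[OF that that, of "c - 1"] by (simp add: algebra_simps)
  have "\<exists>X u. (X, u) \<in> C \<and> ?qB u = 1 \<and> ?qA X < m + 1 / real (Suc n)" for n
  proof -
    have "Inf R < m + 1 / real (Suc n)" by (simp add: m_def)
    then obtain X u where Xu: "(X, u) \<in> C" "?qB u > 0" "?qA X / ?qB u < m + 1 / real (Suc n)"
      unfolding cInf_less_iff[OF Rne Rb] by (auto simp: R_def)
    let ?c = "1 / sqrt (?qB u)"
    have c2: "?c * ?c = 1 / ?qB u" using Xu(2) by (simp add: real_sqrt_mult_self)
    show ?thesis
    proof (intro exI conjI)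
      show "(\<lambda>x. ?c *\<^sub>R X x, \<lambda>x. ?c *\<^sub>R u x) \<in> C" by (rule scale[OF Xu(1)])
      show "L2_sq B (\<lambda>x. ?c *\<^sub>R u x) = 1"
        unfolding L2_inner_scaleR_left L2_inner_scaleR_right mult.assoc[symmetric] c2 using Xu(2) by simp
      show "L2_sq A (\<lambda>x. ?c *\<^sub>R X x) < m + 1 / real (Suc n)"
        unfolding L2_inner_scaleR_left L2_inner_scaleR_right mult.assoc[symmetric] c2 using Xu(3) by simp
    qed
  qed
  then have "\<exists>p. \<forall>n. p n \<in> C \<and> ?qB (snd (p n)) = 1 \<and> ?qA (fst (p n)) < m + 1 / real (Suc n)"
    by (intro choice allI) (metis fst_conv snd_conv)
  then obtain p where p: "\<And>n. p n \<in> C" "\<And>n. ?qB (snd (p n)) = 1" "\<And>n. ?qA (fst (p n)) < m + 1 / real (Suc n)"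
    by blast
  have pC: "(fst (p n), snd (p n)) \<in> C" for n using p(1) by simp
  have "?qA (fst (p n)) \<le> m + 1" for n
  proof -
    have "1 / real (Suc n) \<le> 1" by simp
    then show ?thesis using p(3)[of n] by linarith
  qed
  from compact[of "\<lambda>n. fst (p n)" "\<lambda>n. snd (p n)", OF pC this] obtain r :: "nat \<Rightarrow> nat" where
    r0: "strict_mono r \<and> (\<forall>\<epsilon>>0. \<exists>N. \<forall>i\<ge>N. \<forall>j\<ge>N.
      L2_sq B (\<lambda>x. snd (p (r i)) x - snd (p (r j)) x) < \<epsilon>)" ..
  have r: "strict_mono r" using r0 ..
  have cB: "\<exists>N. \<forall>i\<ge>N. \<forall>j\<ge>N. L2_sq B (\<lambda>x. snd (p (r i)) x - snd (p (r j)) x) < \<epsilon>"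
    if "\<epsilon> > 0" for \<epsilon>
    using r0[THEN conjunct2, rule_format, OF that] .
  define X where "X n = fst (p (r n))" for n
  define u where "u n = snd (p (r n))" for n
  have C: "(X n, u n) \<in> C" for n using pC by (simp add: X_def u_def)
  have qB1: "?qB (u n) = 1" for n using p(2) by (simp add: u_def)
  have qAle: "?qA (X n) \<le> m + 1 / real (Suc n)" for n
  proof -
    have "1 / real (Suc (r n)) \<le> 1 / real (Suc n)" using seq_suble[OF r, of n] by (simp add: frac_le)
    then show ?thesis using p(3)[of "r n"] by (simp add: X_def)
  qed
  have qAge: "m \<le> ?qA (X n)" for n using low[OF C, of n] qB1 by simp
  have sX: "sq_integrable A (X n)" and su: "sq_integrable B (u n)" for n using sA sB C by blast+
  have cX: "\<exists>N. \<forall>i\<ge>N. \<forall>j\<ge>N. L2_sq A (\<lambda>x. X i x - X j x) < \<epsilon>" if \<epsilon>: "\<epsilon> > 0" for \<epsilon>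
  proof -
    have "\<epsilon> / (2 * (m + 1)) > 0" using \<epsilon> m0 by simp
    from cB[OF this] obtain N1 where N1: "\<And>i j. i \<ge> N1 \<Longrightarrow> j \<ge> N1 \<Longrightarrow> L2_sq B (\<lambda>x. u i x - u j x) < \<epsilon> / (2 * (m + 1))"
      unfolding u_def by blast
    obtain N2 :: nat where N2: "8 / \<epsilon> < real N2" using reals_Archimedean2 by blast
    have small: "2 / real (Suc i) \<le> \<epsilon> / 4" if "i \<ge> N2" for i
    proof -
      have "8 / \<epsilon> \<le> real (Suc i)" using N2 that by simp
      then have "8 \<le> real (Suc i) * \<epsilon>" using \<epsilon> by (simp add: pos_divide_le_eq)
      then show ?thesis by (simp add: field_simps)
    qed
    show ?thesis
    proof (intro exI[of _ "max N1 N2"] allI impI)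
      fix i j assume i: "max N1 N2 \<le> i" and j: "max N1 N2 \<le> j"
      \<comment> \<open>The sum of two normalised elements is admissible, so its
        \<open>A\<close>-square is at least m (4 - \<open>?b\<close>). Subtracting this in the
        parallelogram law leaves at most 2/(i+1) + 2/(j+1) + m \<open>?b\<close>: near-minimality
        and closeness in \<open>B\<close> force closeness in \<open>A\<close>.\<close>
      let ?b = "L2_sq B (\<lambda>x. u i x - u j x)"
      have "(\<lambda>x. X i x + X j x, \<lambda>x. u i x + u j x) \<in> C" using lin[OF C[of i] C[of j], of 1] by simp
      from low[OF this] have "m * L2_sq B (\<lambda>x. u i x + u j x) \<le> L2_sq A (\<lambda>x. X i x + X j x)" .
      moreover have "L2_sq B (\<lambda>x. u i x + u j x) = 4 - ?b"
        using L2_parallelogram[OF su su, of i j] qB1 by simp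
      ultimately have "m * (4 - ?b) \<le> L2_sq A (\<lambda>x. X i x + X j x)" by simp
      moreover note L2_parallelogram[OF sX sX, of i j] qAle[of i] qAle[of j] small[of i] small[of j]
      moreover have "2 / real (Suc i) = 2 * (1 / real (Suc i))" "2 / real (Suc j) = 2 * (1 / real (Suc j))" by simp_all
      ultimately have "L2_sq A (\<lambda>x. X i x - X j x) \<le> \<epsilon> / 4 + \<epsilon> / 4 + m * ?b"
        using i j by (simp add: right_diff_distrib)
      also have "m * ?b \<le> m * (\<epsilon> / (2 * (m + 1)))"
        by (rule mult_left_mono[OF less_imp_le[OF N1] m0]) (use i j in auto)
      also have "m * (\<epsilon> / (2 * (m + 1))) < \<epsilon> / 2" using m0 \<epsilon> by (simp add: field_simps)
      finally show "L2_sq A (\<lambda>x. X i x - X j x) < \<epsilon>" by simp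
    qed
  qed
  obtain X\<^sub>0 where X\<^sub>0: "L2_tendsto A X X\<^sub>0" using L2_complete[OF sX cX] by blast
  obtain u\<^sub>0 where u\<^sub>0: "L2_tendsto B u u\<^sub>0" using L2_complete[OF su cB[folded u_def]] by blast
  have sX\<^sub>0: "sq_integrable A X\<^sub>0" "sq_integrable B u\<^sub>0" using X\<^sub>0 u\<^sub>0 by (auto simp: L2_tendsto_def)
  have "(\<lambda>n. 1) \<longlonglongrightarrow> ?qB u\<^sub>0" using L2_tendsto_inner[OF u\<^sub>0 u\<^sub>0] unfolding qB1 .
  then have n1: "?qB u\<^sub>0 = 1" by (simp add: LIMSEQ_const_iff)
  have "?qA X\<^sub>0 = m"
  proof (rule LIMSEQ_unique[OF L2_tendsto_inner[OF X\<^sub>0 X\<^sub>0]])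
    show "(\<lambda>n. ?qA (X n)) \<longlonglongrightarrow> m"
    proof (rule tendsto_sandwich[of "\<lambda>_. m" _ _ "\<lambda>n. m + 1 / real (Suc n)"])
      have "(\<lambda>n. m + inverse (real (Suc n))) \<longlonglongrightarrow> m + 0" by (intro tendsto_add tendsto_const LIMSEQ_inverse_real_of_nat)
      then show "(\<lambda>n. m + 1 / real (Suc n)) \<longlonglongrightarrow> m" by (simp add: inverse_eq_divide)
    qed (use qAle qAge in auto)
  qed
  have EL: "L2_inner A X\<^sub>0 Y = m * L2_inner B u\<^sub>0 v" if Yv: "(Y, v) \<in> C" for Y v
  proof -
    have sY: "sq_integrable A Y" "sq_integrable B v" using sA sB Yv by blast+
    \<comment> \<open>The limit pair may lie outside \<open>C\<close>, so minimality is applied to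
      the approximants perturbed by t (Y, v), and the limit is taken afterwards. The constant terms
      cancel because \<open>?qA X\<^sub>0 = m\<close> and \<open>?qB u\<^sub>0 = 1\<close>.\<close>
    have "0 \<le> 2 * t * (L2_inner A X\<^sub>0 Y - m * L2_inner B u\<^sub>0 v) + t\<^sup>2 * (?qA Y - m * ?qB v)" for t
    proof -
      have "m * (?qB (u n) + 2 * t * L2_inner B (u n) v + t\<^sup>2 * ?qB v) \<le> ?qA (X n) + 2 * t * L2_inner A (X n) Y + t\<^sup>2 * ?qA Y" for n
        using low[OF lin[OF C[of n] Yv, of t]]
        unfolding L2_inner_add_self[OF sX sY(1)] L2_inner_add_self[OF su sY(2)] .
      moreover have "(\<lambda>n. m * (?qB (u n) + 2 * t * L2_inner B (u n) v + t\<^sup>2 * ?qB v))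
          \<longlonglongrightarrow> m * (?qB u\<^sub>0 + 2 * t * L2_inner B u\<^sub>0 v + t\<^sup>2 * ?qB v)"
        by (intro tendsto_intros L2_tendsto_inner u\<^sub>0 L2_tendsto_const sY)
      moreover have "(\<lambda>n. ?qA (X n) + 2 * t * L2_inner A (X n) Y + t\<^sup>2 * ?qA Y)
          \<longlonglongrightarrow> ?qA X\<^sub>0 + 2 * t * L2_inner A X\<^sub>0 Y + t\<^sup>2 * ?qA Y"
        by (intro tendsto_intros L2_tendsto_inner X\<^sub>0 L2_tendsto_const sY)
      ultimately have "m * (?qB u\<^sub>0 + 2 * t * L2_inner B u\<^sub>0 v + t\<^sup>2 * ?qB v) \<le> ?qA X\<^sub>0 + 2 * t * L2_inner A X\<^sub>0 Y + t\<^sup>2 * ?qA Y"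
        by (intro LIMSEQ_le[of _ _ "\<lambda>n. ?qA (X n) + 2 * t * L2_inner A (X n) Y + t\<^sup>2 * ?qA Y"]) auto
      then show ?thesis using n1 \<open>?qA X\<^sub>0 = m\<close> by (simp add: algebra_simps)
    qed
    then have "L2_inner A X\<^sub>0 Y - m * L2_inner B u\<^sub>0 v = 0" by (rule nonneg_quadratic_imp)
    then show ?thesis by simp
  qed
  show ?thesis
    by (rule exI[of _ m], rule exI[of _ X\<^sub>0], rule exI[of _ u\<^sub>0], rule exI[of _ X], rule exI[of _ u])
      (use C X\<^sub>0 u\<^sub>0 n1 low EL in auto)
qed

section \<open>Weak gradients and traces\<close>

lemma C1_grad_zero_outside:
  assumes C1: "C1_grad g Dg" and "closed C" and zero: "\<And>x. x \<notin> C \<Longrightarrow> g x = 0" and x: "x \<notin> C"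
  shows "Dg x = 0"
proof -
  have "((\<lambda>_. 0::real) has_derivative (\<lambda>h. Dg x \<bullet> h)) (at x)"
  proof (rule has_derivative_transform_within_open[where s="- C"])
    show "(g has_derivative (\<lambda>h. Dg x \<bullet> h)) (at x)" using C1 by (simp add: C1_grad_def)
  qed (use assms in auto)
  moreover have "((\<lambda>_. 0::real) has_derivative (\<lambda>h. 0)) (at x)" by simp
  ultimately have "(\<lambda>h. Dg x \<bullet> h) = (\<lambda>h. 0)" by (rule has_derivative_unique)
  then have "Dg x \<bullet> Dg x = 0" by meson
  then show ?thesis by simp
qed

lemma integrable_continuous_compact_support:
  fixes h :: "'a::euclidean_space \<Rightarrow> 'b::euclidean_space"
  assumes C: "compact C" and h: "continuous_on UNIV h" and zero: "\<And>x. x \<notin> C \<Longrightarrow> h x = 0"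
  shows "integrable lborel h"
proof -
  have "(\<lambda>y. indicator C y *\<^sub>R h y) = h" using zero by (auto simp: fun_eq_iff indicator_def)
  then show ?thesis using integrable_continuous_on_compact[OF C h] by simp
qed

lemma lborel_integral_translation:
  fixes f :: "'a::euclidean_space \<Rightarrow> real"
  assumes "f \<in> borel_measurable borel"
  shows "(LINT x|lborel. f (x + a)) = (LINT x|lborel. f x)"
proof -
  have "(LINT x|lborel. f x) = (LINT x|distr lborel borel ((+) a). f x)" by (simp add: lborel_distr_plus)
  also have "\<dots> = (LINT x|lborel. f (a + x))" by (rule integral_distr) (use assms in auto)
  finally show ?thesis by (simp add: add.commute)
qed

text \<open>Difference quotients of a compactly supported function integrate to zero by translation
  invariance, and they converge to the directional derivative with a common majorant. This is the
  integration by parts behind the weak gradient of a C1 function.\<close>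

lemma integral_C1_derivative_zero:
  fixes g :: "'a::euclidean_space \<Rightarrow> real"
  assumes C1: "C1_grad g Dg" and C: "compact C" and zero: "\<And>x. x \<notin> C \<Longrightarrow> g x = 0" and b: "norm b = 1"
  shows "(LINT x|lborel. Dg x \<bullet> b) = 0"
proof -
  note cont = C1_grad_continuous(1,2)[OF C1]
  have [measurable]: "g \<in> borel_measurable borel" "Dg \<in> borel_measurable borel" using C1_grad_continuous(3,4)[OF C1] by auto
  have Dz: "x \<notin> C \<Longrightarrow> Dg x = 0" for x by (rule C1_grad_zero_outside[OF C1 compact_imp_closed[OF C] zero])
  have "compact (Dg ` C)" by (rule compact_continuous_image[OF continuous_on_subset[OF cont(2)] C]) simp
  then obtain M where M: "M > 0" "\<And>x. x \<in> C \<Longrightarrow> norm (Dg x) \<le> M" using compact_imp_bounded bounded_pos by (metis imageI)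
  then have DM: "norm (Dg x) \<le> M" for x using Dz[of x] by (cases "x \<in> C") auto
  obtain R where R: "R > 0" "\<And>x. x \<in> C \<Longrightarrow> norm x \<le> R" using compact_imp_bounded[OF C] bounded_pos by metis
  have gint: "integrable lborel g" by (rule integrable_continuous_compact_support[OF C cont(1) zero])
  define \<delta> where "\<delta> n = inverse (real (Suc n))" for n
  have \<delta>: "\<delta> n > 0" "\<delta> n \<le> 1" for n by (auto simp: \<delta>_def inverse_le_1_iff)
  define q where "q n x = (g (x + \<delta> n *\<^sub>R b) - g x) / \<delta> n" for n x
  \<comment> \<open>Uniform Lipschitz bound for the domination, obtained from the segment estimate
    with the gradient bounded by \<open>M\<close>.\<close>
  have qb: "\<bar>g (x + \<delta> n *\<^sub>R b) - g x\<bar> \<le> M * \<delta> n" for n x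
  proof -
    have "ennreal ((g x - g (x + \<delta> n *\<^sub>R b))\<^sup>2)
      \<le> ennreal (\<delta> n * (norm b)\<^sup>2) * (\<integral>\<^sup>+t. indicator {0..\<delta> n} t * ennreal ((norm (Dg (x + t *\<^sub>R b)))\<^sup>2) \<partial>lborel)"
      by (rule C1_difference_along_segment[OF C1]) (use \<delta>(1)[of n] in simp)
    also have "\<dots> \<le> ennreal (\<delta> n * (norm b)\<^sup>2) * (\<integral>\<^sup>+t. ennreal (M\<^sup>2) * indicator {0..\<delta> n} t \<partial>lborel)"
      by (intro mult_left_mono nn_integral_mono)
        (use DM M in \<open>auto simp: indicator_def intro!: ennreal_leI power_mono\<close>)
    also have "\<dots> = ennreal ((M * \<delta> n)\<^sup>2)"
      using \<delta>(1)[of n] b M(1) by (simp add: nn_integral_cmult_indicator ennreal_mult[symmetric] power2_eq_square mult_ac)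
    finally have "(g x - g (x + \<delta> n *\<^sub>R b))\<^sup>2 \<le> (M * \<delta> n)\<^sup>2" by simp
    then have "\<bar>g x - g (x + \<delta> n *\<^sub>R b)\<bar> \<le> \<bar>M * \<delta> n\<bar>" by (simp only: abs_le_square_iff)
    then show ?thesis using M(1) \<delta>(1)[of n] by (simp add: abs_minus_commute)
  qed
  have "(\<lambda>n. LINT x|lborel. q n x) \<longlonglongrightarrow> (LINT x|lborel. Dg x \<bullet> b)"
  \<comment> \<open>Shifts have length at most 1, so enlarging the support radius to R + 1 lets one
    integrable majorant serve every n.\<close>
  proof (rule integral_dominated_convergence[where w="\<lambda>x. M * indicator (cball 0 (R + 1)) x"])
    show "AE x in lborel. (\<lambda>n. q n x) \<longlonglongrightarrow> Dg x \<bullet> b"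
    proof (rule AE_I2)
      fix x
      have "((\<lambda>t. g (x + t *\<^sub>R b)) has_derivative (\<lambda>s. Dg (x + 0 *\<^sub>R b) \<bullet> (s *\<^sub>R b))) (at 0)"
        using C1 unfolding C1_grad_def
        by (intro has_derivative_compose[of "\<lambda>t. x + t *\<^sub>R b" _ _ _ g]) (auto intro!: derivative_eq_intros)
      then have "((\<lambda>t. g (x + t *\<^sub>R b)) has_field_derivative (Dg x \<bullet> b)) (at 0)"
        unfolding has_field_derivative_def by (simp add: mult.commute[of _ "_ \<bullet> _"])
      then have "((\<lambda>h. (g (x + h *\<^sub>R b) - g x) / h) \<longlongrightarrow> Dg x \<bullet> b) (at 0)" by (simp add: DERIV_def)
      moreover have "filterlim \<delta> (at 0) sequentially"
        using LIMSEQ_inverse_real_of_nat \<delta>(1) unfolding filterlim_at \<delta>_def by auto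
      ultimately show "(\<lambda>n. q n x) \<longlonglongrightarrow> Dg x \<bullet> b" unfolding q_def by (rule filterlim_compose)
    qed
    show "AE x in lborel. norm (q n x) \<le> M * indicator (cball 0 (R + 1)) x" for n
    proof (rule AE_I2)
      fix x
      show "norm (q n x) \<le> M * indicator (cball 0 (R + 1)) x"
      proof (cases "x \<in> cball 0 (R + 1)")
        case True then show ?thesis using qb[of x n] \<delta>(1)[of n] by (simp add: q_def pos_divide_le_eq)
      next
        case False
        then have nx: "norm x > R + 1" by simp
        have "norm x \<le> norm (x + \<delta> n *\<^sub>R b) + norm (\<delta> n *\<^sub>R b)" using norm_triangle_ineq4[of "x + \<delta> n *\<^sub>R b" "\<delta> n *\<^sub>R b"] by simp
        then have "norm (x + \<delta> n *\<^sub>R b) > R" using nx \<delta>[of n] b by simp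
        then have "x + \<delta> n *\<^sub>R b \<notin> C" "x \<notin> C" using R(2) nx by force+
        then show ?thesis using zero False by (simp add: q_def)
      qed
    qed
    show "integrable lborel (\<lambda>x::'a. M * indicator (cball 0 (R + 1)) x)"
      by (intro integrable_mult_right integrable_real_indicator) (use emeasure_lborel_cball_finite in simp_all)
  qed (auto simp: q_def)
  moreover have "(LINT x|lborel. q n x) = 0" for n
  proof -
    have "integrable lborel (\<lambda>x. g (x + \<delta> n *\<^sub>R b))"
    proof (rule integrable_continuous_compact_support)
      show "compact ((\<lambda>y. y - \<delta> n *\<^sub>R b) ` C)" by (intro compact_continuous_image continuous_intros C)
      show "continuous_on UNIV (\<lambda>x. g (x + \<delta> n *\<^sub>R b))"
        by (intro continuous_on_compose2[OF cont(1)] continuous_intros) auto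
      fix x assume "x \<notin> (\<lambda>y. y - \<delta> n *\<^sub>R b) ` C"
      then have "x + \<delta> n *\<^sub>R b \<notin> C" by (metis add_diff_cancel_right' image_eqI)
      then show "g (x + \<delta> n *\<^sub>R b) = 0" by (rule zero)
    qed
    then have "(LINT x|lborel. g (x + \<delta> n *\<^sub>R b) - g x) = 0"
      using gint lborel_integral_translation[of g "\<delta> n *\<^sub>R b"] by simp
    then show ?thesis unfolding q_def by simp
  qed
  ultimately show ?thesis by (simp add: LIMSEQ_const_iff)
qed

text \<open>Weak gradients are defined through \<open>lebesgue_on \<Omega>\<close>, while the
  translation argument runs on \<open>lborel\<close>. Completion and restriction leave integrals of
  Borel functions supported in \<Omega> unchanged.\<close>

lemma lebesgue_on_borel_integral:
  fixes h :: "'a::euclidean_space \<Rightarrow> real"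
  assumes "h \<in> borel_measurable borel" "\<Omega> \<in> sets borel" "\<And>x. x \<notin> \<Omega> \<Longrightarrow> h x = 0"
  shows "integrable (lebesgue_on \<Omega>) h \<longleftrightarrow> integrable lborel h"
    and "integral\<^sup>L (lebesgue_on \<Omega>) h = integral\<^sup>L lborel h"
proof -
  have eq: "(\<lambda>x. indicator \<Omega> x *\<^sub>R h x) = h" using assms(3) by (auto simp: fun_eq_iff indicator_def)
  have \<Omega>: "\<Omega> \<inter> space lebesgue \<in> sets lebesgue" using assms(2) by simp
  show "integrable (lebesgue_on \<Omega>) h \<longleftrightarrow> integrable lborel h"
    using integrable_restrict_space[OF \<Omega>, of h] assms(1) unfolding eq
    by (simp add: integrable_completion)
  show "integral\<^sup>L (lebesgue_on \<Omega>) h = integral\<^sup>L lborel h"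
    using integral_restrict_space[OF \<Omega>, of h] assms(1) unfolding eq
    by (simp add: integral_completion)
qed

lemma C1_grad_mult:
  assumes "C1_grad f Df" "C1_grad g Dg"
  shows "C1_grad (\<lambda>x. f x * g x) (\<lambda>x. f x *\<^sub>R Dg x + g x *\<^sub>R Df x)"
  unfolding C1_grad_def
proof (intro conjI allI)
  fix x
  have "((\<lambda>x. f x * g x) has_derivative (\<lambda>h. f x * (Dg x \<bullet> h) + (Df x \<bullet> h) * g x)) (at x)"
    using assms unfolding C1_grad_def by (intro has_derivative_mult) auto
  then show "((\<lambda>x. f x * g x) has_derivative (\<lambda>h. (f x *\<^sub>R Dg x + g x *\<^sub>R Df x) \<bullet> h)) (at x)"
    by (simp add: inner_add_left mult.commute)
  show "continuous_on UNIV (\<lambda>x. f x *\<^sub>R Dg x + g x *\<^sub>R Df x)"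
    by (intro continuous_intros C1_grad_continuous[OF assms(1)] C1_grad_continuous[OF assms(2)])
qed

text \<open>The product with a test function supported in \<Omega> is C1 with compact support, so
  its derivatives integrate to zero; the product rule splits this into the two sides of the defining
  identity.\<close>

lemma weak_gradient_C1:
  fixes \<Omega> :: "'a::euclidean_space set"
  assumes C1: "C1_grad \<phi> D\<phi>" and \<Omega>: "\<Omega> \<in> sets borel"
  shows "weak_gradient \<Omega> \<phi> D\<phi>"
  unfolding weak_gradient_def
proof (intro allI impI ballI)
  fix \<psi> D\<psi> and b :: 'a
  assume "C1_grad \<psi> D\<psi> \<and> compact (closure {x. \<psi> x \<noteq> 0}) \<and> closure {x. \<psi> x \<noteq> 0} \<subseteq> \<Omega>" and b: "b \<in> Basis"
  then have \<psi>: "C1_grad \<psi> D\<psi>" and C0: "compact (closure {x. \<psi> x \<noteq> 0})" and sub0: "closure {x. \<psi> x \<noteq> 0} \<subseteq> \<Omega>" by auto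
  obtain C where C: "compact C" and sub: "C \<subseteq> \<Omega>" and supp: "{x. \<psi> x \<noteq> 0} \<subseteq> C"
    by (rule that[OF C0 sub0 closure_subset])
  have z: "\<psi> x = 0" if "x \<notin> C" for x using supp that by auto
  have Dz: "D\<psi> x = 0" if "x \<notin> C" for x by (rule C1_grad_zero_outside[OF \<psi> compact_imp_closed[OF C] z that])
  note c = C1_grad_continuous[OF C1] and c' = C1_grad_continuous[OF \<psi>]
  let ?h1 = "\<lambda>x. \<phi> x * (D\<psi> x \<bullet> b)" and ?h2 = "\<lambda>x. (D\<phi> x \<bullet> b) * \<psi> x"
  have cont: "continuous_on UNIV ?h1" "continuous_on UNIV ?h2" by (intro continuous_intros c c')+
  have i: "integrable lborel ?h1" "integrable lborel ?h2"
    by (rule integrable_continuous_compact_support[OF C cont(1)], simp add: Dz)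
      (rule integrable_continuous_compact_support[OF C cont(2)], simp add: z)
  have m: "?h1 \<in> borel_measurable borel" "?h2 \<in> borel_measurable borel"
    using cont by (auto intro: borel_measurable_continuous_onI)
  have xC: "x \<notin> C" if "x \<notin> \<Omega>" for x using that sub by auto
  have out: "?h1 x = 0" "?h2 x = 0" if "x \<notin> \<Omega>" for x
    using z[OF xC[OF that]] Dz[OF xC[OF that]] by simp_all
  have "(LINT x|lborel. (\<phi> x *\<^sub>R D\<psi> x + \<psi> x *\<^sub>R D\<phi> x) \<bullet> b) = 0"
    by (rule integral_C1_derivative_zero[OF C1_grad_mult[OF C1 \<psi>] C]) (use z b in auto)
  then have "(LINT x|lborel. ?h1 x + ?h2 x) = 0" by (simp add: inner_add_left mult.commute)
  then have "integral\<^sup>L lborel ?h1 = - integral\<^sup>L lborel ?h2" using i by simp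
  then show "integrable (lebesgue_on \<Omega>) ?h1 \<and> integrable (lebesgue_on \<Omega>) ?h2 \<and>
      integral\<^sup>L (lebesgue_on \<Omega>) ?h1 = - integral\<^sup>L (lebesgue_on \<Omega>) ?h2"
    using lebesgue_on_borel_integral[OF m(1) \<Omega> out(1)] lebesgue_on_borel_integral[OF m(2) \<Omega> out(2)] i by simp
qed

section \<open>Square integrability of continuous functions inside and on the boundary\<close>

lemma finite_measure_lebesgue_on_bounded_open:
  "bounded \<Omega> \<Longrightarrow> open \<Omega> \<Longrightarrow> finite_measure (lebesgue_on \<Omega>)"
  by (intro finite_measure_lebesgue_on lmeasurable_open)

lemma measurable_lebesgue_on:
  fixes f :: "'a::euclidean_space \<Rightarrow> 'b::topological_space"
  assumes "f \<in> borel_measurable borel" shows "f \<in> borel_measurable (lebesgue_on \<Omega>)"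
  by (rule measurable_restrict_space1) (use assms in \<open>simp add: measurable_completion\<close>)

lemma nn_integral_lebesgue_on_borel:
  fixes \<Omega> :: "'a::euclidean_space set"
  assumes "\<Omega> \<in> sets borel"
  shows "(\<integral>\<^sup>+x. f x \<partial>lebesgue_on \<Omega>) = (\<integral>\<^sup>+x. indicator \<Omega> x * f x \<partial>lborel)"
  using assms by (subst nn_integral_restrict_space) (simp_all add: nn_integral_completion mult.commute)

lemma sq_integrable_bounded:
  fixes f :: "'a \<Rightarrow> 'b::euclidean_space"
  assumes "finite_measure M" "f \<in> borel_measurable M" "\<And>x. x \<in> space M \<Longrightarrow> norm (f x) \<le> K"
  shows "sq_integrable M f"
  unfolding sq_integrable_def
proof
  interpret finite_measure M by fact
  show "integrable M (\<lambda>x. (norm (f x))\<^sup>2)"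
  proof (rule integrable_const_bound[where B="K\<^sup>2"])
    show "AE x in M. norm ((norm (f x))\<^sup>2) \<le> K\<^sup>2"
      using assms(3) by (intro AE_I2) (auto intro: power_mono)
  qed (use assms(2) in measurable)
qed fact

lemma continuous_bounded_on_bounded:
  fixes f :: "'a::euclidean_space \<Rightarrow> 'b::euclidean_space"
  assumes "continuous_on UNIV f" "bounded S"
  shows "\<exists>K. \<forall>x\<in>S. norm (f x) \<le> K"
proof -
  have "compact (closure S)" using assms(2) by simp
  then have "compact (f ` closure S)" by (intro compact_continuous_image continuous_on_subset[OF assms(1)]) auto
  then have "bounded (f ` closure S)" by (rule compact_imp_bounded)
  then obtain K where "\<And>y. y \<in> f ` closure S \<Longrightarrow> norm y \<le> K" unfolding bounded_iff by blast
  then show ?thesis using closure_subset[of S] by (intro exI[of _ K]) auto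
qed

lemma sq_integrable_continuous_interior:
  fixes f :: "'a::euclidean_space \<Rightarrow> 'b::euclidean_space"
  assumes "continuous_on UNIV f" "bounded \<Omega>" "open \<Omega>"
  shows "sq_integrable (lebesgue_on \<Omega>) f"
proof -
  obtain K where "\<forall>x\<in>\<Omega>. norm (f x) \<le> K" using continuous_bounded_on_bounded[OF assms(1,2)] ..
  then show ?thesis
    by (intro sq_integrable_bounded[where K=K] finite_measure_lebesgue_on_bounded_open
        measurable_lebesgue_on borel_measurable_continuous_onI assms) auto
qed

lemma sq_integrable_continuous_surface:
  fixes f :: "'a::euclidean_space \<Rightarrow> 'b::euclidean_space"
  assumes "continuous_on UNIV f" "bounded \<Omega>" "finite_measure (surface_measure \<Omega>)"
  shows "sq_integrable (surface_measure \<Omega>) f"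
proof -
  have "bounded (frontier \<Omega>)" by (rule compact_imp_bounded[OF compact_frontier_bounded[OF assms(2)]])
  from continuous_bounded_on_bounded[OF assms(1) this] obtain K where "\<forall>x\<in>frontier \<Omega>. norm (f x) \<le> K" ..
  then show ?thesis
    by (intro sq_integrable_bounded[where K=K] measurable_surface borel_measurable_continuous_onI assms) auto
qed

lemma ennreal_tendsto_0_mono:
  fixes f g :: "nat \<Rightarrow> ennreal"
  assumes "\<And>n. f n \<le> g n" "g \<longlonglongrightarrow> 0" shows "f \<longlonglongrightarrow> 0"
  by (rule tendsto_sandwich[of "\<lambda>_. 0" f _ g]) (use assms in auto)

text \<open>Bounded support amounts to compactness of its closure, the condition in
  \<open>is_trace\<close>, and in this form stability under linear combinations is
  immediate.\<close>

definition C1_test :: "('a::euclidean_space \<Rightarrow> real) \<Rightarrow> ('a \<Rightarrow> 'a) \<Rightarrow> bool" where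
  "C1_test \<phi> D\<phi> \<longleftrightarrow> C1_grad \<phi> D\<phi> \<and> bounded {x. \<phi> x \<noteq> 0}"

text \<open>With \<open>k\<^sup>2 = - \<Lambda>\<close>, the bilinear form \<open>\<nabla>U \<sqdot> \<nabla>V - \<Lambda> U V\<close> becomes the plain
  \<open>L\<^sup>2\<close> inner product of the pairs \<open>(k U, \<nabla>U)\<close>.\<close>
definition energy_pair :: "real \<Rightarrow> ('a \<Rightarrow> real) \<Rightarrow> ('a \<Rightarrow> 'a) \<Rightarrow> 'a::euclidean_space \<Rightarrow> real \<times> 'a" where
  "energy_pair k U G x = (k * U x, G x)"

lemma energy_pair_norm: "(norm (energy_pair k U G x))\<^sup>2 = k\<^sup>2 * (U x)\<^sup>2 + (norm (G x))\<^sup>2"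
  by (simp add: energy_pair_def norm_Pair power_mult_distrib)

lemma C1_grad_add_scaled:
  assumes "C1_grad f Df" "C1_grad g Dg"
  shows "C1_grad (\<lambda>x. f x + t * g x) (\<lambda>x. Df x + t *\<^sub>R Dg x)"
  unfolding C1_grad_def
proof (intro conjI allI)
  fix x
  have "((\<lambda>x. f x + t * g x) has_derivative (\<lambda>h. Df x \<bullet> h + t * (Dg x \<bullet> h))) (at x)"
    using assms unfolding C1_grad_def by (intro has_derivative_add has_derivative_mult_right) auto
  then show "((\<lambda>x. f x + t * g x) has_derivative (\<lambda>h. (Df x + t *\<^sub>R Dg x) \<bullet> h)) (at x)"
    by (simp add: inner_add_left)
  show "continuous_on UNIV (\<lambda>x. Df x + t *\<^sub>R Dg x)"
    by (intro continuous_intros C1_grad_continuous[OF assms(1)] C1_grad_continuous[OF assms(2)])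
qed

lemma C1_test_add_scaled:
  assumes "C1_test f Df" "C1_test g Dg"
  shows "C1_test (\<lambda>x. f x + t * g x) (\<lambda>x. Df x + t *\<^sub>R Dg x)"
proof -
  have "bounded ({x. f x \<noteq> 0} \<union> {x. g x \<noteq> 0})" using assms by (simp add: C1_test_def)
  then have "bounded {x. f x + t * g x \<noteq> 0}" by (rule bounded_subset) auto
  then show ?thesis using assms by (simp add: C1_test_def C1_grad_add_scaled)
qed

lemma energy_pair_continuous:
  assumes "C1_grad \<phi> D\<phi>" shows "continuous_on UNIV (energy_pair k \<phi> D\<phi>)"
  unfolding energy_pair_def by (intro continuous_intros C1_grad_continuous[OF assms])

text \<open>Both sides of the weak gradient identity are inner products of (k U, grad U) with fixed
  square integrable pairs, so the identity passes from C1 functions to their L2 limits.\<close>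

lemma weak_gradient_limit:
  fixes \<Omega> :: "'a::euclidean_space set"
  assumes \<Omega>: "bounded \<Omega>" "open \<Omega>" and k: "k > 0" and C1: "\<And>n. C1_grad (\<phi> n) (D\<phi> n)"
    and lim: "L2_tendsto (lebesgue_on \<Omega>) (\<lambda>n. energy_pair k (\<phi> n) (D\<phi> n)) (energy_pair k U G)"
  shows "weak_gradient \<Omega> U G"
  unfolding weak_gradient_def
proof (intro allI impI ballI)
  fix \<psi> D\<psi> and b :: 'a
  assume \<psi>0: "C1_grad \<psi> D\<psi> \<and> compact (closure {x. \<psi> x \<noteq> 0}) \<and> closure {x. \<psi> x \<noteq> 0} \<subseteq> \<Omega>" and b: "b \<in> Basis"
  then have \<psi>: "C1_grad \<psi> D\<psi>" by simp
  let ?A = "lebesgue_on \<Omega>"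
  \<comment> \<open>The division by k cancels the weight of the first component of
    \<open>energy_pair\<close>.\<close>
  define Y1 :: "'a \<Rightarrow> real \<times> 'a" where "Y1 x = ((D\<psi> x \<bullet> b) / k, 0)" for x
  define Y2 :: "'a \<Rightarrow> real \<times> 'a" where "Y2 x = (0, \<psi> x *\<^sub>R b)" for x
  have "continuous_on UNIV Y1" unfolding Y1_def
    by (intro continuous_intros C1_grad_continuous[OF \<psi>]) (use k in auto)
  then have s1: "sq_integrable ?A Y1" by (rule sq_integrable_continuous_interior[OF _ \<Omega>])
  have "continuous_on UNIV Y2" unfolding Y2_def by (intro continuous_intros C1_grad_continuous[OF \<psi>])
  then have s2: "sq_integrable ?A Y2" by (rule sq_integrable_continuous_interior[OF _ \<Omega>])
  note s = s1 s2
  have ip: "energy_pair k V W x \<bullet> Y1 x = V x * (D\<psi> x \<bullet> b)" "energy_pair k V W x \<bullet> Y2 x = (W x \<bullet> b) * \<psi> x" for V W x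
    using k by (simp_all add: energy_pair_def Y1_def Y2_def)
  have sX: "sq_integrable ?A (energy_pair k U G)" using lim by (simp add: L2_tendsto_def)
  have eq: "L2_inner ?A (energy_pair k (\<phi> n) (D\<phi> n)) Y1 = - L2_inner ?A (energy_pair k (\<phi> n) (D\<phi> n)) Y2" for n
    using weak_gradient_C1[OF C1[of n], of \<Omega>] \<Omega> \<psi>0 b
    unfolding weak_gradient_def L2_inner_def ip by auto
  have "(\<lambda>n. L2_inner ?A (energy_pair k (\<phi> n) (D\<phi> n)) Y1) \<longlonglongrightarrow> L2_inner ?A (energy_pair k U G) Y1"
    by (rule L2_tendsto_inner[OF lim L2_tendsto_const[OF s(1)]])
  moreover have "(\<lambda>n. L2_inner ?A (energy_pair k (\<phi> n) (D\<phi> n)) Y1) \<longlonglongrightarrow> - L2_inner ?A (energy_pair k U G) Y2"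
    unfolding eq by (intro tendsto_minus L2_tendsto_inner[OF lim L2_tendsto_const[OF s(2)]])
  ultimately have "L2_inner ?A (energy_pair k U G) Y1 = - L2_inner ?A (energy_pair k U G) Y2"
    by (rule LIMSEQ_unique)
  then show "integrable ?A (\<lambda>x. U x * (D\<psi> x \<bullet> b)) \<and> integrable ?A (\<lambda>x. (G x \<bullet> b) * \<psi> x) \<and>
      integral\<^sup>L ?A (\<lambda>x. U x * (D\<psi> x \<bullet> b)) = - integral\<^sup>L ?A (\<lambda>x. (G x \<bullet> b) * \<psi> x)"
    using integrable_inner_sq[OF sX s(1)] integrable_inner_sq[OF sX s(2)] unfolding L2_inner_def ip by simp
qed

lemma sq_integrable_energy_pair:
  assumes "k > 0" "sq_integrable M (energy_pair k U G)"
  shows "U \<in> borel_measurable M" "G \<in> borel_measurable M" "integrable M (\<lambda>x. (U x)\<^sup>2)" "integrable M (\<lambda>x. (norm (G x))\<^sup>2)"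
proof -
  have m: "energy_pair k U G \<in> borel_measurable M" and i: "integrable M (\<lambda>x. k\<^sup>2 * (U x)\<^sup>2 + (norm (G x))\<^sup>2)"
    using assms(2) by (auto simp: sq_integrable_def energy_pair_norm)
  have "(\<lambda>x. fst (energy_pair k U G x) / k) \<in> borel_measurable M"
    by (intro borel_measurable_divide borel_measurable_const measurable_compose[OF m] borel_measurable_continuous_onI continuous_intros)
  then show U[measurable]: "U \<in> borel_measurable M" using assms(1) by (simp add: energy_pair_def)
  have "(\<lambda>x. snd (energy_pair k U G x)) \<in> borel_measurable M"
    by (intro measurable_compose[OF m] borel_measurable_continuous_onI continuous_intros)
  then show G[measurable]: "G \<in> borel_measurable M" by (simp add: energy_pair_def)
  have "integrable M (\<lambda>x. k\<^sup>2 * (U x)\<^sup>2)"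
    by (rule Bochner_Integration.integrable_bound[OF i]) auto
  then show "integrable M (\<lambda>x. (U x)\<^sup>2)" using assms(1) by simp
  show "integrable M (\<lambda>x. (norm (G x))\<^sup>2)"
    by (rule Bochner_Integration.integrable_bound[OF i]) auto
qed

text \<open>Turns the abstract limit of the minimisation into an H1 function with trace. Together
  with \<open>H1_trace_L2_tendsto\<close> it identifies the H1 functions having a trace with the
  joint L2 closure of the test functions.\<close>

lemma L2_tendsto_H1_trace:
  fixes \<Omega> :: "'a::euclidean_space set"
  assumes \<Omega>: "bounded \<Omega>" "open \<Omega>" and k: "k > 0" and C1: "\<And>n. C1_test (\<phi> n) (D\<phi> n)"
    and limA: "L2_tendsto (lebesgue_on \<Omega>) (\<lambda>n. energy_pair k (\<phi> n) (D\<phi> n)) (energy_pair k U G)"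
    and limB: "L2_tendsto (surface_measure \<Omega>) \<phi> u"
  shows "H1 \<Omega> U G" "is_trace \<Omega> U G u"
proof -
  let ?A = "lebesgue_on \<Omega>" and ?B = "surface_measure \<Omega>"
  have sX: "sq_integrable ?A (energy_pair k U G)" and sn: "sq_integrable ?A (energy_pair k (\<phi> n) (D\<phi> n))" for n
    using limA by (auto simp: L2_tendsto_def)
  have C1g: "C1_grad (\<phi> n) (D\<phi> n)" for n using C1 by (simp add: C1_test_def)
  show "H1 \<Omega> U G"
    unfolding H1_def using sq_integrable_energy_pair[OF k sX] weak_gradient_limit[OF \<Omega> k C1g limA] by blast
  let ?d = "\<lambda>n x. energy_pair k (\<phi> n) (D\<phi> n) x - energy_pair k U G x"
  \<comment> \<open>Chosen so that a + b \<le> c (k^2 a + b): the product expands to a + b + k^2 a +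
    b/k^2.\<close>
  define c where "c = 1 + 1 / k\<^sup>2"
  have c: "c \<ge> 0" by (simp add: c_def)
  have bound: "(\<integral>\<^sup>+ x. ennreal ((\<phi> n x - U x)\<^sup>2 + (norm (D\<phi> n x - G x))\<^sup>2) \<partial>?A) \<le> ennreal (c * L2_sq ?A (?d n))" for n
  proof -
    have "(\<integral>\<^sup>+ x. ennreal ((\<phi> n x - U x)\<^sup>2 + (norm (D\<phi> n x - G x))\<^sup>2) \<partial>?A) \<le> (\<integral>\<^sup>+ x. ennreal ((norm (c *\<^sub>R ?d n x))\<^sup>2 / c) \<partial>?A)"
    proof (intro nn_integral_mono ennreal_leI)
      fix x
      let ?a = "(\<phi> n x - U x)\<^sup>2" and ?b = "(norm (D\<phi> n x - G x))\<^sup>2"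
      have "?d n x = energy_pair k (\<lambda>x. \<phi> n x - U x) (\<lambda>x. D\<phi> n x - G x) x"
        by (simp add: energy_pair_def algebra_simps)
      then have "(norm (?d n x))\<^sup>2 = k\<^sup>2 * ?a + ?b" by (simp add: energy_pair_norm)
      moreover have "(norm (c *\<^sub>R ?d n x))\<^sup>2 / c = c * (norm (?d n x))\<^sup>2" using c
        by (simp add: power_mult_distrib power2_eq_square)
      moreover have "c * (k\<^sup>2 * ?a + ?b) = ?a + ?b + k\<^sup>2 * ?a + ?b / k\<^sup>2"
        using k by (simp add: c_def field_simps)
      ultimately show "?a + ?b \<le> (norm (c *\<^sub>R ?d n x))\<^sup>2 / c" by simp
    qed
    also have "\<dots> = (\<integral>\<^sup>+ x. ennreal c * ennreal ((norm (?d n x))\<^sup>2) \<partial>?A)"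
      by (intro nn_integral_cong) (use c in \<open>simp add: ennreal_mult[symmetric] power_mult_distrib power2_eq_square\<close>)
    also have "\<dots> = ennreal c * (\<integral>\<^sup>+ x. ennreal ((norm (?d n x))\<^sup>2) \<partial>?A)"
      by (rule nn_integral_cmult) (use sq_integrable_diff[OF sn[of n] sX] in \<open>auto simp: sq_integrable_def\<close>)
    also have "\<dots> = ennreal (c * L2_sq ?A (?d n))"
      using nn_integral_sq_eq[OF sq_integrable_diff[OF sn[of n] sX]] c by (simp add: ennreal_mult L2_inner_nonneg)
    finally show ?thesis .
  qed
  have "(\<lambda>n. c * L2_sq ?A (?d n)) \<longlonglongrightarrow> c * 0"
    by (intro tendsto_mult tendsto_const) (use limA in \<open>simp add: L2_tendsto_def\<close>)
  then have "(\<lambda>n. ennreal (c * L2_sq ?A (?d n))) \<longlonglongrightarrow> ennreal (c * 0)" by (rule tendsto_ennrealI)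
  then have "(\<lambda>n. ennreal (c * L2_sq ?A (?d n))) \<longlonglongrightarrow> 0" by simp
  then have t1: "(\<lambda>n. \<integral>\<^sup>+ x. ennreal ((\<phi> n x - U x)\<^sup>2 + (norm (D\<phi> n x - G x))\<^sup>2) \<partial>?A) \<longlonglongrightarrow> 0"
    by (rule ennreal_tendsto_0_mono[OF bound])
  have su: "sq_integrable ?B u" and s\<phi>: "sq_integrable ?B (\<phi> n)" for n using limB by (auto simp: L2_tendsto_def)
  have "(\<lambda>n. ennreal (L2_sq ?B (\<lambda>x. \<phi> n x - u x))) \<longlonglongrightarrow> ennreal 0"
    by (rule tendsto_ennrealI) (use limB in \<open>simp add: L2_tendsto_def\<close>)
  then have t2: "(\<lambda>n. \<integral>\<^sup>+ x. ennreal ((\<phi> n x - u x)\<^sup>2) \<partial>?B) \<longlonglongrightarrow> 0"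
    using nn_integral_sq_eq[OF sq_integrable_diff[OF s\<phi> su]] by simp
  have "u \<in> borel_measurable ?B" "integrable ?B (\<lambda>x. (u x)\<^sup>2)" using su by (auto simp: sq_integrable_def)
  moreover have "\<forall>n. C1_grad (\<phi> n) (D\<phi> n) \<and> compact (closure {x. \<phi> n x \<noteq> 0})" using C1 by (simp add: C1_test_def)
  ultimately show "is_trace \<Omega> U G u" unfolding is_trace_def using t1 t2 by blast
qed

text \<open>The approximation built into \<open>is_trace\<close>, rewritten for the weighted pair by
  k^2 a + b \<le> (1 + k^2)(a + b). Through it, statements about test functions reach all H1
  functions with trace by continuity of the inner products.\<close>

lemma H1_trace_L2_tendsto:
  fixes \<Omega> :: "'a::euclidean_space set"
  assumes \<Omega>: "bounded \<Omega>" "open \<Omega>" and fin: "finite_measure (surface_measure \<Omega>)"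
    and H: "H1 \<Omega> U G" and T: "is_trace \<Omega> U G u"
  shows "\<exists>\<phi> D\<phi>. (\<forall>n. C1_test (\<phi> n) (D\<phi> n)) \<and>
    L2_tendsto (lebesgue_on \<Omega>) (\<lambda>n. energy_pair k (\<phi> n) (D\<phi> n)) (energy_pair k U G) \<and>
    L2_tendsto (surface_measure \<Omega>) \<phi> u"
proof -
  let ?A = "lebesgue_on \<Omega>" and ?B = "surface_measure \<Omega>"
  obtain \<phi> D\<phi> where C1: "\<And>n. C1_grad (\<phi> n) (D\<phi> n)" "\<And>n. compact (closure {x. \<phi> n x \<noteq> 0})"
    and t1: "(\<lambda>n. \<integral>\<^sup>+ x. ennreal ((\<phi> n x - U x)\<^sup>2 + (norm (D\<phi> n x - G x))\<^sup>2) \<partial>?A) \<longlonglongrightarrow> 0"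
    and t2: "(\<lambda>n. \<integral>\<^sup>+ x. ennreal ((\<phi> n x - u x)\<^sup>2) \<partial>?B) \<longlonglongrightarrow> 0"
    using T unfolding is_trace_def by blast
  have [measurable]: "U \<in> borel_measurable ?A" "G \<in> borel_measurable ?A" using H by (auto simp: H1_def)
  have mn[measurable]: "\<phi> n \<in> borel_measurable ?A" "D\<phi> n \<in> borel_measurable ?A" for n
    by (intro measurable_lebesgue_on C1_grad_continuous[OF C1(1)])+
  have sX: "sq_integrable ?A (energy_pair k U G)"
    unfolding sq_integrable_def energy_pair_norm
  proof
    show "energy_pair k U G \<in> borel_measurable ?A" unfolding energy_pair_def by measurable
    show "integrable ?A (\<lambda>x. k\<^sup>2 * (U x)\<^sup>2 + (norm (G x))\<^sup>2)" using H by (simp add: H1_def)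
  qed
  have sn: "sq_integrable ?A (energy_pair k (\<phi> n) (D\<phi> n))" for n
    by (rule sq_integrable_continuous_interior[OF energy_pair_continuous[OF C1(1)] \<Omega>])
  have su: "sq_integrable ?B u" using T by (simp add: is_trace_def sq_integrable_def)
  have s\<phi>: "sq_integrable ?B (\<phi> n)" for n
    by (rule sq_integrable_continuous_surface[OF C1_grad_continuous(1)[OF C1(1)] \<Omega>(1) fin])
  let ?d = "\<lambda>n x. energy_pair k (\<phi> n) (D\<phi> n) x - energy_pair k U G x"
  define c where "c = 1 + k\<^sup>2"
  have c: "c \<ge> 0" by (simp add: c_def)
  have bound: "ennreal (L2_sq ?A (?d n)) \<le> ennreal c * (\<integral>\<^sup>+ x. ennreal ((\<phi> n x - U x)\<^sup>2 + (norm (D\<phi> n x - G x))\<^sup>2) \<partial>?A)" for n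
  proof -
    have "ennreal (L2_sq ?A (?d n)) = (\<integral>\<^sup>+ x. ennreal ((norm (?d n x))\<^sup>2) \<partial>?A)"
      by (rule nn_integral_sq_eq[symmetric]) (rule sq_integrable_diff[OF sn sX])
    also have "\<dots> \<le> (\<integral>\<^sup>+ x. ennreal c * ennreal ((\<phi> n x - U x)\<^sup>2 + (norm (D\<phi> n x - G x))\<^sup>2) \<partial>?A)"
    proof (rule nn_integral_mono)
      fix x
      let ?a = "(\<phi> n x - U x)\<^sup>2" and ?b = "(norm (D\<phi> n x - G x))\<^sup>2"
      have "?d n x = energy_pair k (\<lambda>x. \<phi> n x - U x) (\<lambda>x. D\<phi> n x - G x) x"
        by (simp add: energy_pair_def algebra_simps)
      then have "(norm (?d n x))\<^sup>2 = k\<^sup>2 * ?a + ?b" by (simp add: energy_pair_norm)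
      also have "\<dots> \<le> c * (?a + ?b)" unfolding c_def by (simp add: algebra_simps)
      finally have "ennreal ((norm (?d n x))\<^sup>2) \<le> ennreal (c * (?a + ?b))" by (rule ennreal_leI)
      also have "\<dots> = ennreal c * ennreal (?a + ?b)" using c by (intro ennreal_mult) auto
      finally show "ennreal ((norm (?d n x))\<^sup>2) \<le> ennreal c * ennreal (?a + ?b)" .
    qed
    also have "\<dots> = ennreal c * (\<integral>\<^sup>+ x. ennreal ((\<phi> n x - U x)\<^sup>2 + (norm (D\<phi> n x - G x))\<^sup>2) \<partial>?A)"
      by (rule nn_integral_cmult) measurable
    finally show ?thesis .
  qed
  have "(\<lambda>n. ennreal c * (\<integral>\<^sup>+ x. ennreal ((\<phi> n x - U x)\<^sup>2 + (norm (D\<phi> n x - G x))\<^sup>2) \<partial>?A)) \<longlonglongrightarrow> ennreal c * 0"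
    by (rule ennreal_tendsto_cmult[OF _ t1]) simp
  then have "(\<lambda>n. ennreal c * (\<integral>\<^sup>+ x. ennreal ((\<phi> n x - U x)\<^sup>2 + (norm (D\<phi> n x - G x))\<^sup>2) \<partial>?A)) \<longlonglongrightarrow> 0" by simp
  then have "(\<lambda>n. ennreal (L2_sq ?A (?d n))) \<longlonglongrightarrow> 0"
    by (rule ennreal_tendsto_0_mono[OF bound])
  then have A: "(\<lambda>n. L2_sq ?A (?d n)) \<longlonglongrightarrow> 0"
    using tendsto_ennreal_iff[of "\<lambda>n. L2_sq ?A (?d n)" sequentially 0] by (simp add: L2_inner_nonneg)
  have "(\<lambda>n. ennreal (L2_sq ?B (\<lambda>x. \<phi> n x - u x))) \<longlonglongrightarrow> 0"
    using t2 nn_integral_sq_eq[OF sq_integrable_diff[OF s\<phi> su]] by simp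
  then have B: "(\<lambda>n. L2_sq ?B (\<lambda>x. \<phi> n x - u x)) \<longlonglongrightarrow> 0"
    using tendsto_ennreal_iff[of "\<lambda>n. L2_sq ?B (\<lambda>x. \<phi> n x - u x)" sequentially 0]
    by (simp add: L2_inner_nonneg)
  show ?thesis
    by (rule exI[of _ \<phi>], rule exI[of _ D\<phi>])
      (use C1 A B sX sn su s\<phi> in \<open>simp add: L2_tendsto_def C1_test_def\<close>)
qed

section \<open>The smallest eigenvalue\<close>

lemma dirichlet_le_energy:
  fixes \<Omega> :: "'a::euclidean_space set"
  assumes \<Omega>: "\<Omega> \<in> sets borel" and s: "sq_integrable (lebesgue_on \<Omega>) (energy_pair k \<phi> D\<phi>)"
  shows "(\<integral>\<^sup>+y. indicator \<Omega> y * ennreal ((norm (D\<phi> y))\<^sup>2) \<partial>lborel)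
     \<le> ennreal (L2_sq (lebesgue_on \<Omega>) (energy_pair k \<phi> D\<phi>))"
proof -
  have "(\<integral>\<^sup>+y. indicator \<Omega> y * ennreal ((norm (D\<phi> y))\<^sup>2) \<partial>lborel) = (\<integral>\<^sup>+y. ennreal ((norm (D\<phi> y))\<^sup>2) \<partial>lebesgue_on \<Omega>)"
    by (rule nn_integral_lebesgue_on_borel[OF \<Omega>, symmetric])
  also have "\<dots> \<le> (\<integral>\<^sup>+y. ennreal ((norm (energy_pair k \<phi> D\<phi> y))\<^sup>2) \<partial>lebesgue_on \<Omega>)"
    unfolding energy_pair_norm by (intro nn_integral_mono ennreal_leI) simp
  also have "\<dots> = ennreal (L2_sq (lebesgue_on \<Omega>) (energy_pair k \<phi> D\<phi>))"
    by (rule nn_integral_sq_eq[OF s])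
  finally show ?thesis .
qed

text \<open>The energy contains k^2 \<phi>^2 with k > 0, so bounded energy bounds the L2 norm on
  \<Omega> and, by Cauchy-Schwarz, the integral over any compact subset.\<close>

lemma compact_average_bounded:
  fixes \<Omega> :: "'a::euclidean_space set"
  assumes \<Omega>: "bounded \<Omega>" "open \<Omega>" and k: "k > 0" and B: "compact B" "B \<subseteq> \<Omega>" and C1: "C1_grad \<phi> D\<phi>"
    and K: "L2_sq (lebesgue_on \<Omega>) (energy_pair k \<phi> D\<phi>) \<le> K"
  shows "\<bar>LINT y|lborel. indicator B y * \<phi> y\<bar> \<le> sqrt (measure lborel \<Omega> * (K / k\<^sup>2))"
proof -
  let ?A = "lebesgue_on \<Omega>"
  have s: "sq_integrable ?A (energy_pair k \<phi> D\<phi>)"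
    by (rule sq_integrable_continuous_interior[OF energy_pair_continuous[OF C1] \<Omega>])
  have K0: "K \<ge> 0" using K L2_inner_nonneg order_trans by blast
  have \<Omega>b: "\<Omega> \<in> sets borel" using \<Omega> by simp
  have fin: "emeasure lborel \<Omega> = ennreal (measure lborel \<Omega>)"
    using emeasure_bounded_finite[OF \<Omega>(1)] by (intro emeasure_eq_ennreal_measure) simp
  have "(\<integral>\<^sup>+y. indicator B y * ennreal ((\<phi> y)\<^sup>2) \<partial>lborel) \<le> (\<integral>\<^sup>+y. indicator \<Omega> y * ennreal ((\<phi> y)\<^sup>2) \<partial>lborel)"
    using B(2) by (intro nn_integral_mono mult_right_mono) (auto simp: indicator_def)
  also have "\<dots> = (\<integral>\<^sup>+y. ennreal ((\<phi> y)\<^sup>2) \<partial>?A)" by (rule nn_integral_lebesgue_on_borel[OF \<Omega>b, symmetric])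
  also have "\<dots> \<le> (\<integral>\<^sup>+y. ennreal (1 / k\<^sup>2) * ennreal ((norm (energy_pair k \<phi> D\<phi> y))\<^sup>2) \<partial>?A)"
  proof (rule nn_integral_mono)
    fix y
    have "(\<phi> y)\<^sup>2 \<le> 1 / k\<^sup>2 * (norm (energy_pair k \<phi> D\<phi> y))\<^sup>2"
      using k by (simp add: energy_pair_norm field_simps)
    then show "ennreal ((\<phi> y)\<^sup>2) \<le> ennreal (1 / k\<^sup>2) * ennreal ((norm (energy_pair k \<phi> D\<phi> y))\<^sup>2)"
      by (simp add: ennreal_mult[symmetric] ennreal_leI)
  qed
  also have "\<dots> = ennreal (1 / k\<^sup>2) * (\<integral>\<^sup>+y. ennreal ((norm (energy_pair k \<phi> D\<phi> y))\<^sup>2) \<partial>?A)"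
    by (rule nn_integral_cmult) (use s in \<open>auto simp: sq_integrable_def\<close>)
  also have "\<dots> \<le> ennreal (1 / k\<^sup>2) * ennreal K"
    unfolding nn_integral_sq_eq[OF s] by (intro mult_left_mono ennreal_leI K) simp
  finally have b: "(\<integral>\<^sup>+y. indicator B y * ennreal ((\<phi> y)\<^sup>2) \<partial>lborel) \<le> ennreal (1 / k\<^sup>2) * ennreal K" .
  have "ennreal ((LINT y|lborel. indicator B y * \<phi> y)\<^sup>2)
      \<le> emeasure lborel B * (\<integral>\<^sup>+y. indicator B y * ennreal ((\<phi> y)\<^sup>2) \<partial>lborel)"
    by (rule square_integral_compact_le[OF B(1) C1_grad_continuous(1)[OF C1]])
  also have "\<dots> \<le> emeasure lborel \<Omega> * (ennreal (1 / k\<^sup>2) * ennreal K)"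
    by (intro mult_mono b emeasure_mono B(2)) (use \<Omega>b in auto)
  also have "\<dots> = ennreal (measure lborel \<Omega> * (K / k\<^sup>2))"
    unfolding fin using K0 by (simp add: ennreal_mult[symmetric])
  finally have "(LINT y|lborel. indicator B y * \<phi> y)\<^sup>2 \<le> measure lborel \<Omega> * (K / k\<^sup>2)"
    using K0 by simp
  from real_sqrt_le_mono[OF this] show ?thesis by simp
qed

text \<open>Only countably many compact sets are involved when \<open>boundary_compactness\<close>
  is used for each \<epsilon> = 1/(j+1), so a diagonal subsequence makes all integrals over them
  converge. Applied to differences along it, the energy term is small through the choice of j and
  the finite sum through convergence.\<close>

lemma boundary_values_subsequence_Cauchy:
  fixes \<Omega> :: "'a::euclidean_space set"
  assumes dim: "DIM('a) \<ge> 2" and \<Omega>: "bounded \<Omega>" "lipschitz_domain \<Omega>" and k: "k > 0"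
    and C1: "\<And>n. C1_grad (\<phi> n) (D\<phi> n)"
    and K: "\<And>n. L2_sq (lebesgue_on \<Omega>) (energy_pair k (\<phi> n) (D\<phi> n)) \<le> K"
  shows "\<exists>r :: nat \<Rightarrow> nat. strict_mono r \<and> (\<forall>\<epsilon>>0. \<exists>N. \<forall>i\<ge>N. \<forall>j\<ge>N.
     L2_sq (surface_measure \<Omega>) (\<lambda>x. \<phi> (r i) x - \<phi> (r j) x) < \<epsilon>)"
proof -
  let ?A = "lebesgue_on \<Omega>" and ?B = "surface_measure \<Omega>"
  let ?I = "\<lambda>n B. LINT y|lborel. indicator B y * \<phi> n y"
  have op: "open \<Omega>" using \<Omega>(2) by (simp add: lipschitz_domain_def)
  have fin: "finite_measure ?B" by (rule finite_measure_surface[OF dim \<Omega>])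
  have K0: "K \<ge> 0" using K[of 0] L2_inner_nonneg order_trans by blast
  define P where "P j M F \<longleftrightarrow> M \<ge> (0::real) \<and> finite F \<and> (\<forall>B\<in>F. compact B \<and> B \<subseteq> \<Omega>) \<and>
    (\<forall>\<phi> D\<phi>. C1_grad \<phi> D\<phi> \<longrightarrow>
      (\<integral>\<^sup>+x. ennreal ((\<phi> x)\<^sup>2) \<partial>?B)
       \<le> ennreal (1 / real (Suc j)) * (\<integral>\<^sup>+y. indicator \<Omega> y * ennreal ((norm (D\<phi> y))\<^sup>2) \<partial>lborel)
         + ennreal (M * (\<Sum>B\<in>F. (LINT y|lborel. indicator B y * \<phi> y)\<^sup>2)))" for j :: nat and M F
  have "\<forall>j. \<exists>M F. P j M F"
  proof
    fix j :: nat
    have "1 / real (Suc j) > 0" by simp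
    from boundary_compactness[OF dim \<Omega> this] show "\<exists>M F. P j M F" unfolding P_def by blast
  qed
  from choice[OF this] obtain M where "\<forall>j. \<exists>F. P j (M j) F" ..
  from choice[OF this] obtain F where P: "\<forall>j. P j (M j) (F j)" ..
  define FF where "FF = (\<Union>j. F j)"
  have "finite (F j)" for j using P[THEN spec, of j] by (simp add: P_def)
  then have cFF: "countable FF" unfolding FF_def by (rule countable_UN[OF countableI_type countable_finite])
  have bound: "norm (?I n B) \<le> sqrt (measure lborel \<Omega> * (K / k\<^sup>2))" if "B \<in> FF" for n B
  proof -
    from that obtain j where "B \<in> F j" by (auto simp: FF_def)
    with P[THEN spec, of j] have "compact B" "B \<subseteq> \<Omega>" by (auto simp: P_def)
    from compact_average_bounded[OF \<Omega>(1) op k this C1 K] show ?thesis by simp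
  qed
  obtain r :: "nat \<Rightarrow> nat" where r: "strict_mono r" and conv: "\<And>B. B \<in> FF \<Longrightarrow> \<exists>l. (\<lambda>n. ?I (r n) B) \<longlonglongrightarrow> l"
    by (rule function_convergent_subsequence[where f="\<lambda>n B. ?I n B", OF cFF bound])
      (assumption, rule that, assumption, blast)
  have sA: "sq_integrable ?A (energy_pair k (\<phi> n) (D\<phi> n))" for n
    by (rule sq_integrable_continuous_interior[OF energy_pair_continuous[OF C1] \<Omega>(1) op])
  have sB: "sq_integrable ?B (\<phi> n)" for n
    by (rule sq_integrable_continuous_surface[OF C1_grad_continuous(1)[OF C1] \<Omega>(1) fin])
  have "\<exists>N. \<forall>i\<ge>N. \<forall>j\<ge>N. L2_sq ?B (\<lambda>x. \<phi> (r i) x - \<phi> (r j) x) < \<epsilon>"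
    if \<epsilon>: "\<epsilon> > 0" for \<epsilon>
  proof -
    \<comment> \<open>Differences have energy at most 4 K by the parallelogram law; \<open>m\<close>
      makes 4 K/(m+1) at most \<epsilon>/2.\<close>
    obtain m :: nat where m: "8 * K / \<epsilon> < real m" using reals_Archimedean2 by blast
    have mK: "1 / real (Suc m) * (4 * K) \<le> \<epsilon> / 2"
    proof -
      have "8 * K / \<epsilon> \<le> real (Suc m)" using m by simp
      then have "8 * K \<le> real (Suc m) * \<epsilon>" using \<epsilon> by (simp add: pos_divide_le_eq)
      then show ?thesis by (simp add: field_simps)
    qed
    from P have Pm: "P m (M m) (F m)" ..
    then have M0: "M m \<ge> 0" and fF: "finite (F m)" and cF: "\<And>B. B \<in> F m \<Longrightarrow> compact B" by (auto simp: P_def)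
    \<comment> \<open>Chosen so that \<open>M m\<close> times the number of sets times \<eta>^2 is
      at most \<epsilon>/4; the added 1's keep the denominator positive.\<close>
    define \<eta> where "\<eta> = sqrt (\<epsilon> / (4 * (1 + M m) * (1 + real (card (F m)))))"
    have \<eta>: "\<eta> > 0" using \<epsilon> M0 by (simp add: \<eta>_def)
    have \<eta>2: "\<eta>\<^sup>2 = \<epsilon> / (4 * (1 + M m) * (1 + real (card (F m))))" unfolding \<eta>_def using \<epsilon> M0 by simp
    have M\<eta>: "M m * (real (card (F m)) * \<eta>\<^sup>2) \<le> \<epsilon> / 4"
    proof -
      have "M m * (real (card (F m)) * \<eta>\<^sup>2) \<le> (1 + M m) * ((1 + real (card (F m))) * \<eta>\<^sup>2)"
        using M0 by (intro mult_mono) auto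
      also have "\<dots> = \<epsilon> / 4" unfolding \<eta>2 using M0 by (simp add: field_simps add_nonneg_eq_0_iff)
      finally show ?thesis .
    qed
    have "\<forall>B. \<exists>N. B \<in> F m \<longrightarrow> (\<forall>i\<ge>N. \<forall>j\<ge>N. dist (?I (r i) B) (?I (r j) B) < \<eta>)"
    proof
      fix B
      show "\<exists>N. B \<in> F m \<longrightarrow> (\<forall>i\<ge>N. \<forall>j\<ge>N. dist (?I (r i) B) (?I (r j) B) < \<eta>)"
      proof (cases "B \<in> F m")
        case True
        then have "B \<in> FF" by (auto simp: FF_def)
        from conv[OF this] obtain l where "(\<lambda>n. ?I (r n) B) \<longlonglongrightarrow> l" ..
        then have "Cauchy (\<lambda>n. ?I (r n) B)" by (rule LIMSEQ_imp_Cauchy)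
        from metric_CauchyD[OF this \<eta>] show ?thesis by simp
      qed simp
    qed
    from choice[OF this] obtain N where N: "\<forall>B. B \<in> F m \<longrightarrow> (\<forall>i\<ge>N B. \<forall>j\<ge>N B. dist (?I (r i) B) (?I (r j) B) < \<eta>)" ..
    \<comment> \<open>A sum of naturals dominates each summand and, unlike a maximum, has a value
      for the empty family.\<close>
    define N0 where "N0 = (\<Sum>B\<in>F m. N B)"
    have N0: "N B \<le> N0" if "B \<in> F m" for B unfolding N0_def by (rule member_le_sum) (use that fF in auto)
    show ?thesis
    proof (intro exI[of _ N0] allI impI)
      fix i j assume i: "N0 \<le> i" and j: "N0 \<le> j"
      let ?\<phi> = "\<lambda>x. \<phi> (r i) x - \<phi> (r j) x" and ?D = "\<lambda>x. D\<phi> (r i) x - D\<phi> (r j) x"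
      have C1d: "C1_grad ?\<phi> ?D" using C1_grad_add_scaled[OF C1[of "r i"] C1[of "r j"], of "-1"] by simp
      have pair: "energy_pair k ?\<phi> ?D = (\<lambda>x. energy_pair k (\<phi> (r i)) (D\<phi> (r i)) x - energy_pair k (\<phi> (r j)) (D\<phi> (r j)) x)"
        by (simp add: fun_eq_iff energy_pair_def algebra_simps)
      have "L2_sq ?A (energy_pair k ?\<phi> ?D) \<le> 4 * K"
        unfolding pair using L2_parallelogram[OF sA[of "r i"] sA[of "r j"]] K[of "r i"] K[of "r j"]
          L2_inner_nonneg[of ?A "\<lambda>x. energy_pair k (\<phi> (r i)) (D\<phi> (r i)) x + energy_pair k (\<phi> (r j)) (D\<phi> (r j)) x"]
        by linarith
      moreover have "sq_integrable ?A (energy_pair k ?\<phi> ?D)" unfolding pair by (rule sq_integrable_diff[OF sA sA])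
      ultimately have D: "(\<integral>\<^sup>+y. indicator \<Omega> y * ennreal ((norm (?D y))\<^sup>2) \<partial>lborel) \<le> ennreal (4 * K)"
        using dirichlet_le_energy[of \<Omega> k ?\<phi> ?D] op by (meson borel_open ennreal_leI order_trans)
      have Q: "(\<Sum>B\<in>F m. (LINT y|lborel. indicator B y * ?\<phi> y)\<^sup>2) \<le> real (card (F m)) * \<eta>\<^sup>2"
      proof (rule sum_bounded_above)
        fix B assume B: "B \<in> F m"
        have int: "integrable lborel (\<lambda>y. indicator B y * \<phi> n y)" for n
          using integrable_continuous_on_compact[OF cF[OF B] C1_grad_continuous(1)[OF C1[of n]]] by simp
        have "(LINT y|lborel. indicator B y * ?\<phi> y) = ?I (r i) B - ?I (r j) B"
          using int by (simp add: right_diff_distrib)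
        moreover have "dist (?I (r i) B) (?I (r j) B) < \<eta>"
          using N[THEN spec, of B] B N0[OF B] i j by simp
        ultimately have "\<bar>LINT y|lborel. indicator B y * ?\<phi> y\<bar> \<le> \<eta>" by (simp add: dist_real_def)
        then have "\<bar>LINT y|lborel. indicator B y * ?\<phi> y\<bar>\<^sup>2 \<le> \<eta>\<^sup>2" by (rule power_mono) simp
        then show "(LINT y|lborel. indicator B y * ?\<phi> y)\<^sup>2 \<le> \<eta>\<^sup>2" by simp
      qed
      have "ennreal (L2_sq ?B ?\<phi>) = (\<integral>\<^sup>+x. ennreal ((?\<phi> x)\<^sup>2) \<partial>?B)"
        using nn_integral_sq_eq[OF sq_integrable_diff[OF sB[of "r i"] sB[of "r j"]]] by simp
      also have "\<dots> \<le> ennreal (1 / real (Suc m)) * (\<integral>\<^sup>+y. indicator \<Omega> y * ennreal ((norm (?D y))\<^sup>2) \<partial>lborel)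
         + ennreal (M m * (\<Sum>B\<in>F m. (LINT y|lborel. indicator B y * ?\<phi> y)\<^sup>2))"
        using Pm C1d unfolding P_def by blast
      also have "\<dots> \<le> ennreal (1 / real (Suc m)) * ennreal (4 * K) + ennreal (M m * (real (card (F m)) * \<eta>\<^sup>2))"
        by (intro add_mono mult_left_mono D ennreal_leI Q M0) simp
      also have "\<dots> = ennreal (1 / real (Suc m) * (4 * K)) + ennreal (M m * (real (card (F m)) * \<eta>\<^sup>2))"
        by (subst ennreal_mult) (use K0 in auto)
      also have "\<dots> = ennreal (1 / real (Suc m) * (4 * K) + M m * (real (card (F m)) * \<eta>\<^sup>2))"
        by (rule ennreal_plus[symmetric]) (use K0 M0 in auto)
      also have "\<dots> \<le> ennreal (\<epsilon> / 2 + \<epsilon> / 4)" by (intro ennreal_leI add_mono mK M\<eta>)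
      finally have "L2_sq ?B ?\<phi> \<le> \<epsilon> / 2 + \<epsilon> / 4" using \<epsilon> by (subst (asm) ennreal_le_iff) auto
      then show "L2_sq ?B ?\<phi> < \<epsilon>" using \<epsilon> by linarith
    qed
  qed
  then show ?thesis using r by (intro exI[of _ r]) simp
qed

section \<open>The truncated exponential as a test function\<close>

lemma C1_grad_compose:
  assumes f: "\<And>s. (f has_real_derivative f' s) (at s)" and f': "continuous_on UNIV f'" and g: "C1_grad g Dg"
  shows "C1_grad (\<lambda>x. f (g x)) (\<lambda>x. f' (g x) *\<^sub>R Dg x)"
  unfolding C1_grad_def
proof (intro conjI allI)
  fix x
  have "((\<lambda>x. f (g x)) has_derivative (\<lambda>h. f' (g x) * (Dg x \<bullet> h))) (at x)"
    using g f[of "g x"] unfolding C1_grad_def has_field_derivative_def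
    by (intro has_derivative_compose[of g "\<lambda>h. Dg x \<bullet> h" x UNIV f "\<lambda>h. f' (g x) * h"]) auto
  then show "((\<lambda>x. f (g x)) has_derivative (\<lambda>h. (f' (g x) *\<^sub>R Dg x) \<bullet> h)) (at x)" by simp
  show "continuous_on UNIV (\<lambda>x. f' (g x) *\<^sub>R Dg x)"
    by (intro continuous_intros continuous_on_compose2[OF f'] C1_grad_continuous[OF g]) auto
qed

text \<open>Building block of the cutoff: a C1 function that vanishes on a half-line. At 0 the
  difference quotient is at most |h|.\<close>

lemma DERIV_max_zero_square:
  "((\<lambda>s. (max 0 s)\<^sup>2) has_real_derivative 2 * max 0 s) (at (s::real))"
proof -
  consider "s > 0" | "s < 0" | "s = 0" by linarith
  then show ?thesis
  proof cases
    case 1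
    have "((\<lambda>s. s\<^sup>2) has_real_derivative 2 * max 0 s) (at s)"
      using 1 by (auto intro!: derivative_eq_intros)
    then show ?thesis
      by (rule has_field_derivative_transform_within_open[where S="{0<..}"]) (use 1 in auto)
  next
    case 2
    have "((\<lambda>s. 0) has_real_derivative 2 * max 0 s) (at s)" using 2 by simp
    then show ?thesis
      by (rule has_field_derivative_transform_within_open[where S="{..<0}"]) (use 2 in auto)
  next
    case 3
    have "(\<lambda>h::real. ((max 0 (0 + h))\<^sup>2 - (max 0 0)\<^sup>2) / h) \<midarrow>0\<rightarrow> 0"
    proof (rule Lim_null_comparison)
      show "\<forall>\<^sub>F h::real in at 0. norm (((max 0 (0 + h))\<^sup>2 - (max 0 0)\<^sup>2) / h) \<le> \<bar>h\<bar>"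
        by (rule always_eventually) (auto simp: max_def power2_eq_square)
      show "((\<lambda>h::real. \<bar>h\<bar>) \<longlongrightarrow> 0) (at 0)" by (rule tendsto_rabs_zero) (rule tendsto_ident_at)
    qed
    then show ?thesis using 3 by (simp add: DERIV_def)
  qed
qed

text \<open>The cutoff is p(1 - p(|x|^2 - R'^2)) with p(s) = max(0, s)^2. For |x| \<le> R' the inner
  p vanishes together with its derivative, so the cutoff equals p(1) = 1 and does not affect the
  gradient; for |x| \<ge> R' + 1 the inner p is at least 1 and the cutoff is 0.\<close>

lemma C1_test_exponential:
  fixes b :: "'a::euclidean_space"
  shows "\<exists>\<psi> D\<psi>. C1_test \<psi> D\<psi> \<and> (\<forall>x. norm x \<le> R \<longrightarrow> \<psi> x = exp (k * (x \<bullet> b)) \<and> D\<psi> x = (k * exp (k * (x \<bullet> b))) *\<^sub>R b)"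
proof -
  define p :: "real \<Rightarrow> real" where "p s = (max 0 s)\<^sup>2" for s
  define p' :: "real \<Rightarrow> real" where "p' s = 2 * max 0 s" for s
  have p: "(p has_real_derivative p' s) (at s)" for s unfolding p_def p'_def by (rule DERIV_max_zero_square)
  have cp: "continuous_on UNIV p'" unfolding p'_def by (intro continuous_intros)
  \<comment> \<open>A nonnegative radius makes squaring monotone, whatever the sign of
    \<open>R\<close>.\<close>
  define R' where "R' = max R 0"
  have q: "C1_grad (\<lambda>x::'a. x \<bullet> x - R'\<^sup>2) (\<lambda>x. 2 *\<^sub>R x)"
    unfolding C1_grad_def by (auto intro!: derivative_eq_intros continuous_intros simp: inner_commute)
  have one: "C1_grad (\<lambda>x::'a. 1) (\<lambda>x. 0)" unfolding C1_grad_def inner_zero_left by simp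
  note pq = C1_grad_compose[OF p cp q]
  note oq = C1_grad_add_scaled[OF one pq, of "-1"]
  note ch = C1_grad_compose[OF p cp oq]
  have lin: "C1_grad (\<lambda>x::'a. x \<bullet> b) (\<lambda>x. b)"
    unfolding C1_grad_def by (auto intro!: derivative_eq_intros simp: inner_commute)
  have "((\<lambda>s. exp (k * s)) has_real_derivative k * exp (k * s)) (at s)" for s
    by (auto intro!: derivative_eq_intros)
  then have ex: "C1_grad (\<lambda>x::'a. exp (k * (x \<bullet> b))) (\<lambda>x. (k * exp (k * (x \<bullet> b))) *\<^sub>R b)"
    by (rule C1_grad_compose[OF _ _ lin]) (intro continuous_intros)
  define \<psi> where "\<psi> x = exp (k * (x \<bullet> b)) * p (1 + - 1 * p (x \<bullet> x - R'\<^sup>2))" for x :: 'a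
  define D\<psi> where "D\<psi> x = exp (k * (x \<bullet> b)) *\<^sub>R p' (1 + - 1 * p (x \<bullet> x - R'\<^sup>2)) *\<^sub>R (0 + - 1 *\<^sub>R p' (x \<bullet> x - R'\<^sup>2) *\<^sub>R 2 *\<^sub>R x)
      + p (1 + - 1 * p (x \<bullet> x - R'\<^sup>2)) *\<^sub>R (k * exp (k * (x \<bullet> b))) *\<^sub>R b" for x :: 'a
  have C1: "C1_grad \<psi> D\<psi>" unfolding \<psi>_def[abs_def] D\<psi>_def[abs_def] by (rule C1_grad_mult[OF ex ch])
  have "{x. \<psi> x \<noteq> 0} \<subseteq> cball 0 (R' + 1)"
  proof (rule subsetI, rule ccontr)
    fix x assume x: "x \<in> {x. \<psi> x \<noteq> 0}" "x \<notin> cball 0 (R' + 1)"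
    then have "(R' + 1)\<^sup>2 \<le> (norm x)\<^sup>2" by (intro power_mono) (auto simp: R'_def)
    then have "x \<bullet> x - R'\<^sup>2 \<ge> 1" by (simp add: power2_norm_eq_inner[symmetric] power2_sum R'_def)
    then have "p (x \<bullet> x - R'\<^sup>2) \<ge> 1" unfolding p_def by (simp add: one_le_power)
    moreover have "p t = 0" if "t \<le> 0" for t using that by (simp add: p_def)
    ultimately have "p (1 + - 1 * p (x \<bullet> x - R'\<^sup>2)) = 0" by simp
    then show False using x by (simp add: \<psi>_def)
  qed
  then have "bounded {x. \<psi> x \<noteq> 0}" by (rule bounded_subset[OF bounded_cball])
  moreover have "\<psi> x = exp (k * (x \<bullet> b)) \<and> D\<psi> x = (k * exp (k * (x \<bullet> b))) *\<^sub>R b" if "norm x \<le> R" for x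
  proof -
    have "(norm x)\<^sup>2 \<le> R'\<^sup>2" using that by (intro power_mono) (auto simp: R'_def)
    then have "x \<bullet> x - R'\<^sup>2 \<le> 0" by (simp add: power2_norm_eq_inner)
    then have "p (x \<bullet> x - R'\<^sup>2) = 0" "p' (x \<bullet> x - R'\<^sup>2) = 0" by (simp_all add: p_def p'_def)
    then show ?thesis by (simp add: \<psi>_def D\<psi>_def p_def[of 1])
  qed
  ultimately show ?thesis using C1 unfolding C1_test_def by blast
qed

lemma exponential_rayleigh_quotient:
  fixes \<Omega> :: "'a::euclidean_space set"
  assumes dim: "DIM('a) \<ge> 2" and \<Omega>: "bounded \<Omega>" "lipschitz_domain \<Omega>" and k: "k > 0"
  shows "\<exists>\<psi> D\<psi>. C1_test \<psi> D\<psi> \<and> L2_sq (surface_measure \<Omega>) \<psi> > 0 \<and>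
    L2_sq (lebesgue_on \<Omega>) (energy_pair k \<psi> D\<psi>) \<le> k * L2_sq (surface_measure \<Omega>) \<psi>"
proof -
  let ?A = "lebesgue_on \<Omega>" and ?B = "surface_measure \<Omega>"
  have op: "open \<Omega>" and ne: "\<Omega> \<noteq> {}" using \<Omega>(2) by (auto simp: lipschitz_domain_def)
  have \<Omega>b: "\<Omega> \<in> sets borel" using op by simp
  have fin: "finite_measure ?B" by (rule finite_measure_surface[OF dim \<Omega>])
  obtain b :: 'a where b: "b \<in> Basis" using nonempty_Basis by blast
  have "bounded (closure \<Omega>)" by (rule bounded_closure[OF \<Omega>(1)])
  then obtain R where R: "\<forall>x\<in>closure \<Omega>. norm x \<le> R" unfolding bounded_iff ..
  obtain \<psi> D\<psi> where C1: "C1_test \<psi> D\<psi>"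
    and \<psi>: "\<forall>x. norm x \<le> R \<longrightarrow> \<psi> x = exp (k * (x \<bullet> b)) \<and> D\<psi> x = (k * exp (k * (x \<bullet> b))) *\<^sub>R b"
    using C1_test_exponential[of R k b] by blast
  have C1g: "C1_grad \<psi> D\<psi>" using C1 by (simp add: C1_test_def)
  have sA: "sq_integrable ?A (energy_pair k \<psi> D\<psi>)"
    by (rule sq_integrable_continuous_interior[OF energy_pair_continuous[OF C1g] \<Omega>(1) op])
  have sB: "sq_integrable ?B \<psi>"
    by (rule sq_integrable_continuous_surface[OF C1_grad_continuous(1)[OF C1g] \<Omega>(1) fin])
  have esq: "(exp (k * s))\<^sup>2 = exp (2 * k * s)" for s :: real
    by (simp add: power2_eq_square exp_add[symmetric])
  \<comment> \<open>For this exponential k^2 \<psi>^2 and |grad \<psi>|^2 agree; their sum is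
    grouped as k times the density that \<open>exp_interior_le_boundary\<close> bounds.\<close>
  have en: "(norm (energy_pair k \<psi> D\<psi> x))\<^sup>2 = k * (2 * k * exp (2 * k * (x \<bullet> b)))" if "x \<in> \<Omega>" for x
  proof -
    have "norm x \<le> R" using R closure_subset that by blast
    then have "\<psi> x = exp (k * (x \<bullet> b))" "D\<psi> x = (k * exp (k * (x \<bullet> b))) *\<^sub>R b" using \<psi> by auto
    then show ?thesis using b unfolding energy_pair_norm
      by (simp add: power_mult_distrib esq power2_eq_square[of k])
  qed
  have bd: "(\<psi> x)\<^sup>2 = exp (2 * k * (x \<bullet> b))" if "x \<in> frontier \<Omega>" for x
    using \<psi> R that by (simp add: frontier_def esq)
  have "ennreal (L2_sq ?A (energy_pair k \<psi> D\<psi>)) = (\<integral>\<^sup>+x. ennreal ((norm (energy_pair k \<psi> D\<psi> x))\<^sup>2) \<partial>?A)"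
    by (rule nn_integral_sq_eq[OF sA, symmetric])
  also have "\<dots> = (\<integral>\<^sup>+x. indicator \<Omega> x * ennreal ((norm (energy_pair k \<psi> D\<psi> x))\<^sup>2) \<partial>lborel)"
    by (rule nn_integral_lebesgue_on_borel[OF \<Omega>b])
  also have "\<dots> = (\<integral>\<^sup>+x. ennreal k * (indicator \<Omega> x * ennreal (2 * k * exp (2 * k * (x \<bullet> b)))) \<partial>lborel)"
    by (intro nn_integral_cong) (use en k in \<open>simp add: indicator_def ennreal_mult[symmetric]\<close>)
  also have "\<dots> = ennreal k * (\<integral>\<^sup>+x. indicator \<Omega> x * ennreal (2 * k * exp (2 * k * (x \<bullet> b))) \<partial>lborel)"
    by (rule nn_integral_cmult) (use \<Omega>b in measurable)
  also have "\<dots> \<le> ennreal k * (\<integral>\<^sup>+x. ennreal (exp (2 * k * (x \<bullet> b))) \<partial>?B)"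
    by (intro mult_left_mono exp_interior_le_boundary[OF dim op \<Omega>(1) b k fin]) simp
  also have "(\<integral>\<^sup>+x. ennreal (exp (2 * k * (x \<bullet> b))) \<partial>?B) = (\<integral>\<^sup>+x. ennreal ((norm (\<psi> x))\<^sup>2) \<partial>?B)"
    by (intro nn_integral_cong) (simp add: bd)
  also have "\<dots> = ennreal (L2_sq ?B \<psi>)" by (rule nn_integral_sq_eq[OF sB])
  also have "ennreal k * \<dots> = ennreal (k * L2_sq ?B \<psi>)" using k by (simp add: ennreal_mult L2_inner_nonneg)
  finally have le: "L2_sq ?A (energy_pair k \<psi> D\<psi>) \<le> k * L2_sq ?B \<psi>"
    using k by (subst (asm) ennreal_le_iff) (auto simp: L2_inner_nonneg)
  \<comment> \<open>Positivity of the boundary norm is read off from the inequality itself: the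
    energy density is positive on a nonempty open set, which has positive measure, and the energy is
    at most k times the boundary term.\<close>
  have "L2_sq ?A (energy_pair k \<psi> D\<psi>) \<noteq> 0"
  proof
    assume "L2_sq ?A (energy_pair k \<psi> D\<psi>) = 0"
    then have "(\<integral>\<^sup>+x. ennreal ((norm (energy_pair k \<psi> D\<psi> x))\<^sup>2) \<partial>?A) = 0" by (simp add: nn_integral_sq_eq[OF sA])
    then have "AE x in ?A. ennreal ((norm (energy_pair k \<psi> D\<psi> x))\<^sup>2) = 0"
      by (subst (asm) nn_integral_0_iff_AE) (use sA in \<open>auto simp: sq_integrable_def\<close>)
    moreover have "AE x in ?A. x \<in> \<Omega>" by (rule AE_I2) simp
    ultimately have "AE x in ?A. False"
      by eventually_elim (use en k in \<open>auto simp: mult_eq_0_iff\<close>)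
    then have "emeasure ?A (space ?A) = 0" by (simp add: AE_iff_null null_sets_def)
    then have "emeasure lebesgue \<Omega> = 0" using \<Omega>b by (simp add: emeasure_restrict_space)
    then have "\<Omega> \<in> null_sets lebesgue" using \<Omega>b by (simp add: null_sets_def)
    then show False using open_not_negligible[OF op ne] by (simp add: negligible_iff_null_sets)
  qed
  then have "L2_sq ?A (energy_pair k \<psi> D\<psi>) > 0"
    using L2_inner_nonneg[of ?A "energy_pair k \<psi> D\<psi>"] by simp
  then have "k * L2_sq ?B \<psi> > 0" using le by linarith
  then have "L2_sq ?B \<psi> > 0" using k by (simp add: zero_less_mult_iff)
  with C1 le show ?thesis by blast
qed

theorem mainTheorem12:
  fixes \<Omega> :: "'a::euclidean_space set" and \<Lambda> :: real
  assumes "DIM('a) \<ge> 2"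
    and "bounded \<Omega>"
    and "lipschitz_domain \<Omega>"
    and "\<Lambda> < 0"
  shows "DtN_sigma1 \<Omega> \<Lambda> \<le> sqrt (- \<Lambda>)"
proof -
  note dim = assms(1) and \<Omega> = assms(2,3)
  define k where "k = sqrt (- \<Lambda>)"
  have k: "k > 0" "k\<^sup>2 = - \<Lambda>" using assms(4) by (auto simp: k_def)
  let ?A = "lebesgue_on \<Omega>" and ?B = "surface_measure \<Omega>"
  have op: "open \<Omega>" using \<Omega>(2) by (simp add: lipschitz_domain_def)
  have fin: "finite_measure ?B" by (rule finite_measure_surface[OF dim \<Omega>])
  have form: "integral\<^sup>L ?A (\<lambda>x. G x \<bullet> W x - \<Lambda> * U x * V x) = L2_inner ?A (energy_pair k U G) (energy_pair k V W)"
    for U V :: "'a \<Rightarrow> real" and G W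
    unfolding L2_inner_def
  proof (rule Bochner_Integration.integral_cong[OF refl])
    fix x
    have "k * U x * (k * V x) = k\<^sup>2 * (U x * V x)" by (simp add: power2_eq_square)
    then show "G x \<bullet> W x - \<Lambda> * U x * V x = energy_pair k U G x \<bullet> energy_pair k V W x"
      unfolding energy_pair_def using k(2) by simp
  qed
  have formB: "integral\<^sup>L ?B (\<lambda>x. \<sigma> * u x * v x) = \<sigma> * L2_inner ?B u v" for \<sigma> and u v :: "'a \<Rightarrow> real"
    unfolding L2_inner_def by (simp add: mult.assoc)
  \<comment> \<open>Minimisation runs over test functions, to which the compactness estimate applies
    directly; H1 functions with trace enter afterwards as limits.\<close>
  define C where "C = {(energy_pair k \<phi> D\<phi>, \<phi>) | \<phi> D\<phi>. C1_test \<phi> (D\<phi> :: 'a \<Rightarrow> 'a)}"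
  obtain \<psi> D\<psi> where \<psi>: "C1_test \<psi> D\<psi>" "L2_sq ?B \<psi> > 0"
    "L2_sq ?A (energy_pair k \<psi> D\<psi>) \<le> k * L2_sq ?B \<psi>"
    using exponential_rayleigh_quotient[OF dim \<Omega> k(1)] by blast
  have "\<exists>m X u Xs us. (\<forall>n. (Xs n, us n) \<in> C) \<and> L2_tendsto ?A Xs X \<and> L2_tendsto ?B us u \<and> L2_sq ?B u = 1
     \<and> (\<forall>(Y, v)\<in>C. m * L2_sq ?B v \<le> L2_sq ?A Y)
     \<and> (\<forall>(Y, v)\<in>C. L2_inner ?A X Y = m * L2_inner ?B u v)"
  proof (rule rayleigh_minimizer)
    show "sq_integrable ?A X" if "(X, u) \<in> C" for X u
      using that sq_integrable_continuous_interior[OF energy_pair_continuous \<Omega>(1) op]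
      by (auto simp: C_def C1_test_def)
    show "sq_integrable ?B u" if "(X, u) \<in> C" for X u
      using that sq_integrable_continuous_surface[OF C1_grad_continuous(1) \<Omega>(1) fin]
      by (auto simp: C_def C1_test_def)
    show "(\<lambda>x. X x + t *\<^sub>R Y x, \<lambda>x. u x + t *\<^sub>R v x) \<in> C" if Xu: "(X, u) \<in> C" and Yv: "(Y, v) \<in> C" for X u Y v t
    proof -
      from Xu obtain Du where u: "X = energy_pair k u Du" "C1_test u Du" by (auto simp: C_def)
      from Yv obtain Dv where v: "Y = energy_pair k v Dv" "C1_test v Dv" by (auto simp: C_def)
      have "(\<lambda>x. X x + t *\<^sub>R Y x) = energy_pair k (\<lambda>x. u x + t *\<^sub>R v x) (\<lambda>x. Du x + t *\<^sub>R Dv x)"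
        unfolding u v by (auto simp: energy_pair_def fun_eq_iff algebra_simps)
      moreover have "C1_test (\<lambda>x. u x + t *\<^sub>R v x) (\<lambda>x. Du x + t *\<^sub>R Dv x)"
        using C1_test_add_scaled[OF u(2) v(2), of t] by simp
      ultimately show ?thesis unfolding C_def by blast
    qed
    show "\<exists>r :: nat \<Rightarrow> nat. strict_mono r \<and> (\<forall>\<epsilon>>0. \<exists>N. \<forall>i\<ge>N. \<forall>j\<ge>N.
         L2_sq ?B (\<lambda>x. u (r i) x - u (r j) x) < \<epsilon>)"
      if XuC: "\<And>n::nat. (X n, u n) \<in> C" and K: "\<And>n. L2_sq ?A (X n) \<le> K" for X u K
    proof -
      have "\<forall>n. \<exists>Du. X n = energy_pair k (u n) Du \<and> C1_test (u n) Du"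
        using XuC by (auto simp: C_def)
      from choice[OF this] obtain Du where Du: "\<forall>n. X n = energy_pair k (u n) (Du n) \<and> C1_test (u n) (Du n)" ..
      show ?thesis
      proof (rule boundary_values_subsequence_Cauchy[OF dim \<Omega> k(1)])
        show "C1_grad (u n) (Du n)" for n using Du by (simp add: C1_test_def)
        show "L2_sq ?A (energy_pair k (u n) (Du n)) \<le> K" for n
          using K[of n] Du by simp
      qed
    qed
    show "(energy_pair k \<psi> D\<psi>, \<psi>) \<in> C" using \<psi>(1) unfolding C_def by blast
    show "L2_sq ?B \<psi> > 0" by (rule \<psi>(2))
  qed
  then obtain m X u Xs us where XsC: "\<forall>n. (Xs n, us n) \<in> C" and lim: "L2_tendsto ?A Xs X" "L2_tendsto ?B us u"
    and u1: "L2_sq ?B u = 1"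
    and low0: "\<forall>(Y, v)\<in>C. m * L2_sq ?B v \<le> L2_sq ?A Y"
    and EL0: "\<forall>(Y, v)\<in>C. L2_inner ?A X Y = m * L2_inner ?B u v"
    by (elim exE conjE)
  have low: "m * L2_sq ?B v \<le> L2_sq ?A (energy_pair k v W)" if "C1_test v W" for v W
    using low0 that unfolding C_def by blast
  have EL: "L2_inner ?A X (energy_pair k v W) = m * L2_inner ?B u v" if "C1_test v W" for v W
    using EL0 that unfolding C_def by blast
  have "\<forall>n. \<exists>Du. Xs n = energy_pair k (us n) Du \<and> C1_test (us n) Du"
    using XsC by (auto simp: C_def)
  from choice[OF this] obtain Ds where Ds: "\<forall>n. Xs n = energy_pair k (us n) (Ds n) \<and> C1_test (us n) (Ds n)" ..
  then have Xs: "Xs = (\<lambda>n. energy_pair k (us n) (Ds n))" and C1s: "\<And>n. C1_test (us n) (Ds n)" by auto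
  \<comment> \<open>The limit is merely some function with values in pairs; reading off
    \<open>U\<close> and \<open>G\<close> exhibits it as an energy pair.\<close>
  define U where "U x = fst (X x) / k" for x
  define G where "G x = snd (X x)" for x
  have X: "X = energy_pair k U G" using k(1) by (simp add: fun_eq_iff energy_pair_def U_def G_def)
  have HT: "H1 \<Omega> U G" "is_trace \<Omega> U G u"
    using L2_tendsto_H1_trace[OF \<Omega>(1) op k(1) C1s lim(1)[unfolded Xs X] lim(2)] .
  have approx: "\<exists>\<phi> D\<phi>. (\<forall>n. C1_test (\<phi> n) (D\<phi> n)) \<and>
    L2_tendsto ?A (\<lambda>n. energy_pair k (\<phi> n) (D\<phi> n)) (energy_pair k V W) \<and> L2_tendsto ?B \<phi> v"
    if "H1 \<Omega> V W" "is_trace \<Omega> V W v" for V W v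
    by (rule H1_trace_L2_tendsto[OF \<Omega>(1) op fin that])
  have sX: "sq_integrable ?A X" "sq_integrable ?B u" using lim by (auto simp: L2_tendsto_def)
  \<comment> \<open>The Euler-Lagrange equation extends from test functions to every H1 function
    with trace by approximation and continuity of the inner products.\<close>
  have weak: "L2_inner ?A X (energy_pair k V W) = m * L2_inner ?B u v" if VW: "H1 \<Omega> V W" "is_trace \<Omega> V W v" for V W v
  proof -
    obtain \<phi> D\<phi> where \<phi>: "\<And>n. C1_test (\<phi> n) (D\<phi> n)"
      "L2_tendsto ?A (\<lambda>n. energy_pair k (\<phi> n) (D\<phi> n)) (energy_pair k V W)" "L2_tendsto ?B \<phi> v"
      using approx[OF VW] by blast
    have "(\<lambda>n. L2_inner ?A X (energy_pair k (\<phi> n) (D\<phi> n))) \<longlonglongrightarrow> L2_inner ?A X (energy_pair k V W)"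
      by (rule L2_tendsto_inner[OF L2_tendsto_const[OF sX(1)] \<phi>(2)])
    moreover have "(\<lambda>n. L2_inner ?A X (energy_pair k (\<phi> n) (D\<phi> n))) \<longlonglongrightarrow> m * L2_inner ?B u v"
      unfolding EL[OF \<phi>(1)]
      by (intro tendsto_mult tendsto_const L2_tendsto_inner[OF L2_tendsto_const[OF sX(2)] \<phi>(3)])
    ultimately show ?thesis by (rule LIMSEQ_unique)
  qed
  \<comment> \<open>Translates the nontriviality condition of \<open>DtN_eigenvalue\<close> into
    positivity of the boundary norm.\<close>
  have zero: "L2_sq ?B w = 0 \<longleftrightarrow> (AE x in ?B. w x = 0)" if "sq_integrable ?B w" for w :: "'a \<Rightarrow> real"
    unfolding L2_inner_def using that integral_nonneg_eq_0_iff_AE[of ?B "\<lambda>x. (w x)\<^sup>2"]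
    by (simp add: sq_integrable_def power2_eq_square)
  have eig: "DtN_eigenvalue \<Omega> \<Lambda> m"
    unfolding DtN_eigenvalue_def form formB
  proof (rule exI[of _ U], rule exI[of _ G], rule exI[of _ u], intro conjI allI impI HT)
    show "\<not> (AE x in ?B. u x = 0)" using zero[OF sX(2)] u1 by simp
    show "L2_inner ?A (energy_pair k U G) (energy_pair k V W) = m * L2_inner ?B u v"
      if "H1 \<Omega> V W \<and> is_trace \<Omega> V W v" for V W v
      using weak[of V W v] that unfolding X by simp
  qed
  \<comment> \<open>Testing an eigenfunction with itself shows that its Rayleigh quotient is
    \<sigma>; the lower bound m reaches it through its approximating test functions.\<close>
  have least: "m \<le> \<sigma>" if "DtN_eigenvalue \<Omega> \<Lambda> \<sigma>" for \<sigma>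
  proof -
    from that obtain V W v where "H1 \<Omega> V W \<and> is_trace \<Omega> V W v \<and> \<not> (AE x in ?B. v x = 0) \<and>
      (\<forall>V' W' v'. H1 \<Omega> V' W' \<and> is_trace \<Omega> V' W' v' \<longrightarrow>
        L2_inner ?A (energy_pair k V W) (energy_pair k V' W') = \<sigma> * L2_inner ?B v v')"
      unfolding DtN_eigenvalue_def form formB by (elim exE)
    then have V: "H1 \<Omega> V W" "is_trace \<Omega> V W v" "\<not> (AE x in ?B. v x = 0)"
      and eq: "L2_sq ?A (energy_pair k V W) = \<sigma> * L2_sq ?B v"
      by simp_all
    obtain \<phi> D\<phi> where \<phi>: "\<And>n. C1_test (\<phi> n) (D\<phi> n)"
      "L2_tendsto ?A (\<lambda>n. energy_pair k (\<phi> n) (D\<phi> n)) (energy_pair k V W)" "L2_tendsto ?B \<phi> v"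
      using approx[OF V(1,2)] by blast
    have "(\<lambda>n. m * L2_sq ?B (\<phi> n)) \<longlonglongrightarrow> m * L2_sq ?B v"
      by (intro tendsto_mult tendsto_const L2_tendsto_inner[OF \<phi>(3) \<phi>(3)])
    moreover have "(\<lambda>n. L2_sq ?A (energy_pair k (\<phi> n) (D\<phi> n)))
        \<longlonglongrightarrow> \<sigma> * L2_sq ?B v"
      unfolding eq[symmetric] by (rule L2_tendsto_inner[OF \<phi>(2) \<phi>(2)])
    ultimately have "m * L2_sq ?B v \<le> \<sigma> * L2_sq ?B v"
      by (rule LIMSEQ_le) (use low[OF \<phi>(1)] in blast)
    moreover have "sq_integrable ?B v" using \<phi>(3) by (simp add: L2_tendsto_def)
    then have "L2_sq ?B v > 0" using zero[of v] V(3) L2_inner_nonneg[of ?B v] by (simp add: less_le)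
    ultimately show ?thesis by simp
  qed
  have "DtN_sigma1 \<Omega> \<Lambda> = m"
    unfolding DtN_sigma1_def by (rule Least_equality) (fact eig, rule least)
  \<comment> \<open>The truncated exponential belongs to the class on which m bounds the Rayleigh
    quotient from below.\<close>
  moreover have "m * L2_sq ?B \<psi> \<le> k * L2_sq ?B \<psi>"
    using low[OF \<psi>(1)] \<psi>(3) by (rule order_trans)
  then have "m \<le> k" using \<psi>(2) by simp
  ultimately show ?thesis unfolding k_def by simp
qed

end
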